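(* Let $b>0$, $\beta\in\mathbb{R}$ and $V(\lambda,y)=\lambda\mathbf{1}_{|y|\ge b}+\beta\mathbf{1}_{|y|<b}+\alpha\delta_0(y)$, and let $k_*\in\mathbb{N}$ and $\lambda_*<1$ be given. Suppose one of the following holds: (Case $\beta>1$) $b,\alpha>0$ are determined by $b=\frac{\pi}{\sqrt{\beta-1}}$, $\alpha=\frac{2\sqrt{1-\lambda_*}}{k_*}$; (Case $\beta<1$) $b>0$ is given and $$\alpha=\frac{2\sqrt{1-\beta}}{k_*}\cdot\frac{\sqrt{1-\beta}\sinh(k_*\sqrt{1-\beta}\,b)+\sqrt{1-\lambda_*}\cosh(k_*\sqrt{1-\beta}\,b)}{\sqrt{1-\beta}\cosh(k_*\sqrt{1-\beta}\,b)+\sqrt{1-\lambda_*}\sinh(k_*\sqrt{1-\beta}\,b)};$$ (Case $\beta=1$) $b>0$ is given and $\alpha=\frac{2\sqrt{1-\lambda_*}}{k_*(1+\sqrt{1-\lambda_*}\,k_*b)}$. Set $V_0=\mathbf{1}_{|y|\ge b}$, $W=\beta\mathbf{1}_{|y|<b}$, $L_\lambda^k=-\frac{d^2}{dy^2}+k^2(1-\lambda V_0-W-\alpha\delta_0)$ and $L_{0,\lambda}^k=-\frac{d^2}{dy^2}+k^2(1-\lambda V_0-W)$ for $k\in\mathbb{N}$, $\lambda\in\mathbb{R}$. Then in all three cases: (a) $V_0,W\in L^\infty(\mathbb{R})$ are even; (b) there is an interval $I\subset\mathbb{R}$ such that $L_{0,\lambda}^k:H^2(\mathbb{R})\subset L^2(\mathbb{R})\to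 L^2(\mathbb{R})$ satisfies $0\in\rho(L_{0,\lambda}^k)$ for all $k\in\mathbb{N}$, $\lambda\in I$; (c) there is an open interval $I_{\lambda_*}\subset I$ containing $\lambda_*$ such that zero is an isolated simple eigenvalue of $L_{\lambda_*}^{k_*}$ and $0\in\rho(L_\lambda^k)$ for all $(k,\lambda)\in\mathbb{N}\times I_{\lambda_*}$ with $(k,\lambda)\ne(k_*,\lambda_* )$; (d) there is $C>0$ such that $\|\phi_k(\cdot;\lambda)\|_{L^2(0,\infty)}\le C$ for all $\lambda\in I_{\lambda_*}$, $k\in\mathbb{N}$, where $\phi_k(\cdot;\lambda)\in H^2(0,\infty)$ satisfies $L_{0,\lambda}^k\phi_k(\cdot;\lambda)=0$ on $(0,\infty)$ and $\phi_k(0;\lambda)=1$; (e) $\langle V_0\phi^*,\phi^*\rangle_{L^2(\mathbb{R})}\neq0$, where $\phi^*$ spans the kernel of $L_{\lambda_*}^{k_*}$.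
   Context: $\mathbb{N}=\{1,2,\dots\}$; $\rho(\cdot)$ is the resolvent set; $\mathbf{1}_A$ is the indicator function. $L_\lambda^k$ is the operator in $L^2(\mathbb{R})$ with domain $D(L_\lambda^k)=\{\phi\in H^1(\mathbb{R}):\phi\in H^2(-\infty,0)\cap H^2(0,\infty),\ \phi'(0_+)-\phi'(0_-)=-k^2\alpha\phi(0)\}$, acting as $-\phi''+k^2(1-\lambda V_0-W)\phi$ on $\mathbb{R}\setminus\{0\}$. The functions $\phi_k(\cdot;\lambda)$ in (d) exist and are unique as a consequence of (b). *)

theory Defs
  imports "HOL-Analysis.Analysis"
begin

section \<open>The Hilbert space of square-integrable functions on the real line\<close>

text \<open>
  Square-integrable functions are taken Borel measurable; every Lebesgue measurable function agrees
  almost everywhere with a Borel one, so this gives the usual space of equivalence classes.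
\<close>

definition square_integrable_on :: "(real \<Rightarrow> complex) \<Rightarrow> real set \<Rightarrow> bool"
    (infixr \<open>square'_integrable'_on\<close> 46)
  where "f square_integrable_on S \<longleftrightarrow>
    set_borel_measurable lborel S f \<and> set_integrable lborel S (\<lambda>y. (norm (f y))\<^sup>2)"

definition L2_norm_on :: "real set \<Rightarrow> (real \<Rightarrow> complex) \<Rightarrow> real"
  where "L2_norm_on S f = sqrt (LINT y:S|lborel. (norm (f y))\<^sup>2)"

definition L2_rel :: "(real \<Rightarrow> complex) \<Rightarrow> (real \<Rightarrow> complex) \<Rightarrow> bool"
  where "L2_rel f g \<longleftrightarrow>
    f square_integrable_on UNIV \<and> g square_integrable_on UNIV \<and> (AE y in lborel. f y = g y)"

lemma square_integrable_on_UNIV_iff: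
  "f square_integrable_on UNIV \<longleftrightarrow>
    f \<in> borel_measurable lborel \<and> integrable lborel (\<lambda>y. (norm (f y))\<^sup>2)"
  by (simp add: square_integrable_on_def set_borel_measurable_def set_integrable_def)

lemma square_integrable_mult:
  assumes "f square_integrable_on UNIV" "g square_integrable_on UNIV"
  shows "integrable lborel (\<lambda>y. norm (f y) * norm (g y))"
proof (rule Bochner_Integration.integrable_bound)
  show "integrable lborel (\<lambda>y. (norm (f y))\<^sup>2 + (norm (g y))\<^sup>2)"
    using assms by (auto simp: square_integrable_on_UNIV_iff)
  show "(\<lambda>y. norm (f y) * norm (g y)) \<in> borel_measurable lborel"
    using assms by (auto simp: square_integrable_on_UNIV_iff)
  have "a * b \<le> a\<^sup>2 + b\<^sup>2" if "0 \<le> a" "0 \<le> b" for a b :: real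
    using sum_squares_bound [of a b] mult_nonneg_nonneg [OF that] by linarith
  then show "AE y in lborel. norm (norm (f y) * norm (g y))
      \<le> norm ((norm (f y))\<^sup>2 + (norm (g y))\<^sup>2)"
    by simp
qed

lemma square_integrable_inner:
  assumes "f square_integrable_on UNIV" "g square_integrable_on UNIV"
  shows "integrable lborel (\<lambda>y. inner (f y) (g y))"
  by (rule Bochner_Integration.integrable_bound [OF square_integrable_mult [OF assms]])
    (use assms in \<open>auto simp: square_integrable_on_UNIV_iff Cauchy_Schwarz_ineq2\<close>)

lemma square_integrable_add:
  assumes "f square_integrable_on UNIV" "g square_integrable_on UNIV"
  shows "(\<lambda>y. f y + g y) square_integrable_on UNIV"
proof -
  have "integrable lborel (\<lambda>y. (norm (f y))\<^sup>2 + (norm (g y))\<^sup>2 + 2 * inner (f y) (g y))"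
    using assms square_integrable_inner [OF assms]
    by (auto simp: square_integrable_on_UNIV_iff)
  then have "integrable lborel (\<lambda>y. (norm (f y + g y))\<^sup>2)"
    by (simp add: power2_norm_eq_inner inner_add_left inner_add_right inner_commute algebra_simps)
  then show ?thesis
    using assms by (auto simp: square_integrable_on_UNIV_iff)
qed

lemma square_integrable_cmult:
  assumes "f square_integrable_on UNIV"
  shows "(\<lambda>y. c * f y) square_integrable_on UNIV"
  using assms by (auto simp: square_integrable_on_UNIV_iff norm_mult power_mult_distrib)

lemma square_integrable_zero: "(\<lambda>_. 0) square_integrable_on UNIV"
  by (simp add: square_integrable_on_UNIV_iff)

quotient_type L2 = "real \<Rightarrow> complex" / partial: L2_rel
  morphisms rep_L2 abs_L2
proof (rule part_equivpI)
  show "\<exists>f. L2_rel f f"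
    using square_integrable_zero by (auto simp: L2_rel_def)
  show "symp L2_rel"
    by (auto simp: symp_def L2_rel_def elim!: eventually_mono)
  show "transp L2_rel"
    by (auto simp: transp_def L2_rel_def elim: eventually_elim2)
qed

instantiation L2 :: real_inner
begin

lift_definition zero_L2 :: L2 is "\<lambda>_. 0"
  by (simp add: L2_rel_def square_integrable_zero)

lift_definition plus_L2 :: "L2 \<Rightarrow> L2 \<Rightarrow> L2" is "\<lambda>f g y. f y + g y"
  by (auto simp: L2_rel_def square_integrable_add elim: eventually_elim2)

lift_definition uminus_L2 :: "L2 \<Rightarrow> L2" is "\<lambda>f y. - f y"
  by (auto simp: L2_rel_def square_integrable_on_UNIV_iff)

definition minus_L2 :: "L2 \<Rightarrow> L2 \<Rightarrow> L2"
  where "u - v = u + - v" for u v :: L2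

lift_definition scaleR_L2 :: "real \<Rightarrow> L2 \<Rightarrow> L2" is "\<lambda>r f y. r *\<^sub>R f y"
  by (auto simp: L2_rel_def scaleR_conv_of_real square_integrable_cmult)

lift_definition inner_L2 :: "L2 \<Rightarrow> L2 \<Rightarrow> real" is "\<lambda>f g. LINT y|lborel. inner (f y) (g y)"
  unfolding L2_rel_def
  by (rule integral_cong_AE) (auto simp: square_integrable_on_UNIV_iff)

definition norm_L2 :: "L2 \<Rightarrow> real"
  where "norm u = sqrt (inner u u)" for u :: L2

definition sgn_L2 :: "L2 \<Rightarrow> L2"
  where "sgn u = inverse (norm u) *\<^sub>R u" for u :: L2

definition dist_L2 :: "L2 \<Rightarrow> L2 \<Rightarrow> real"
  where "dist u v = norm (u - v)" for u v :: L2

definition uniformity_L2 :: "(L2 \<times> L2) filter"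
  where "uniformity_L2 = (INF e\<in>{0<..}. principal {(u, v). dist u v < e})"

definition open_L2 :: "L2 set \<Rightarrow> bool"
  where "open_L2 U \<longleftrightarrow> (\<forall>u\<in>U. \<forall>\<^sub>F (u', v) in uniformity. u' = u \<longrightarrow> v \<in> U)"

instance
proof
  fix u v w :: L2 and a b r :: real and U :: "L2 set"
  show "u + v + w = u + (v + w)"
    by transfer (auto simp: L2_rel_def add.assoc square_integrable_add)
  show "u + v = v + u"
    by transfer (auto simp: L2_rel_def add.commute square_integrable_add)
  show "0 + u = u"
    by transfer (auto simp: L2_rel_def)
  show "- u + u = 0"
    by transfer (auto simp: L2_rel_def square_integrable_zero)
  show "u - v = u + - v"
    by (fact minus_L2_def)
  show "a *\<^sub>R (u + v) = a *\<^sub>R u + a *\<^sub>R v"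
    by transfer (auto simp: L2_rel_def scaleR_conv_of_real distrib_left distrib_right
        intro!: square_integrable_add square_integrable_cmult)
  show "(a + b) *\<^sub>R u = a *\<^sub>R u + b *\<^sub>R u"
    by transfer (auto simp: L2_rel_def scaleR_conv_of_real distrib_left distrib_right
        intro!: square_integrable_add square_integrable_cmult)
  show "a *\<^sub>R b *\<^sub>R u = (a * b) *\<^sub>R u"
    by transfer (auto simp: L2_rel_def scaleR_conv_of_real mult.assoc
        intro!: square_integrable_cmult)
  show "1 *\<^sub>R u = u"
    by transfer (auto simp: L2_rel_def)
  show "sgn u = inverse (norm u) *\<^sub>R u"
    by (fact sgn_L2_def)
  show "dist u v = norm (u - v)"
    by (fact dist_L2_def)
  show "uniformity = (INF e\<in>{0<..}. principal {(u :: L2, v). dist u v < e})"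
    by (fact uniformity_L2_def)
  show "open U \<longleftrightarrow> (\<forall>u\<in>U. \<forall>\<^sub>F (u', v) in uniformity. u' = u \<longrightarrow> v \<in> U)"
    by (fact open_L2_def)
  show "inner u v = inner v u"
    by transfer (simp add: inner_commute)
  show "inner (u + v) w = inner u w + inner v w"
    by transfer (simp add: L2_rel_def inner_add_left square_integrable_inner)
  show "inner (r *\<^sub>R u) v = r * inner u v"
    by transfer simp
  show "0 \<le> inner u u"
    by transfer simp
  show "inner u u = 0 \<longleftrightarrow> u = 0"
    by transfer (auto simp: L2_rel_def square_integrable_inner square_integrable_zero
        integral_nonneg_eq_0_iff_AE)
  show "norm u = sqrt (inner u u)"
    by (fact norm_L2_def)
qed

end

lift_definition scaleC_L2 :: "complex \<Rightarrow> L2 \<Rightarrow> L2" (infixr \<open>*\<^sub>C\<close> 75) is "\<lambda>c f y. c * f y"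
  by (auto simp: L2_rel_def square_integrable_cmult)

global_interpretation L2: vector_space scaleC_L2
proof
  fix c d :: complex and u v :: L2
  show "c *\<^sub>C (u + v) = c *\<^sub>C u + c *\<^sub>C v"
    by transfer (auto simp: L2_rel_def distrib_left distrib_right
        intro!: square_integrable_add square_integrable_cmult)
  show "(c + d) *\<^sub>C u = c *\<^sub>C u + d *\<^sub>C u"
    by transfer (auto simp: L2_rel_def distrib_left distrib_right
        intro!: square_integrable_add square_integrable_cmult)
  show "c *\<^sub>C d *\<^sub>C u = (c * d) *\<^sub>C u"
    by transfer (auto simp: L2_rel_def mult.assoc intro!: square_integrable_cmult)
  show "1 *\<^sub>C u = u"
    by transfer (auto simp: L2_rel_def)
qed

lemma borel_measurable_cnj: "cnj \<in> borel_measurable borel"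
  by (intro borel_measurable_continuous_onI continuous_intros)

lift_definition cinner_L2 :: "L2 \<Rightarrow> L2 \<Rightarrow> complex" is "\<lambda>f g. LINT y|lborel. f y * cnj (g y)"
  unfolding L2_rel_def
  by (rule integral_cong_AE)
    (auto simp: square_integrable_on_UNIV_iff
      intro!: borel_measurable_times measurable_compose [OF _ borel_measurable_cnj])


section \<open>Unbounded operators: resolvent set, spectrum, eigenvalues\<close>

text \<open>
  An operator is given by its domain \<open>D\<close> and a map \<open>A\<close> whose values outside \<open>D\<close> are irrelevant.
\<close>

definition resolvent_set :: "L2 set \<Rightarrow> (L2 \<Rightarrow> L2) \<Rightarrow> complex set"
  where "resolvent_set D A = {z. bij_betw (\<lambda>u. A u - z *\<^sub>C u) D UNIV \<and>
    (\<exists>C. \<forall>u\<in>D. norm u \<le> C * norm (A u - z *\<^sub>C u))}"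

definition spectrum :: "L2 set \<Rightarrow> (L2 \<Rightarrow> L2) \<Rightarrow> complex set"
  where "spectrum D A = - resolvent_set D A"

definition kernel :: "L2 set \<Rightarrow> (L2 \<Rightarrow> L2) \<Rightarrow> L2 set"
  where "kernel D A = {u \<in> D. A u = 0}"

text \<open>
  Simplicity is algebraic: the eigenspace is one-dimensional and there are no Jordan chains. (For
  self-adjoint operators the second requirement is automatic.)
\<close>

definition simple_eigenvalue :: "L2 set \<Rightarrow> (L2 \<Rightarrow> L2) \<Rightarrow> complex \<Rightarrow> bool"
  where "simple_eigenvalue D A z \<longleftrightarrow>
    L2.dim (kernel D (\<lambda>u. A u - z *\<^sub>C u)) = 1 \<and>
    (\<forall>u\<in>D. A u - z *\<^sub>C u \<in> kernel D (\<lambda>u. A u - z *\<^sub>C u) \<longrightarrow> A u - z *\<^sub>C u = 0)"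

definition isolated_simple_eigenvalue :: "L2 set \<Rightarrow> (L2 \<Rightarrow> L2) \<Rightarrow> complex \<Rightarrow> bool"
  where "isolated_simple_eigenvalue D A z \<longleftrightarrow>
    simple_eigenvalue D A z \<and> z isolated_in spectrum D A"


section \<open>Weak derivatives, Sobolev spaces and traces\<close>

definition test_function :: "real set \<Rightarrow> (real \<Rightarrow> real) \<Rightarrow> bool"
  where "test_function S \<psi> \<longleftrightarrow>
    (\<forall>n x. (deriv ^^ n) \<psi> field_differentiable at x) \<and>
    (\<exists>K. compact K \<and> K \<subseteq> S \<and> (\<forall>x. x \<notin> K \<longrightarrow> \<psi> x = 0))"

definition locally_integrable_on :: "(real \<Rightarrow> complex) \<Rightarrow> real set \<Rightarrow> bool"
    (infixr \<open>locally'_integrable'_on\<close> 46)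
  where "f locally_integrable_on S \<longleftrightarrow> (\<forall>K. compact K \<longrightarrow> K \<subseteq> S \<longrightarrow> set_integrable lborel K f)"

definition has_weak_derivative_on ::
    "(real \<Rightarrow> complex) \<Rightarrow> (real \<Rightarrow> complex) \<Rightarrow> real set \<Rightarrow> bool"
  where "has_weak_derivative_on f g S \<longleftrightarrow>
    f locally_integrable_on S \<and> g locally_integrable_on S \<and>
    (\<forall>\<psi>. test_function S \<psi> \<longrightarrow>
      (LINT y:S|lborel. deriv \<psi> y *\<^sub>R f y) = - (LINT y:S|lborel. \<psi> y *\<^sub>R g y))"

text \<open>The weak derivative is determined only almost everywhere on \<open>S\<close>.\<close>

definition weak_deriv :: "real set \<Rightarrow> (real \<Rightarrow> complex) \<Rightarrow> real \<Rightarrow> complex"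
  where "weak_deriv S f = (SOME g. has_weak_derivative_on f g S)"

primrec sobolev_H :: "nat \<Rightarrow> real set \<Rightarrow> (real \<Rightarrow> complex) \<Rightarrow> bool"
  where
    "sobolev_H 0 S f \<longleftrightarrow> f square_integrable_on S"
  | "sobolev_H (Suc m) S f \<longleftrightarrow>
      f square_integrable_on S \<and> (\<exists>g. has_weak_derivative_on f g S \<and> sobolev_H m S g)"

text \<open>
  The value at \<open>x \<in> closure S\<close> of the representative of \<open>f\<close> that is continuous on \<open>closure S\<close>. For
  \<open>S = {0<..}\<close> and \<open>x = 0\<close> this is the one-sided value at \<open>0\<^sub>+\<close>, for \<open>S = {..<0}\<close> the one at \<open>0\<^sub>-\<close>.
\<close>

definition trace_at :: "real set \<Rightarrow> (real \<Rightarrow> complex) \<Rightarrow> real \<Rightarrow> complex"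
  where "trace_at S f x =
    (THE c. \<exists>g. continuous_on (closure S) g \<and> (AE y\<in>S in lborel. g y = f y) \<and> g x = c)"


section \<open>The potentials and the Schroedinger operators\<close>

definition L_infinity :: "(real \<Rightarrow> real) \<Rightarrow> bool"
  where "L_infinity f \<longleftrightarrow> f \<in> borel_measurable lborel \<and> (\<exists>C. AE y in lborel. \<bar>f y\<bar> \<le> C)"

definition mult_L2 :: "(real \<Rightarrow> real) \<Rightarrow> L2 \<Rightarrow> L2"
  where "mult_L2 V u = abs_L2 (\<lambda>y. of_real (V y) * rep_L2 u y)"

definition V0 :: "real \<Rightarrow> real \<Rightarrow> real"
  where "V0 b = indicator {y. \<bar>y\<bar> \<ge> b}"

definition W :: "real \<Rightarrow> real \<Rightarrow> real \<Rightarrow> real"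
  where "W b \<beta> y = \<beta> * indicator {y. \<bar>y\<bar> < b} y"

text \<open>The differential expression \<open>- \<phi>'' + k\<^sup>2 (1 - lam \<cdot> V\<^sub>0 - W) \<phi>\<close> on the open set \<open>S\<close>.\<close>

definition diff_expr ::
    "real \<Rightarrow> real \<Rightarrow> nat \<Rightarrow> real \<Rightarrow> real set \<Rightarrow> (real \<Rightarrow> complex) \<Rightarrow> real \<Rightarrow> complex"
  where "diff_expr b \<beta> k lam S \<phi> y =
    - weak_deriv S (weak_deriv S \<phi>) y
    + of_real ((real k)\<^sup>2 * (1 - lam * V0 b y - W b \<beta> y)) * \<phi> y"

definition L0_dom :: "L2 set"
  where "L0_dom = {u. sobolev_H 2 UNIV (rep_L2 u)}"

definition L0_op :: "real \<Rightarrow> real \<Rightarrow> nat \<Rightarrow> real \<Rightarrow> L2 \<Rightarrow> L2"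
  where "L0_op b \<beta> k lam u = abs_L2 (diff_expr b \<beta> k lam UNIV (rep_L2 u))"

definition L_dom :: "real \<Rightarrow> nat \<Rightarrow> L2 set"
  where "L_dom \<alpha> k = {u. let \<phi> = rep_L2 u in
    sobolev_H 1 UNIV \<phi> \<and> sobolev_H 2 {..<0} \<phi> \<and> sobolev_H 2 {0<..} \<phi> \<and>
    trace_at {0<..} (weak_deriv {0<..} \<phi>) 0 - trace_at {..<0} (weak_deriv {..<0} \<phi>) 0
      = - of_real ((real k)\<^sup>2 * \<alpha>) * trace_at UNIV \<phi> 0}"

text \<open>The delta potential acts only through the jump condition in the domain.\<close>

definition L_op :: "real \<Rightarrow> real \<Rightarrow> nat \<Rightarrow> real \<Rightarrow> L2 \<Rightarrow> L2"
  where "L_op b \<beta> k lam u = abs_L2 (diff_expr b \<beta> k lam (- {0}) (rep_L2 u))"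

definition half_line_solution ::
    "real \<Rightarrow> real \<Rightarrow> nat \<Rightarrow> real \<Rightarrow> (real \<Rightarrow> complex) \<Rightarrow> bool"
  where "half_line_solution b \<beta> k lam \<phi> \<longleftrightarrow>
    sobolev_H 2 {0<..} \<phi> \<and>
    (AE y\<in>{0<..} in lborel. diff_expr b \<beta> k lam {0<..} \<phi> y = 0) \<and>
    trace_at {0<..} \<phi> 0 = 1"

end

theory Submission
  imports Defs "HOL-Complex_Analysis.Complex_Analysis"
begin

text \<open>
  Away from \<open>0\<close> and \<open>\<plusminus>b\<close> the equation has constant coefficients, so everything can be read off the
  solution \<open>\<phi>\<close> on the half-line that decays at infinity. Put \<open>w\<^sup>2 = k\<^sup>2 (1 - \<beta>) - z\<close> and
  \<open>\<kappa>\<^sup>2 = k\<^sup>2 (1 - lam) - z\<close> with \<open>Re \<kappa> > 0\<close>. Continuing \<open>exp (- \<kappa> (y - b))\<close> to the left gives the value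
  \<open>EE = cosh (w b) + \<kappa> sinh (w b) / w\<close> and the derivative \<open>- NN\<close> with
  \<open>NN = w sinh (w b) + \<kappa> cosh (w b)\<close> at \<open>0\<close>. If \<open>EE \<noteq> 0\<close>, the Dirichlet problem on the half-line is
  solved by a Green function with exponentially decaying kernel, and the problem with the point
  interaction reduces to one scalar equation with coefficient \<open>2 NN / EE - k\<^sup>2 \<alpha>\<close>. So \<open>z\<close> is in the
  resolvent set when \<open>EE \<noteq> 0\<close> and \<open>2 NN \<noteq> k\<^sup>2 \<alpha> EE\<close>.

  At \<open>z = 0\<close> the resonance condition is \<open>G k (sqrt (1 - lam)) = \<alpha>\<close> for a function \<open>G k s\<close> that is strictly
  decreasing in \<open>k\<close> and strictly increasing and continuous in \<open>s\<close>; this isolates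
  \<open>(k_star, lam_star)\<close>, uniformly in \<open>k\<close>. The eigenvalue is isolated since \<open>w EE\<close> and
  \<open>w (2 NN - k\<^sup>2 \<alpha> EE)\<close> are holomorphic in \<open>w\<close> and have no zeros at non-real \<open>z\<close>, and it is simple
  because a Jordan chain would force \<open>\<integral> \<phi>\<^sup>2 = 0\<close> for the real function \<open>\<phi>\<close>.
\<close>

section \<open>Smooth cut-off functions\<close>

text \<open>The operators are built from weak derivatives chosen by \<open>SOME\<close> and traces
  defined by \<open>THE\<close>, so nothing can be computed before these are tied to actual
  functions. The bridge is the Lebesgue primitive on an interval that may contain its endpoint:
  Sobolev functions agree almost everywhere with such primitives, and product rule and Wronskian
  survive at this low regularity. Establishing the bridge needs explicit test functions, hence the
  cut-offs. For \<beta> > 1 the width b = pi / sqrt (\<beta> - 1) makes the transfer matrix across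
  [0, b] equal to plus or minus the identity for every k at once; this keeps \<open>EE\<close> away
  from 0 uniformly in k and makes the resonance condition explicit. Isolation of the eigenvalue is
  studied in \<open>w\<close> rather than in \<open>z\<close>, because for \<beta> = 1 the point z =
  0 is a branch point of the root \<open>w\<close>. The operator without point interaction is the
  case of coupling 0, so its invertibility comes down to \<open>G\<close> being positive.\<close>

definition smooth_upto :: "nat \<Rightarrow> (real \<Rightarrow> real) \<Rightarrow> bool"
  where "smooth_upto n f \<longleftrightarrow> (\<forall>m<n. \<forall>x. (deriv ^^ m) f field_differentiable at x)"

lemma smooth_upto_0 [simp]: "smooth_upto 0 f"
  by (simp add: smooth_upto_def)

lemma smooth_upto_Suc:
  "smooth_upto (Suc n) f \<longleftrightarrow> (\<forall>x. f field_differentiable at x) \<and> smooth_upto n (deriv f)"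
proof -
  have "smooth_upto (Suc n) f \<longleftrightarrow>
      (\<forall>x. f field_differentiable at x) \<and> (\<forall>m<n. \<forall>x. (deriv ^^ Suc m) f field_differentiable at x)"
    unfolding smooth_upto_def using less_Suc_eq_0_disj by auto
  then show ?thesis
    by (simp only: smooth_upto_def funpow_Suc_right o_apply)
qed

lemma smooth_upto_SucI:
  assumes "\<And>x. (f has_field_derivative f' x) (at x)" "smooth_upto n f'"
  shows "smooth_upto (Suc n) f"
proof -
  have "deriv f = f'"
    using assms(1) DERIV_imp_deriv by blast
  then show ?thesis
    using assms field_differentiable_def smooth_upto_Suc by metis
qed

lemma smooth_upto_mono: "smooth_upto n f \<Longrightarrow> m \<le> n \<Longrightarrow> smooth_upto m f"
  by (auto simp: smooth_upto_def)

lemma smooth_upto_DERIV: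
  "smooth_upto (Suc n) f \<Longrightarrow> (f has_field_derivative deriv f x) (at x)"
  by (simp add: DERIV_deriv_iff_field_differentiable smooth_upto_Suc)

lemma smooth_upto_add:
  "smooth_upto n f \<Longrightarrow> smooth_upto n g \<Longrightarrow> smooth_upto n (\<lambda>x. f x + g x)"
proof (induction n arbitrary: f g)
  case (Suc n)
  show ?case
  proof (rule smooth_upto_SucI)
    show "((\<lambda>x. f x + g x) has_field_derivative deriv f x + deriv g x) (at x)" for x
      using Suc.prems by (auto intro!: derivative_eq_intros smooth_upto_DERIV)
  qed (use Suc in \<open>auto simp: smooth_upto_Suc\<close>)
qed simp

text \<open>Counting finitely many derivatives gives an induction parameter: the derivative of a
  product is a sum of two products whose factors are smooth to one order less.\<close>

lemma smooth_upto_mult: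
  "smooth_upto n f \<Longrightarrow> smooth_upto n g \<Longrightarrow> smooth_upto n (\<lambda>x. f x * g x)"
proof (induction n arbitrary: f g)
  case (Suc n)
  show ?case
  proof (rule smooth_upto_SucI)
    show "((\<lambda>x. f x * g x) has_field_derivative deriv f x * g x + f x * deriv g x) (at x)" for x
      using Suc.prems by (auto intro!: derivative_eq_intros smooth_upto_DERIV)
    show "smooth_upto n (\<lambda>x. deriv f x * g x + f x * deriv g x)"
      using Suc.prems smooth_upto_mono[of "Suc n" _ n]
      by (intro smooth_upto_add Suc.IH) (auto simp: smooth_upto_Suc)
  qed
qed simp

lemma smooth_upto_const: "smooth_upto n (\<lambda>_. c)"
proof (induction n arbitrary: c)
  case (Suc n)
  then show ?case
    by (intro smooth_upto_SucI[where f' = "\<lambda>_. 0"]) auto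
qed simp

lemma smooth_upto_affine:
  "smooth_upto n f \<Longrightarrow> smooth_upto n (\<lambda>x. f (c * x + d))"
proof (induction n arbitrary: f)
  case (Suc n)
  show ?case
  proof (rule smooth_upto_SucI)
    show "((\<lambda>x. f (c * x + d)) has_field_derivative c * deriv f (c * x + d)) (at x)" for x
    proof -
      have "((\<lambda>x. c * x + d) has_field_derivative c) (at x)"
        by (auto intro!: derivative_eq_intros)
      from DERIV_chain2[OF smooth_upto_DERIV[OF Suc.prems] this] show ?thesis
        by (simp add: mult.commute)
    qed
    show "smooth_upto n (\<lambda>x. c * deriv f (c * x + d))"
      using Suc by (intro smooth_upto_mult smooth_upto_const) (auto simp: smooth_upto_Suc)
  qed
qed simp

text \<open>For p = 1 this is the classical smooth function that is flat at 0. Polynomial prefactors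
  are included because the family is then closed under differentiation, so that smoothness of every
  order is a single induction.\<close>

definition flat :: "real poly \<Rightarrow> real \<Rightarrow> real"
  where "flat p x = (if x > 0 then poly p (1 / x) * exp (- (1 / x)) else 0)"

lemma poly_exp_tendsto_0: "((\<lambda>t. poly p t * exp (- t)) \<longlongrightarrow> (0::real)) at_top"
proof -
  have "((\<lambda>t. \<Sum>i\<le>degree p. coeff p i * (t ^ i / exp t)) \<longlongrightarrow> (\<Sum>i\<le>degree p. coeff p i * 0)) at_top"
    by (intro tendsto_sum tendsto_mult tendsto_const tendsto_power_div_exp_0)
  then show ?thesis
    by (simp add: poly_altdef exp_minus divide_inverse sum_distrib_right mult.assoc)
qed

lemma flat_tendsto_0: "(flat p \<longlongrightarrow> 0) (at 0)"
proof -
  have "((\<lambda>x. poly p (1 / x) * exp (- (1 / x))) \<longlongrightarrow> 0) (at_right 0)"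
    using filterlim_compose[OF poly_exp_tendsto_0[of p] filterlim_inverse_at_top_right]
    by (simp add: divide_inverse)
  then have "(flat p \<longlongrightarrow> 0) (at_right 0)"
    by (rule tendsto_cong[THEN iffD1, rotated])
      (auto simp: flat_def intro: eventually_mono[OF eventually_at_right_less])
  moreover have "(flat p \<longlongrightarrow> 0) (at_left 0)"
    by (rule tendsto_eventually) (auto simp: flat_def intro!: eventually_at_leftI[of "-1"])
  ultimately show ?thesis
    by (simp add: filterlim_split_at)
qed

text \<open>With t = 1/x, differentiating p(t) exp(-t) in x gives t^2 (p - p')(t) exp(-t), and
  \<open>[:0, 0, 1:]\<close> is the factor t^2. At x = 0 the derivative vanishes by the decay of the
  exponential.\<close>

lemma flat_DERIV:
  "(flat p has_field_derivative flat ([:0, 0, 1:] * (p - pderiv p)) x) (at x)"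
proof -
  consider "x > 0" | "x < 0" | "x = 0" by linarith
  then show ?thesis
  proof cases
    case 1
    have "((\<lambda>x. poly p (1 / x) * exp (- (1 / x))) has_field_derivative
        flat ([:0, 0, 1:] * (p - pderiv p)) x) (at x)"
      using 1 by (auto intro!: derivative_eq_intros simp: flat_def power2_eq_square field_simps)
    then show ?thesis
      by (rule has_field_derivative_transform_within_open[of _ _ _ "{0<..}"])
        (use 1 in \<open>auto simp: flat_def\<close>)
  next
    case 2
    have "((\<lambda>x. 0) has_field_derivative flat ([:0, 0, 1:] * (p - pderiv p)) x) (at x)"
      using 2 by (auto simp: flat_def)
    then show ?thesis
      by (rule has_field_derivative_transform_within_open[of _ _ _ "{..<0}"])
        (use 2 in \<open>auto simp: flat_def\<close>)
  next
    case 3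
    \<comment> \<open>Dividing by y multiplies the polynomial in 1/y by its variable, so the
      difference quotient at 0 is again of the form \<open>flat\<close> and tends to 0.\<close>
    have "(\<lambda>y. flat p y / y) = flat ([:0, 1:] * p)"
      by (auto simp: flat_def)
    then have "((\<lambda>y. flat p y / y) \<longlongrightarrow> 0) (at 0)"
      using flat_tendsto_0 by metis
    then show ?thesis
      using 3 by (simp add: has_field_derivative_iff flat_def[of _ 0])
  qed
qed

lemma smooth_upto_flat: "smooth_upto n (flat p)"
  by (induction n arbitrary: p) (auto intro: smooth_upto_SucI flat_DERIV)

text \<open>Scaling both arguments by n + 1 drives the two factors to 1 inside (a, b) while the
  support stays fixed. The bumps thus lie between 0 and 1 and converge to the indicator of (a, b),
  ready for dominated convergence.\<close>

definition bump :: "real \<Rightarrow> real \<Rightarrow> nat \<Rightarrow> real \<Rightarrow> real"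
  where "bump a b n x = flat 1 (real (Suc n) * (x - a)) * flat 1 (real (Suc n) * (b - x))"

lemma smooth_upto_bump: "smooth_upto m (bump a b n)"
proof -
  have "smooth_upto m (\<lambda>x. flat 1 (real (Suc n) * x + - real (Suc n) * a)
      * flat 1 (- real (Suc n) * x + real (Suc n) * b))"
    by (intro smooth_upto_mult smooth_upto_affine smooth_upto_flat)
  then show ?thesis
    by (simp add: bump_def[abs_def] algebra_simps)
qed

lemma bump_eq_0: "x \<notin> {a<..<b} \<Longrightarrow> bump a b n x = 0"
  by (auto simp: bump_def flat_def zero_less_mult_iff)

lemma bump_nonneg: "0 \<le> bump a b n x"
  by (simp add: bump_def flat_def)

lemma bump_le_1: "bump a b n x \<le> 1"
  by (auto simp: bump_def flat_def intro!: mult_le_one)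

lemma bump_tendsto: "(\<lambda>n. bump a b n x) \<longlonglongrightarrow> indicator {a<..<b} x"
proof (cases "x \<in> {a<..<b}")
  case True
  have *: "(\<lambda>n. exp (- (1 / (real (Suc n) * c)))) \<longlonglongrightarrow> 1" if "c > 0" for c :: real
  proof -
    have "(\<lambda>n. exp (- (inverse (real (Suc n)) * (1 / c)))) \<longlonglongrightarrow> exp (- (0 * (1 / c)))"
      by (intro tendsto_intros LIMSEQ_inverse_real_of_nat)
    then show ?thesis
      by (simp add: divide_simps)
  qed
  have "(\<lambda>n. exp (- (1 / (real (Suc n) * (x - a)))) * exp (- (1 / (real (Suc n) * (b - x))))) \<longlonglongrightarrow> 1 * 1"
    using True by (intro tendsto_mult *) auto
  moreover have "bump a b n x = exp (- (1 / (real (Suc n) * (x - a)))) * exp (- (1 / (real (Suc n) * (b - x))))" for n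
    using True by (simp add: bump_def flat_def)
  ultimately show ?thesis
    using True by simp
next
  case False
  then show ?thesis
    by (simp add: bump_eq_0)
qed

lemma bump_measurable [measurable]: "bump a b n \<in> borel_measurable borel"
proof (rule borel_measurable_continuous_onI)
  show "continuous_on UNIV (bump a b n)"
    using smooth_upto_DERIV[OF smooth_upto_bump[of 1 a b n, simplified]]
    by (auto intro!: continuous_at_imp_continuous_on DERIV_isCont)
qed

section \<open>Regularity of test functions and integrability of bumps\<close>

lemma test_function_iff:
  "test_function S \<psi> \<longleftrightarrow> (\<forall>n. smooth_upto n \<psi>) \<and>
    (\<exists>K. compact K \<and> K \<subseteq> S \<and> (\<forall>x. x \<notin> K \<longrightarrow> \<psi> x = 0))"
  unfolding test_function_def smooth_upto_def by (metis lessI)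

lemma test_function_DERIV: "test_function S \<psi> \<Longrightarrow> (\<psi> has_field_derivative deriv \<psi> x) (at x)"
  using smooth_upto_DERIV test_function_iff by blast

lemma test_function_deriv_continuous: 
  assumes "test_function S \<psi>" shows "continuous_on A (deriv \<psi>)"
proof -
  have "smooth_upto 2 \<psi>"
    using assms test_function_iff by blast
  then show ?thesis
    by (auto simp: numeral_2_eq_2 smooth_upto_Suc
        intro!: continuous_at_imp_continuous_on field_differentiable_imp_continuous_at)
qed

lemma test_function_mono: "test_function S \<psi> \<Longrightarrow> S \<subseteq> T \<Longrightarrow> test_function T \<psi>"
  unfolding test_function_def by blast

lemma bump_integrable: "set_integrable lborel A (bump a b n)" if "A \<in> sets borel"
proof -
  have "integrable lborel (bump a b n)"
  proof (rule Bochner_Integration.integrable_bound)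
    show "integrable lborel (indicator {a<..<b} :: real \<Rightarrow> real)"
      by (cases "a \<le> b") auto
    show "AE x in lborel. norm (bump a b n x) \<le> norm (indicator {a<..<b} x :: real)"
      using bump_nonneg bump_le_1 bump_eq_0 by (auto simp: indicator_def)
  qed auto
  then show ?thesis
    using that unfolding set_integrable_def by (intro integrable_mult_indicator) auto
qed

section \<open>Indefinite Lebesgue integrals\<close>

text \<open>Absolute continuity expressed by the fundamental theorem on compact subintervals instead
  of by pointwise derivatives. \<open>f\<close> matters only up to null sets, and \<open>S\<close>
  may contain its endpoints, which is how one-sided boundary values become ordinary function
  values.\<close>

definition primitive_on :: "real set \<Rightarrow> (real \<Rightarrow> complex) \<Rightarrow> (real \<Rightarrow> complex) \<Rightarrow> bool"
  where "primitive_on S F f \<longleftrightarrow> (\<forall>x y. x \<le> y \<longrightarrow> {x..y} \<subseteq> S \<longrightarrow>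
    set_integrable lborel {x..y} f \<and> (LINT t:{x..y}|lborel. f t) = F y - F x)"

lemma primitive_onD:
  assumes "primitive_on S F f" "x \<le> y" "{x..y} \<subseteq> S"
  shows "set_integrable lborel {x..y} f" "(LINT t:{x..y}|lborel. f t) = F y - F x"
  using assms by (auto simp: primitive_on_def)

lemma primitive_on_subset: "primitive_on S F f \<Longrightarrow> T \<subseteq> S \<Longrightarrow> primitive_on T F f"
  unfolding primitive_on_def by (meson order_trans)

lemma primitive_on_continuous_on_Icc:
  assumes "primitive_on S F f" "{x..y} \<subseteq> S"
  shows "continuous_on {x..y} F"
proof (cases "x \<le> y")
  case True
  have "f integrable_on {x..y}"
    using primitive_onD(1)[OF assms(1) True assms(2)] by (rule set_borel_integral_eq_integral)
  then have "continuous_on {x..y} (\<lambda>t. F x + integral {x..t} f)"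
    by (intro continuous_intros indefinite_integral_continuous_1)
  moreover have "F x + integral {x..t} f = F t" if "t \<in> {x..y}" for t
  proof -
    have "{x..t} \<subseteq> S"
      using assms that by force
    then show ?thesis
      using primitive_onD[OF assms(1), of x t] that
      by (simp add: set_borel_integral_eq_integral)
  qed
  ultimately show ?thesis
    by (rule continuous_on_eq)
qed simp

text \<open>Covers half-open \<open>S\<close> as well: a convergent sequence together with its limit
  is compact, hence contained in one compact subinterval of \<open>S\<close>, where the indefinite
  integral is continuous.\<close>

lemma primitive_on_continuous_on:
  assumes "primitive_on S F f" "is_interval S"
  shows "continuous_on S F"
proof (rule continuous_on_sequentiallyI)
  fix u a assume u: "\<forall>n. u n \<in> S" "a \<in> S" "u \<longlonglongrightarrow> a"
  define K where "K = insert a (range u)"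
  have K: "compact K" "K \<noteq> {}" "K \<subseteq> S"
    using u compact_sequence_with_limit by (auto simp: K_def)
  obtain m M where m: "m \<in> K" "\<And>t. t \<in> K \<Longrightarrow> m \<le> t" and M: "M \<in> K" "\<And>t. t \<in> K \<Longrightarrow> t \<le> M"
    using compact_attains_inf[OF K(1,2)] compact_attains_sup[OF K(1,2)] by auto
  have "{m..M} \<subseteq> S"
    using m(1) M(1) K(3) assms(2) unfolding is_interval_1 by (meson atLeastAtMost_iff subsetD subsetI)
  then have "continuous_on {m..M} F"
    by (rule primitive_on_continuous_on_Icc[OF assms(1)])
  moreover have "\<forall>n. u n \<in> {m..M}" "a \<in> {m..M}"
    using m M by (auto simp: K_def)
  ultimately show "(\<lambda>n. F (u n)) \<longlonglongrightarrow> F a"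
    using u(3) by (auto simp: continuous_on_sequentially o_def)
qed

lemma set_integral_Icc_split:
  fixes f :: "real \<Rightarrow> complex"
  assumes "x \<le> y" "y \<le> z" "set_integrable lborel {x..y} f" "set_integrable lborel {y..z} f"
  shows "set_integrable lborel {x..z} f"
    "(LINT t:{x..z}|lborel. f t) = (LINT t:{x..y}|lborel. f t) + (LINT t:{y..z}|lborel. f t)"
proof -
  have *: "{x..z} = {x..y} \<union> {y..z}"
    using assms by auto
  show "set_integrable lborel {x..z} f"
    unfolding * by (intro set_integrable_Un assms) auto
  show "(LINT t:{x..z}|lborel. f t) = (LINT t:{x..y}|lborel. f t) + (LINT t:{y..z}|lborel. f t)"
    unfolding * using assms AE_lborel_singleton[of y]
    by (intro set_integral_Un_AE) (auto elim!: eventually_mono)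
qed

lemma primitive_onI_from:
  assumes "is_interval S" "a \<in> S"
    and "\<And>y. y \<in> S \<Longrightarrow> a \<le> y \<Longrightarrow> set_integrable lborel {a..y} f \<and> (LINT t:{a..y}|lborel. f t) = F y - F a"
    and "\<And>y. y \<in> S \<Longrightarrow> y \<le> a \<Longrightarrow> set_integrable lborel {y..a} f \<and> (LINT t:{y..a}|lborel. f t) = F a - F y"
  shows "primitive_on S F f"
  unfolding primitive_on_def
proof (intro allI impI)
  fix x y :: real assume xy: "x \<le> y" "{x..y} \<subseteq> S"
  then have S: "x \<in> S" "y \<in> S" by auto
  have int: "set_integrable lborel {x..y} f" if "c \<le> x" "y \<le> d" "set_integrable lborel {c..d} f" for c d
    using that(3) by (rule set_integrable_subset) (use that in auto)
  consider "a \<le> x" | "y \<le> a" | "x \<le> a" "a \<le> y" by linarith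
  then show "set_integrable lborel {x..y} f \<and> (LINT t:{x..y}|lborel. f t) = F y - F x"
  proof cases
    case 1
    have i: "set_integrable lborel {x..y} f"
      using int[of a y] assms(3)[OF S(2)] 1 xy by auto
    have "(LINT t:{x..y}|lborel. f t) = (LINT t:{a..y}|lborel. f t) - (LINT t:{a..x}|lborel. f t)"
      using assms(3)[OF S(1)] set_integral_Icc_split(2)[of a x y f] i 1 xy by auto
    then show ?thesis
      using i assms(3)[OF S(1)] assms(3)[OF S(2)] 1 xy by simp
  next
    case 2
    have i: "set_integrable lborel {x..y} f"
      using int[of x a] assms(4)[OF S(1)] 2 xy by auto
    have "(LINT t:{x..y}|lborel. f t) = (LINT t:{x..a}|lborel. f t) - (LINT t:{y..a}|lborel. f t)"
      using assms(4)[OF S(2)] set_integral_Icc_split(2)[of x y a f] i 2 xy by auto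
    then show ?thesis
      using i assms(4)[OF S(1)] assms(4)[OF S(2)] 2 xy by simp
  next
    case 3
    note l = assms(4)[OF S(1) 3(1)] and r = assms(3)[OF S(2) 3(2)]
    note sp = set_integral_Icc_split[OF 3 conjunct1[OF l] conjunct1[OF r]]
    show ?thesis
      unfolding sp(2) conjunct2[OF l] conjunct2[OF r] using sp(1) by simp
  qed
qed

lemma primitive_on_glue:
  assumes "primitive_on {..c} F f" "primitive_on {c..} F f"
  shows "primitive_on UNIV F f"
  using assms by (intro primitive_onI_from[of _ c]) (auto simp: primitive_on_def)

text \<open>Fubini on the product of two lines cut along the diagonal: the part with t at most s and
  the part with s < t add up to the full product. This is integration by parts for functions that
  are merely integrable.\<close>

lemma set_integrable_triangle_product:
  fixes f g :: "real \<Rightarrow> complex"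
  assumes f: "integrable lborel f" and g: "integrable lborel g"
  shows "(LINT s|lborel. f s * (LINT t:{..s}|lborel. g t)) + (LINT t|lborel. g t * (LINT s:{..t}|lborel. f s))
      = (LINT s|lborel. f s) * (LINT t|lborel. g t)"
    and "integrable lborel (\<lambda>s. f s * (LINT t:{..s}|lborel. g t))"
proof -
  interpret lborel_pair: pair_sigma_finite "lborel :: real measure" "lborel :: real measure" ..
  define P where "P s t = f s * g t" for s t
  have [measurable]: "f \<in> borel_measurable borel" "g \<in> borel_measurable borel"
    using f g by auto
  have P: "integrable (lborel \<Otimes>\<^sub>M lborel) (\<lambda>(s, t). P s t)"
    unfolding P_def
  proof (rule lborel_pair.Fubini_integrable)
    show "integrable lborel (\<lambda>s. LINT t|lborel. norm (case (s, t) of (s, t) \<Rightarrow> f s * g t))"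
      using f g by (simp add: norm_mult)
  qed (use g in auto)
  define Q where "Q s t = (if t \<le> s then P s t else 0)" for s t
  define R where "R s t = (if s < t then P s t else 0)" for s t
  have [measurable]: "(\<lambda>(s, t). Q s t) \<in> borel_measurable (lborel \<Otimes>\<^sub>M lborel)"
    "(\<lambda>(s, t). R s t) \<in> borel_measurable (lborel \<Otimes>\<^sub>M lborel)"
    unfolding Q_def R_def P_def split_beta' by measurable
  have Q: "integrable (lborel \<Otimes>\<^sub>M lborel) (\<lambda>(s, t). Q s t)"
    by (rule Bochner_Integration.integrable_bound[OF P], measurable) (auto simp: Q_def)
  have R: "integrable (lborel \<Otimes>\<^sub>M lborel) (\<lambda>(s, t). R s t)"
    by (rule Bochner_Integration.integrable_bound[OF P], measurable) (auto simp: R_def)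
  have Qs: "(LINT t|lborel. Q s t) = f s * (LINT t:{..s}|lborel. g t)" for s
  proof -
    have "(LINT t|lborel. Q s t) = (LINT t|lborel. f s * (indicator {..s} t *\<^sub>R g t))"
      by (rule Bochner_Integration.integral_cong) (auto simp: Q_def P_def)
    then show ?thesis
      by (simp only: set_lebesgue_integral_def integral_mult_right_zero)
  qed
  have Rt: "(LINT s|lborel. R s t) = g t * (LINT s:{..t}|lborel. f s)" for t
  proof -
    have "(LINT s|lborel. R s t) = (LINT s|lborel. g t * (indicator {..t} s *\<^sub>R f s))"
    proof (rule integral_cong_AE)
      show "(\<lambda>s. R s t) \<in> borel_measurable lborel"
        unfolding R_def P_def by measurable
      show "AE s in lborel. R s t = g t * (indicator {..t} s *\<^sub>R f s)"
        using AE_lborel_singleton[of t] by (rule eventually_mono) (auto simp: R_def P_def)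
    qed measurable
    then show ?thesis
      by (simp only: set_lebesgue_integral_def integral_mult_right_zero)
  qed
  show "integrable lborel (\<lambda>s. f s * (LINT t:{..s}|lborel. g t))"
    using lborel_pair.integrable_fst[OF Q] by (simp add: Qs)
  have "(LINT s|lborel. f s * (LINT t:{..s}|lborel. g t)) = integral\<^sup>L (lborel \<Otimes>\<^sub>M lborel) (\<lambda>(s, t). Q s t)"
    using lborel_pair.integral_fst[OF Q] by (simp add: Qs)
  moreover have "(LINT t|lborel. g t * (LINT s:{..t}|lborel. f s)) = integral\<^sup>L (lborel \<Otimes>\<^sub>M lborel) (\<lambda>(s, t). R s t)"
    using lborel_pair.integral_snd[OF R] by (simp add: Rt)
  moreover have "integral\<^sup>L (lborel \<Otimes>\<^sub>M lborel) (\<lambda>(s, t). Q s t) + integral\<^sup>L (lborel \<Otimes>\<^sub>M lborel) (\<lambda>(s, t). R s t)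
      = integral\<^sup>L (lborel \<Otimes>\<^sub>M lborel) (\<lambda>(s, t). P s t)"
    unfolding Bochner_Integration.integral_add[OF Q R, symmetric]
    by (rule Bochner_Integration.integral_cong) (auto simp: Q_def R_def)
  moreover have "integral\<^sup>L (lborel \<Otimes>\<^sub>M lborel) (\<lambda>(s, t). P s t) = (LINT s|lborel. f s) * (LINT t|lborel. g t)"
    using lborel_pair.integral_fst[OF P] by (simp add: P_def)
  ultimately show "(LINT s|lborel. f s * (LINT t:{..s}|lborel. g t)) + (LINT t|lborel. g t * (LINT s:{..t}|lborel. f s))
      = (LINT s|lborel. f s) * (LINT t|lborel. g t)"
    by simp
qed

text \<open>Product rule without differentiability. The triangle identity is applied to
  \<open>f\<close> and \<open>g\<close> cut off to [x, y]; the inner integrals are then the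
  increments of \<open>F\<close> and \<open>G\<close> from x.\<close>

lemma primitive_on_mult:
  assumes F: "primitive_on S F f" and G: "primitive_on S G g"
  shows "primitive_on S (\<lambda>t. F t * G t) (\<lambda>t. f t * G t + F t * g t)"
  unfolding primitive_on_def
proof (intro allI impI)
  fix x y :: real assume xy: "x \<le> y" "{x..y} \<subseteq> S"
  define f' where "f' t = indicator {x..y} t *\<^sub>R f t" for t
  define g' where "g' t = indicator {x..y} t *\<^sub>R g t" for t
  note f = primitive_onD[OF F xy] and g = primitive_onD[OF G xy]
  have int: "integrable lborel f'" "integrable lborel g'"
    using f(1) g(1) by (auto simp: f'_def[abs_def] g'_def[abs_def] set_integrable_def)
  have tot: "(LINT t|lborel. f' t) = F y - F x" "(LINT t|lborel. g' t) = G y - G x"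
    using f(2) g(2) by (auto simp: f'_def g'_def set_lebesgue_integral_def)
  have part: "(LINT t:{..s}|lborel. indicator {x..y} t *\<^sub>R h t) = (LINT t:{x..s}|lborel. h t)"
    if "s \<in> {x..y}" for s and h :: "real \<Rightarrow> complex"
    unfolding set_lebesgue_integral_def using that
    by (intro Bochner_Integration.integral_cong) (auto simp: indicator_def)
  have sub: "x \<le> s" "{x..s} \<subseteq> S" if "s \<in> {x..y}" for s
    using that xy by force+
  have F': "f' s * (LINT t:{..s}|lborel. g' t) = indicator {x..y} s *\<^sub>R (f s * (G s - G x))" for s
    unfolding f'_def g'_def
    using part[of s g] primitive_onD(2)[OF G sub] by (cases "s \<in> {x..y}") auto
  have G': "g' s * (LINT t:{..s}|lborel. f' t) = indicator {x..y} s *\<^sub>R (g s * (F s - F x))" for s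
    unfolding f'_def g'_def
    using part[of s f] primitive_onD(2)[OF F sub] by (cases "s \<in> {x..y}") auto
  note tri = set_integrable_triangle_product[OF int] set_integrable_triangle_product(2)[OF int(2,1)]
  have i1: "set_integrable lborel {x..y} (\<lambda>s. f s * (G s - G x))"
    and i2: "set_integrable lborel {x..y} (\<lambda>s. g s * (F s - F x))"
    using tri(2,3) by (auto simp: set_integrable_def F' G')
  have I: "(LINT s:{x..y}|lborel. f s * (G s - G x)) + (LINT s:{x..y}|lborel. g s * (F s - F x))
      = (F y - F x) * (G y - G x)"
    using tri(1) by (simp only: F' G' tot set_lebesgue_integral_def[of _ "{x..y}"])
  \<comment> \<open>Splitting into increments from x plus the constants \<open>F x\<close> and
    \<open>G x\<close>: the increment part is the triangle identity, the constant part is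
    linear.\<close>
  have eq: "f t * G t + F t * g t = (f t * (G t - G x) + g t * (F t - F x)) + (f t * G x + g t * F x)" for t
    by (simp add: algebra_simps)
  have i3: "set_integrable lborel {x..y} (\<lambda>t. f t * (G t - G x) + g t * (F t - F x))"
    "set_integrable lborel {x..y} (\<lambda>t. f t * G x + g t * F x)"
    using i1 i2 f(1) g(1) by (auto intro!: set_integral_add)
  show "set_integrable lborel {x..y} (\<lambda>t. f t * G t + F t * g t) \<and>
      (LINT t:{x..y}|lborel. f t * G t + F t * g t) = F y * G y - F x * G x"
  proof
    show "set_integrable lborel {x..y} (\<lambda>t. f t * G t + F t * g t)"
      unfolding eq by (intro set_integral_add i3)
    have "(LINT t:{x..y}|lborel. f t * G t + F t * g t) =
        (F y - F x) * (G y - G x) + ((F y - F x) * G x + (G y - G x) * F x)"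
      unfolding eq using i1 i2 i3 I f g by (simp add: set_integral_add)
    then show "(LINT t:{x..y}|lborel. f t * G t + F t * g t) = F y * G y - F x * G x"
      by (simp add: algebra_simps)
  qed
qed

lemma primitive_on_add:
  assumes "primitive_on S F f" "primitive_on S G g"
  shows "primitive_on S (\<lambda>t. F t + G t) (\<lambda>t. f t + g t)"
  using assms by (auto simp: primitive_on_def set_integral_add)

lemma primitive_on_cmult:
  assumes "primitive_on S F f"
  shows "primitive_on S (\<lambda>t. c * F t) (\<lambda>t. c * f t)"
  using assms by (auto simp: primitive_on_def right_diff_distrib)

lemma primitive_on_diff:
  assumes "primitive_on S F f" "primitive_on S G g"
  shows "primitive_on S (\<lambda>t. F t - G t) (\<lambda>t. f t - g t)"
  using assms by (auto simp: primitive_on_def set_integral_diff)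

section \<open>Null sets, reflection and uniqueness of the density\<close>

lemma set_integrable_cong_AE':
  fixes f g :: "real \<Rightarrow> complex"
  assumes "set_integrable lborel A f" "set_borel_measurable lborel A g" "AE t\<in>A in lborel. f t = g t"
  shows "set_integrable lborel A g"
  using assms unfolding set_integrable_def set_borel_measurable_def
  by (subst integrable_cong_AE[of _ _ "\<lambda>t. indicator A t *\<^sub>R f t"])
    (auto dest: borel_measurable_integrable elim!: eventually_mono simp: indicator_def)

lemma set_integral_cong_AE':
  fixes f g :: "real \<Rightarrow> complex"
  assumes "set_borel_measurable lborel A f" "set_borel_measurable lborel A g" "AE t\<in>A in lborel. f t = g t"
  shows "(LINT t:A|lborel. f t) = (LINT t:A|lborel. g t)"
  using assms unfolding set_lebesgue_integral_def set_borel_measurable_def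
  by (intro integral_cong_AE) (auto elim!: eventually_mono simp: indicator_def)

lemma primitive_on_uminus:
  assumes "primitive_on S F f"
  shows "primitive_on (uminus ` S) (\<lambda>t. F (- t)) (\<lambda>t. - f (- t))"
  unfolding primitive_on_def
proof (intro allI impI)
  fix x y :: real assume xy: "x \<le> y" "{x..y} \<subseteq> uminus ` S"
  have *: "- y \<le> - x" "{- y..- x} \<subseteq> S"
  proof -
    show "{- y..- x} \<subseteq> S"
    proof
      fix t assume "t \<in> {- y..- x}"
      then have "- t \<in> uminus ` S"
        using xy(2) by (intro subsetD[OF xy(2)]) auto
      then show "t \<in> S" by auto
    qed
  qed (use xy in auto)
  note f = primitive_onD[OF assms *]
  have eq: "indicator {x..y} t *\<^sub>R f (- t) = indicator {- y..- x} (0 + (-1) * t) *\<^sub>R f (0 + (-1) * t)" for t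
    by (auto simp: indicator_def)
  have "set_integrable lborel {x..y} (\<lambda>t. f (- t))"
    using f(1) unfolding set_integrable_def eq by (intro lborel_integrable_real_affine) auto
  moreover have "(LINT t:{x..y}|lborel. f (- t)) = (LINT t:{- y..- x}|lborel. f t)"
    unfolding set_lebesgue_integral_def eq
    by (subst lborel_integral_real_affine[of "-1" _ 0]) auto
  ultimately show "set_integrable lborel {x..y} (\<lambda>t. - f (- t)) \<and>
      (LINT t:{x..y}|lborel. - f (- t)) = F (- y) - F (- x)"
    using f(2) by (simp add: set_integral_uminus set_integrable_def)
qed

text \<open>The finite exceptional set \<open>N\<close> is there for the point b, where the
  potential jumps and the second derivative of a solution does not exist.\<close>

lemma primitive_on_derivative:
  assumes F: "\<And>x y. {x..y} \<subseteq> S \<Longrightarrow> continuous_on {x..y} F"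
    and D: "\<And>t. t \<in> S \<Longrightarrow> t \<notin> N \<Longrightarrow> (F has_vector_derivative f t) (at t)"
    and N: "finite N"
    and f: "\<And>x y. {x..y} \<subseteq> S \<Longrightarrow> set_integrable lborel {x..y} f"
  shows "primitive_on S F f"
  unfolding primitive_on_def
proof (intro allI impI)
  fix x y :: real assume xy: "x \<le> y" "{x..y} \<subseteq> S"
  have "(f has_integral F y - F x) {x..y}"
    by (rule fundamental_theorem_of_calculus_interior_strong[OF N]) (use xy in \<open>auto intro!: F D\<close>)
  then have "(LINT t:{x..y}|lborel. f t) = F y - F x"
    using set_borel_integral_eq_integral[OF f[OF xy(2)]] by (simp add: integral_unique)
  with f[OF xy(2)] show "set_integrable lborel {x..y} f \<and> (LINT t:{x..y}|lborel. f t) = F y - F x"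
    by simp
qed

text \<open>Closed intervals form an intersection-stable generator of the Borel sets, so vanishing
  integrals over intervals extend to all Borel sets by a monotone class argument; a density with
  only zero integrals vanishes almost everywhere.\<close>

lemma AE_Icc_eq_0:
  fixes v :: "real \<Rightarrow> complex"
  assumes v: "set_integrable lborel {x..y} v"
    and 0: "\<And>c d. x \<le> c \<Longrightarrow> c \<le> d \<Longrightarrow> d \<le> y \<Longrightarrow> (LINT t:{c..d}|lborel. v t) = 0"
  shows "AE t\<in>{x..y} in lborel. v t = 0"
proof -
  define w where "w t = indicator {x..y} t *\<^sub>R v t" for t
  have w: "integrable lborel w"
    using v by (simp add: w_def[abs_def] set_integrable_def)
  have basic: "(LINT t:{c..d}|lborel. w t) = 0" for c d
  proof -
    have "(LINT t:{c..d}|lborel. w t) = (LINT t:{max c x..min d y}|lborel. v t)"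
      unfolding set_lebesgue_integral_def w_def
      by (intro Bochner_Integration.integral_cong) (auto simp: indicator_def)
    also have "\<dots> = 0"
    proof (cases "max c x \<le> min d y")
      case True
      then show ?thesis by (intro 0) auto
    next
      case False
      then have "{max c x..min d y} = {}" by simp
      then show ?thesis by (simp only: set_lebesgue_integral_def) simp
    qed
    finally show ?thesis .
  qed
  have wA: "set_integrable lborel A w" if "A \<in> sets borel" for A
    using w that unfolding set_integrable_def by (intro integrable_mult_indicator) auto
  have w0: "(LINT t|lborel. w t) = 0"
  proof -
    have "(LINT t:{x..y}|lborel. w t) = (LINT t|lborel. w t)"
      unfolding set_lebesgue_integral_def w_def
      by (intro Bochner_Integration.integral_cong) (auto simp: indicator_def)
    then show ?thesis using basic[of x y] by simp
  qed
  have "(LINT t:A|lborel. w t) = 0" if "A \<in> sets lborel" for A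
  proof -
    have eq: "sets lborel = sigma_sets UNIV (range (\<lambda>(a, b). {a..b :: real}))"
      by (simp add: borel_eq_atLeastAtMost)
    have "Int_stable (range (\<lambda>(a, b). {a..b :: real}))"
      by (auto simp: Int_stable_def)
    moreover have "range (\<lambda>(a, b). {a..b :: real}) \<subseteq> Pow UNIV" by simp
    moreover have "A \<in> sigma_sets UNIV (range (\<lambda>(a, b). {a..b :: real}))"
      using that eq by simp
    ultimately show ?thesis
    proof (induction rule: sigma_sets_induct_disjoint)
      case (basic A)
      then show ?case using \<open>\<And>c d. (LINT t:{c..d}|lborel. w t) = 0\<close> by auto
    next
      case empty
      then show ?case by (simp add: set_lebesgue_integral_def)
    next
      case (compl A)
      have A: "A \<in> sets borel" using compl(1) eq by simp
      have "(LINT t:UNIV - A|lborel. w t) = (LINT t|lborel. w t - indicator A t *\<^sub>R w t)"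
        unfolding set_lebesgue_integral_def
        by (intro Bochner_Integration.integral_cong) (auto simp: indicator_def)
      also have "\<dots> = 0"
        using wA[OF A] w w0 compl by (simp add: set_integrable_def set_lebesgue_integral_def)
      finally show ?case .
    next
      case (union A)
      have A: "range A \<subseteq> sets lborel" using union(2) eq by auto
      have "(LINT t:(\<Union>i. A i)|lborel. w t) = (\<Sum>i. (LINT t:(A i)|lborel. w t))"
        using A union(1) by (intro lebesgue_integral_countable_add wA)
          (auto simp: disjoint_family_on_def image_subset_iff)
      then show ?case using union by simp
    qed
  qed
  then have "AE t in lborel. w t = 0"
    using w by (rule sigma_finite_measure.density_zero[OF sigma_finite_lborel, rotated])
  then show ?thesis
    by (auto elim!: eventually_mono simp: w_def)
qed

text \<open>The intervals with rational endpoints inside the open set are countably many and cover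
  it, so countably many exceptional null sets suffice.\<close>

lemma AE_open_if_AE_Icc:
  fixes S :: "real set"
  assumes "open S" "\<And>x y. {x..y} \<subseteq> S \<Longrightarrow> AE t\<in>{x..y} in lborel. P t"
  shows "AE t\<in>S in lborel. P t"
proof -
  define Q where "Q = {(p, q) \<in> \<rat> \<times> \<rat>. {p..q :: real} \<subseteq> S}"
  have "countable Q"
    by (rule countable_subset[of _ "\<rat> \<times> \<rat>"]) (auto simp: Q_def countable_rat)
  then have "AE t in lborel. \<forall>i\<in>Q. t \<in> {fst i..snd i} \<longrightarrow> P t"
    by (subst AE_ball_countable) (use assms(2) in \<open>auto simp: Q_def\<close>)
  then show ?thesis
  proof (rule eventually_mono, intro impI)
    fix t assume *: "\<forall>i\<in>Q. t \<in> {fst i..snd i} \<longrightarrow> P t" "t \<in> S"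
    obtain e where e: "e > 0" "ball t e \<subseteq> S"
      using assms(1) *(2) openE by blast
    obtain p q where pq: "p \<in> \<rat>" "t - e < p" "p < t" "q \<in> \<rat>" "t < q" "q < t + e"
      using Rats_dense_in_real[of "t - e" t] Rats_dense_in_real[of t "t + e"] e(1) by auto
    have "{p..q} \<subseteq> ball t e"
      using pq by (auto simp: dist_real_def)
    then have "(p, q) \<in> Q" using pq e by (auto simp: Q_def)
    then show "P t" using * pq by fastforce
  qed
qed

lemma primitive_on_unique_AE:
  assumes "open S" "primitive_on S F f" "primitive_on S F g"
  shows "AE t\<in>S in lborel. f t = g t"
proof (rule AE_open_if_AE_Icc[OF assms(1)])
  fix x y :: real assume S: "{x..y} \<subseteq> S"
  have "AE t\<in>{x..y} in lborel. f t - g t = 0"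
  proof (rule AE_Icc_eq_0)
    have "primitive_on S (\<lambda>t. F t - F t) (\<lambda>t. f t - g t)"
      using assms by (intro primitive_on_diff)
    note * = primitive_onD[OF this]
    show "set_integrable lborel {x..y} (\<lambda>t. f t - g t)"
      using *(1)[of x y] S by (cases "x \<le> y") (auto simp: set_integrable_def)
    show "(LINT t:{c..d}|lborel. f t - g t) = 0" if "x \<le> c" "c \<le> d" "d \<le> y" for c d
    proof -
      have "{c..d} \<subseteq> S" using S that by auto
      then show ?thesis using *(2)[of c d] that by simp
    qed
  qed
  then show "AE t\<in>{x..y} in lborel. f t = g t"
    by (auto elim!: eventually_mono)
qed

section \<open>Weak derivatives on intervals\<close>

lemma test_function_deriv_eq_0:
  assumes "test_function S \<psi>" "open U" "\<And>x. x \<in> U \<Longrightarrow> \<psi> x = 0" "x \<in> U"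
  shows "deriv \<psi> x = 0"
proof -
  have "(\<psi> has_field_derivative 0) (at x)"
    by (rule has_field_derivative_transform_within_open[of "\<lambda>_. 0" _ _ U]) (use assms in auto)
  then show ?thesis
    by (rule DERIV_imp_deriv)
qed

lemma primitive_on_test_function:
  assumes "test_function S \<psi>"
  shows "primitive_on UNIV (\<lambda>x. of_real (\<psi> x)) (\<lambda>x. of_real (deriv \<psi> x))"
proof (rule primitive_on_derivative[where N = "{}"])
  have "continuous_on A \<psi>" for A
    using test_function_DERIV[OF assms] DERIV_continuous_on has_field_derivative_at_within by blast
  then show "continuous_on {x..y} (\<lambda>x. complex_of_real (\<psi> x))" for x y
    by (intro continuous_intros)
  show "((\<lambda>x. complex_of_real (\<psi> x)) has_vector_derivative complex_of_real (deriv \<psi> t)) (at t)" for t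
    using test_function_DERIV[OF assms]
    by (intro has_vector_derivative_of_real) (simp add: has_real_derivative_iff_has_vector_derivative)
  show "set_integrable lborel {x..y} (\<lambda>x. complex_of_real (deriv \<psi> x))" for x y
    by (intro borel_integrable_atLeastAtMost' continuous_intros test_function_deriv_continuous[OF assms])
qed auto

text \<open>The test function may belong to another set \<open>T\<close>; only the part of its
  support inside \<open>S\<close> has to be compact. This freedom lets the same statement be applied
  on each half-line to a test function of the punctured line.\<close>

lemma integral_by_parts_test_function:
  assumes S: "open S" "is_interval S" and F: "primitive_on S F g"
    and \<psi>: "test_function T \<psi>" and K: "compact (K \<inter> S)" "\<And>x. x \<notin> K \<Longrightarrow> \<psi> x = 0"
  shows "set_integrable lborel S (\<lambda>y. deriv \<psi> y *\<^sub>R F y)"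
    and "set_integrable lborel S (\<lambda>y. \<psi> y *\<^sub>R g y)"
    and "(LINT y:S|lborel. deriv \<psi> y *\<^sub>R F y) = - (LINT y:S|lborel. \<psi> y *\<^sub>R g y)"
proof -
  have "set_integrable lborel S (\<lambda>y. deriv \<psi> y *\<^sub>R F y) \<and> set_integrable lborel S (\<lambda>y. \<psi> y *\<^sub>R g y)
    \<and> (LINT y:S|lborel. deriv \<psi> y *\<^sub>R F y) = - (LINT y:S|lborel. \<psi> y *\<^sub>R g y)"
  proof (cases "S = {}")
    case True
    then show ?thesis by (simp add: set_lebesgue_integral_def)
  next
    case False
    then obtain s where s: "s \<in> S" by auto
    \<comment> \<open>A point of \<open>S\<close> is added so that minimum and maximum exist even
      when the support misses \<open>S\<close>.\<close>
    define L where "L = insert s (K \<inter> S)"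
    have L: "compact L" "L \<noteq> {}" "L \<subseteq> S"
      using K(1) s by (auto simp: L_def)
    obtain m M where m: "m \<in> L" "\<And>t. t \<in> L \<Longrightarrow> m \<le> t" and M: "M \<in> L" "\<And>t. t \<in> L \<Longrightarrow> t \<le> M"
      using compact_attains_inf[OF L(1,2)] compact_attains_sup[OF L(1,2)] by auto
    have mM: "m \<in> S" "M \<in> S" using m(1) M(1) L(3) by auto
    obtain d where d: "d > 0" "ball m d \<subseteq> S"
      using S(1) mM(1) by (rule openE)
    obtain e where e: "e > 0" "ball M e \<subseteq> S"
      using S(1) mM(2) by (rule openE)
    note de = d e
    \<comment> \<open>Slightly beyond the extreme points of the support, still inside the open
      interval, so that both boundary terms vanish.\<close>
    define x y where "x = m - d / 2" and "y = M + e / 2"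
    have "x \<in> ball m d" "y \<in> ball M e"
      using de by (simp_all add: x_def y_def dist_real_def)
    then have xS: "x \<in> S" "y \<in> S" "x < m" "M < y"
      using de by (auto simp: x_def y_def)
    have "m \<le> M"
      using m(2)[OF M(1)] .
    then have xy: "x \<le> y" "{x..y} \<subseteq> S"
      using xS(3,4) mem_is_interval_1_I[OF S(2) xS(1,2)] by auto
    have \<psi>0: "\<psi> t = 0" if "t \<in> S - {x<..<y}" for t
    proof (rule K(2))
      show "t \<notin> K"
      proof
        assume "t \<in> K"
        then have "t \<in> L" using that by (simp add: L_def)
        then have "m \<le> t" "t \<le> M" using m(2) M(2) by auto
        then show False using that xS by auto
      qed
    qed
    have \<psi>'0: "deriv \<psi> t = 0" if "t \<in> S - {x..y}" for t
    proof (rule test_function_deriv_eq_0[OF \<psi> _ _ that])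
      show "open (S - {x..y})" using S(1) by (intro open_Diff) auto
      show "\<psi> u = 0" if "u \<in> S - {x..y}" for u
        by (rule \<psi>0) (use that in auto)
    qed
    have P: "primitive_on S (\<lambda>t. of_real (\<psi> t) * F t)
        (\<lambda>t. of_real (deriv \<psi> t) * F t + of_real (\<psi> t) * g t)"
      by (rule primitive_on_mult[OF primitive_on_subset[OF primitive_on_test_function[OF \<psi>]] F]) simp
    have i1: "set_integrable lborel {x..y} (\<lambda>t. of_real (deriv \<psi> t) * F t)"
      by (rule borel_integrable_atLeastAtMost', rule continuous_on_mult[OF continuous_on_of_real
          [OF test_function_deriv_continuous[OF \<psi>]] primitive_on_continuous_on_Icc[OF F xy(2)]])
    have "set_integrable lborel {x..y}
        (\<lambda>t. of_real (deriv \<psi> t) * F t + of_real (\<psi> t) * g t - of_real (deriv \<psi> t) * F t)"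
      by (rule set_integral_diff(1)[OF primitive_onD(1)[OF P xy] i1])
    then have i2: "set_integrable lborel {x..y} (\<lambda>t. of_real (\<psi> t) * g t)"
      by simp
    have "\<psi> x = 0" "\<psi> y = 0"
      using xS by (auto intro: \<psi>0)
    then have "(LINT t:{x..y}|lborel. of_real (deriv \<psi> t) * F t) + (LINT t:{x..y}|lborel. of_real (\<psi> t) * g t) = 0"
      using primitive_onD(2)[OF P xy] unfolding set_integral_add(2)[OF i1 i2] by simp
    then have parts: "(LINT t:{x..y}|lborel. of_real (deriv \<psi> t) * F t) = - (LINT t:{x..y}|lborel. of_real (\<psi> t) * g t)"
      by (simp add: add_eq_0_iff2)
    have eq1: "(\<lambda>t. indicator S t *\<^sub>R (deriv \<psi> t *\<^sub>R F t)) = (\<lambda>t. indicator {x..y} t *\<^sub>R (of_real (deriv \<psi> t) * F t))"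
    proof
      fix t
      show "indicator S t *\<^sub>R (deriv \<psi> t *\<^sub>R F t) = indicator {x..y} t *\<^sub>R (of_real (deriv \<psi> t) * F t)"
        using \<psi>'0[of t] xy(2) by (cases "t \<in> {x..y}"; cases "t \<in> S") (auto simp: scaleR_conv_of_real)
    qed
    have eq2: "(\<lambda>t. indicator S t *\<^sub>R (\<psi> t *\<^sub>R g t)) = (\<lambda>t. indicator {x..y} t *\<^sub>R (of_real (\<psi> t) * g t))"
    proof
      fix t
      show "indicator S t *\<^sub>R (\<psi> t *\<^sub>R g t) = indicator {x..y} t *\<^sub>R (of_real (\<psi> t) * g t)"
        using \<psi>0[of t] xy(2) by (cases "t \<in> {x..y}"; cases "t \<in> S") (auto simp: scaleR_conv_of_real)
    qed
    show ?thesis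
      using i1 i2 parts unfolding set_integrable_def set_lebesgue_integral_def eq1 eq2 by simp
  qed
  then show "set_integrable lborel S (\<lambda>y. deriv \<psi> y *\<^sub>R F y)"
    and "set_integrable lborel S (\<lambda>y. \<psi> y *\<^sub>R g y)"
    and "(LINT y:S|lborel. deriv \<psi> y *\<^sub>R F y) = - (LINT y:S|lborel. \<psi> y *\<^sub>R g y)"
    by auto
qed

section \<open>Measurability on subsets, and primitives as weak derivatives\<close>

lemma set_borel_measurable_subset':
  fixes f :: "real \<Rightarrow> complex"
  assumes "set_borel_measurable lborel S f" "T \<subseteq> S" "T \<in> sets borel"
  shows "set_borel_measurable lborel T f"
proof -
  have [measurable]: "(\<lambda>t. indicator S t *\<^sub>R f t) \<in> borel_measurable borel"
    using assms(1) by (simp add: set_borel_measurable_def)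
  note [measurable] = assms(3)
  have "(\<lambda>t. indicator T t *\<^sub>R (indicator S t *\<^sub>R f t)) \<in> borel_measurable borel"
    by measurable
  moreover have "(\<lambda>t. indicator T t *\<^sub>R (indicator S t *\<^sub>R f t)) = (\<lambda>t. indicator T t *\<^sub>R f t)"
    by (rule ext) (use assms(2) in \<open>auto simp: indicator_def\<close>)
  ultimately show ?thesis
    by (simp add: set_borel_measurable_def)
qed

lemma compact_subset_Icc:
  fixes K :: "real set"
  assumes "compact K" "K \<subseteq> S" "is_interval S"
  obtains x y where "K \<subseteq> {x..y}" "{x..y} \<subseteq> S"
proof (cases "K = {}")
  case True
  then show ?thesis using that[of 1 0] by simp
next
  case False
  obtain m M where m: "m \<in> K" "\<And>t. t \<in> K \<Longrightarrow> m \<le> t" and M: "M \<in> K" "\<And>t. t \<in> K \<Longrightarrow> t \<le> M"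
    using compact_attains_inf[OF assms(1) False] compact_attains_sup[OF assms(1) False] by auto
  have "{m..M} \<subseteq> S"
    using m(1) M(1) assms(2) mem_is_interval_1_I[OF assms(3)] by (meson atLeastAtMost_iff subsetD subsetI)
  moreover have "K \<subseteq> {m..M}" using m(2) M(2) by auto
  ultimately show ?thesis using that by blast
qed

lemma primitive_on_set_integrable:
  assumes "primitive_on S F g" "is_interval S" "compact K" "K \<subseteq> S"
  shows "set_integrable lborel K g"
proof -
  obtain x y where xy: "K \<subseteq> {x..y}" "{x..y} \<subseteq> S"
    using compact_subset_Icc[OF assms(3,4,2)] .
  have "set_integrable lborel {x..y} g"
    using primitive_onD(1)[OF assms(1) _ xy(2)] by (cases "x \<le> y") (auto simp: set_integrable_def)
  then show ?thesis
    by (rule set_integrable_subset) (use xy assms(3) in \<open>auto intro: borel_compact\<close>)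
qed

lemma continuous_on_set_borel_measurable:
  fixes F :: "real \<Rightarrow> complex"
  shows "continuous_on S F \<Longrightarrow> S \<in> sets borel \<Longrightarrow> set_borel_measurable lborel S F"
  using borel_measurable_continuous_on_indicator[of S F] by (simp add: set_borel_measurable_def)

lemma AE_eq_primitive_set_integrable:
  assumes "primitive_on S F g" "is_interval S" "compact K" "K \<subseteq> S"
    and "set_borel_measurable lborel S f" "AE t\<in>S in lborel. f t = F t"
  shows "set_integrable lborel K f"
proof (rule set_integrable_cong_AE'[of _ F])
  show "set_integrable lborel K F"
    unfolding set_integrable_def
    by (intro borel_integrable_compact assms continuous_on_subset[OF primitive_on_continuous_on[OF assms(1,2)]])
  show "set_borel_measurable lborel K f"
    using assms by (intro set_borel_measurable_subset'[OF assms(5)]) (auto intro: borel_compact)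
  show "AE t\<in>K in lborel. F t = f t"
    using assms(6) by (rule eventually_mono) (use assms(4) in auto)
qed

lemma test_function_measurable:
  assumes "test_function S \<psi>"
  shows "\<psi> \<in> borel_measurable borel" "deriv \<psi> \<in> borel_measurable borel"
proof -
  have "continuous_on UNIV \<psi>"
    using test_function_DERIV[OF assms] DERIV_continuous_on has_field_derivative_at_within by blast
  then show "\<psi> \<in> borel_measurable borel"
    by (rule borel_measurable_continuous_onI)
  show "deriv \<psi> \<in> borel_measurable borel"
    by (intro borel_measurable_continuous_onI test_function_deriv_continuous[OF assms])
qed

lemma set_borel_measurable_scaleR:
  fixes f :: "real \<Rightarrow> complex" and r :: "real \<Rightarrow> real"
  assumes "set_borel_measurable lborel S f" "r \<in> borel_measurable borel"
  shows "set_borel_measurable lborel S (\<lambda>t. r t *\<^sub>R f t)"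
proof -
  have "(\<lambda>t. r t *\<^sub>R (indicator S t *\<^sub>R f t)) \<in> borel_measurable borel"
    by (rule borel_measurable_scaleR) (use assms in \<open>simp_all add: set_borel_measurable_def\<close>)
  then show ?thesis
    by (simp add: set_borel_measurable_def mult.commute)
qed

lemma integral_by_parts_test_function':
  assumes S: "open S" "is_interval S" and F: "primitive_on S F g"
    and f: "set_borel_measurable lborel S f" "AE t\<in>S in lborel. f t = F t"
    and \<psi>: "test_function T \<psi>" and K: "compact (K \<inter> S)" "\<And>x. x \<notin> K \<Longrightarrow> \<psi> x = 0"
  shows "set_integrable lborel S (\<lambda>y. deriv \<psi> y *\<^sub>R f y)"
    and "set_integrable lborel S (\<lambda>y. \<psi> y *\<^sub>R g y)"
    and "(LINT y:S|lborel. deriv \<psi> y *\<^sub>R f y) = - (LINT y:S|lborel. \<psi> y *\<^sub>R g y)"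
proof -
  note parts = integral_by_parts_test_function[OF S F \<psi> K]
  have F': "set_borel_measurable lborel S F"
    using S by (intro continuous_on_set_borel_measurable primitive_on_continuous_on[OF F]) auto
  have m: "set_borel_measurable lborel S (\<lambda>y. deriv \<psi> y *\<^sub>R f y)" "set_borel_measurable lborel S (\<lambda>y. deriv \<psi> y *\<^sub>R F y)"
    using \<psi> by (auto intro!: set_borel_measurable_scaleR f F' dest: test_function_measurable)
  have ae: "AE y\<in>S in lborel. deriv \<psi> y *\<^sub>R F y = deriv \<psi> y *\<^sub>R f y"
    using f(2) by (rule eventually_mono) auto
  show "set_integrable lborel S (\<lambda>y. deriv \<psi> y *\<^sub>R f y)"
    by (rule set_integrable_cong_AE'[OF parts(1) m(1) ae])
  show "set_integrable lborel S (\<lambda>y. \<psi> y *\<^sub>R g y)"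
    by (rule parts)
  show "(LINT y:S|lborel. deriv \<psi> y *\<^sub>R f y) = - (LINT y:S|lborel. \<psi> y *\<^sub>R g y)"
    using set_integral_cong_AE'[OF m(2,1) ae] parts(3) by simp
qed

lemma has_weak_derivative_on_primitive:
  assumes S: "open S" "is_interval S" and F: "primitive_on S F g"
    and f: "set_borel_measurable lborel S f" "AE t\<in>S in lborel. f t = F t"
  shows "has_weak_derivative_on f g S"
  unfolding has_weak_derivative_on_def locally_integrable_on_def
proof (intro conjI allI impI)
  fix K assume K: "compact K" "K \<subseteq> S"
  show "set_integrable lborel K f"
    by (rule AE_eq_primitive_set_integrable[OF F S(2) K f])
  show "set_integrable lborel K g"
    by (rule primitive_on_set_integrable[OF F S(2) K])
next
  fix \<psi> assume \<psi>: "test_function S \<psi>"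
  then obtain K where K: "compact K" "K \<subseteq> S" "\<And>x. x \<notin> K \<Longrightarrow> \<psi> x = 0"
    unfolding test_function_def by blast
  moreover have "K \<inter> S = K" using K by auto
  ultimately show "(LINT y:S|lborel. deriv \<psi> y *\<^sub>R f y) = - (LINT y:S|lborel. \<psi> y *\<^sub>R g y)"
    using integral_by_parts_test_function'[OF S F f \<psi>, of K] by simp
qed

lemma primitive_on_exists:
  assumes "is_interval S" "g locally_integrable_on S"
  obtains G where "primitive_on S G g"
proof (cases "S = {}")
  case True
  then show ?thesis by (intro that[of g]) (auto simp: primitive_on_def set_lebesgue_integral_def set_integrable_def)
next
  case False
  then obtain c where c: "c \<in> S" by auto
  define G where "G t = (if c \<le> t then LINT s:{c..t}|lborel. g s else - (LINT s:{t..c}|lborel. g s))" for t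
  have G0: "G c = 0"
  proof -
    have "(LINT s:{c..c}|lborel. g s) = 0"
      unfolding set_lebesgue_integral_def using AE_lborel_singleton[of c]
      by (intro integral_eq_zero_AE, elim eventually_mono) (simp add: indicator_def)
    then show ?thesis by (simp add: G_def)
  qed
  have "set_integrable lborel {x..y} g" if "x \<in> S" "y \<in> S" for x y
  proof -
    have "{x..y} \<subseteq> S"
      using mem_is_interval_1_I[OF assms(1) that] by auto
    then show ?thesis using assms(2) unfolding locally_integrable_on_def by blast
  qed
  then have "primitive_on S G g"
    using c G0 by (intro primitive_onI_from[OF assms(1) c]) (auto simp: G_def)
  then show ?thesis by (rule that)
qed

text \<open>Dominated convergence with the restriction of \<open>v\<close> to [x, y] as majorant:
  integrals over intervals are limits of integrals against bumps.\<close>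

lemma bump_integral_tendsto:
  fixes v :: "real \<Rightarrow> 'a :: {banach, second_countable_topology}"
  assumes v: "set_integrable lborel {x..y} v" and S: "{x..y} \<subseteq> S"
  shows "set_integrable lborel S (\<lambda>t. bump x y n t *\<^sub>R v t)"
    and "(\<lambda>n. LINT t:S|lborel. bump x y n t *\<^sub>R v t) \<longlonglongrightarrow> (LINT t:{x..y}|lborel. v t)"
proof -
  have eq: "indicator S t *\<^sub>R bump x y n t *\<^sub>R v t = bump x y n t *\<^sub>R (indicator {x..y} t *\<^sub>R v t)" for n t
    using S bump_eq_0[of t x y n] by (auto simp: indicator_def)
  have m [measurable]: "(\<lambda>t. indicator {x..y} t *\<^sub>R v t) \<in> borel_measurable borel"
    using v by (auto simp: set_integrable_def)
  have b: "norm (bump x y n t *\<^sub>R (indicator {x..y} t *\<^sub>R v t)) \<le> norm (indicator {x..y} t *\<^sub>R v t)" for n t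
    using mult_right_mono[OF bump_le_1[of x y n t], of "norm (indicator {x..y} t *\<^sub>R v t)"]
    by (simp add: bump_nonneg)
  show "set_integrable lborel S (\<lambda>t. bump x y n t *\<^sub>R v t)"
    unfolding set_integrable_def eq
  proof (rule Bochner_Integration.integrable_bound[OF v[unfolded set_integrable_def]])
    show "(\<lambda>t. bump x y n t *\<^sub>R indicator {x..y} t *\<^sub>R v t) \<in> borel_measurable lborel"
      using m by measurable
    show "AE t in lborel. norm (bump x y n t *\<^sub>R indicator {x..y} t *\<^sub>R v t) \<le> norm (indicator {x..y} t *\<^sub>R v t)"
      using b by simp
  qed
  have "(\<lambda>n. LINT t|lborel. bump x y n t *\<^sub>R (indicator {x..y} t *\<^sub>R v t))
      \<longlonglongrightarrow> (LINT t|lborel. indicator {x..y} t *\<^sub>R v t)"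
  proof (rule integral_dominated_convergence[where w = "\<lambda>t. norm (indicator {x..y} t *\<^sub>R v t)"])
    show "integrable lborel (\<lambda>t. norm (indicator {x..y} t *\<^sub>R v t))"
      using v unfolding set_integrable_def by (rule integrable_norm)
    show "(\<lambda>t. bump x y n t *\<^sub>R indicator {x..y} t *\<^sub>R v t) \<in> borel_measurable lborel" for n
      using m by measurable
    show "AE t in lborel. norm (bump x y n t *\<^sub>R indicator {x..y} t *\<^sub>R v t) \<le> norm (indicator {x..y} t *\<^sub>R v t)" for n
      using b by simp
    show "AE t in lborel. (\<lambda>n. bump x y n t *\<^sub>R indicator {x..y} t *\<^sub>R v t) \<longlonglongrightarrow> indicator {x..y} t *\<^sub>R v t"
      \<comment> \<open>The bumps vanish at x and y, so convergence to the restriction to [x, y]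
        fails at most at these two points.\<close>
      using AE_lborel_singleton[of x] AE_lborel_singleton[of y]
    proof eventually_elim
      case (elim t)
      have "(\<lambda>n. bump x y n t *\<^sub>R indicator {x..y} t *\<^sub>R v t) \<longlonglongrightarrow> indicator {x<..<y} t *\<^sub>R indicator {x..y} t *\<^sub>R v t"
        by (intro tendsto_intros bump_tendsto)
      then show ?case using elim by (auto simp: indicator_def split: if_splits)
    qed
  qed (use m in simp)
  then show "(\<lambda>n. LINT t:S|lborel. bump x y n t *\<^sub>R v t) \<longlonglongrightarrow> (LINT t:{x..y}|lborel. v t)"
    by (simp only: set_lebesgue_integral_def eq)
qed

text \<open>A function with weak derivative zero integrates to zero against every test function of
  mean zero, because such test functions have a test function as primitive.\<close>

lemma mean_zero_combination_has_primitive: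
  assumes S: "is_interval S" "{x..y} \<subseteq> S" "{c..d} \<subseteq> S" "x \<le> y" "c \<le> d"
    and eq: "\<alpha> * (LINT t|lborel. bump x y n t) + \<beta> * (LINT t|lborel. bump c d n t) = 0"
  obtains \<psi> where "test_function S \<psi>" "deriv \<psi> = (\<lambda>t. \<alpha> * bump x y n t + \<beta> * bump c d n t)"
proof -
  define \<phi> where "\<phi> t = \<alpha> * bump x y n t + \<beta> * bump c d n t" for t
  define l u where "l = min x c" and "u = max y d"
  have lu: "{l..u} \<subseteq> S"
  proof -
    have "x \<in> S" "y \<in> S" "c \<in> S" "d \<in> S" using S by auto
    then have "l \<in> S" "u \<in> S" by (auto simp: l_def u_def min_def max_def)
    then show ?thesis
      using mem_is_interval_1_I[OF S(1), of l u] by auto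
  qed
  have \<phi>: "smooth_upto m \<phi>" for m
    unfolding \<phi>_def
    by (rule smooth_upto_add[OF smooth_upto_mult smooth_upto_mult, OF smooth_upto_const smooth_upto_bump smooth_upto_const smooth_upto_bump])
  have \<phi>0: "\<phi> t = 0" if "t \<le> l \<or> u \<le> t" for t
    using that by (auto simp: \<phi>_def l_def u_def bump_eq_0)
  have cont: "continuous_on A \<phi>" for A
    by (rule continuous_at_imp_continuous_on) (intro ballI DERIV_isCont[OF smooth_upto_DERIV[OF \<phi>[of "Suc 0"]]])
  have int: "integrable lborel (\<lambda>t. bump p q n t)" for p q
    using bump_integrable[of UNIV p q n] by (simp add: set_integrable_def)
  \<comment> \<open>The lower limit is l - 1 and not l, so that every t > l - 1 is interior to the
    interval of integration and all other t lie in the open region below l where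
    \<open>\<psi>\<close> is 0; the two-sided derivative then exists everywhere.\<close>
  define \<psi> where "\<psi> t = integral {l - 1..t} \<phi>" for t
  have D: "(\<psi> has_field_derivative \<phi> t) (at t)" for t
  proof (cases "l - 1 < t")
    case True
    have "((\<lambda>t. integral {l - 1..t} \<phi>) has_vector_derivative \<phi> t) (at t within {l - 1..t + 1})"
      by (rule integral_has_vector_derivative) (use True cont in auto)
    then have "((\<lambda>t. integral {l - 1..t} \<phi>) has_vector_derivative \<phi> t) (at t)"
      using True at_within_interior[of t "{l - 1..t + 1}"] by simp
    then show ?thesis
      by (simp add: \<psi>_def[abs_def] has_real_derivative_iff_has_vector_derivative)
  next
    case False
    have "((\<lambda>_. 0) has_field_derivative \<phi> t) (at t)"
      using False \<phi>0 by simp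
    then show ?thesis
    proof (rule has_field_derivative_transform_within_open[of _ _ _ "{..<l}"])
      show "0 = \<psi> s" if "s \<in> {..<l}" for s
        unfolding \<psi>_def using that \<phi>0 by (intro integral_unique[symmetric] has_integral_is_0) auto
    qed (use False in auto)
  qed
  have "test_function S \<psi>"
    unfolding test_function_iff
  proof (intro conjI allI)
    show "smooth_upto m \<psi>" for m
      by (rule smooth_upto_mono[OF smooth_upto_SucI[OF D \<phi>[of m]]]) simp
    show "\<exists>K. compact K \<and> K \<subseteq> S \<and> (\<forall>t. t \<notin> K \<longrightarrow> \<psi> t = 0)"
    proof (intro exI[of _ "{l..u}"] conjI allI impI lu)
      fix t assume t: "t \<notin> {l..u}"
      show "\<psi> t = 0"
      proof (cases "t < l")
        case True
        then show ?thesis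
          unfolding \<psi>_def using \<phi>0 by (intro integral_unique has_integral_is_0) auto
      next
        case False
        then have t: "u < t" using t by simp
        have lu': "l \<le> u" using S by (auto simp: l_def u_def)
        have "set_integrable lborel {l - 1..t} \<phi>"
          by (intro borel_integrable_atLeastAtMost' cont)
        then have "\<psi> t = (LINT s:{l - 1..t}|lborel. \<phi> s)"
          by (simp add: \<psi>_def set_borel_integral_eq_integral)
        also have "\<dots> = (LINT s|lborel. \<phi> s)"
          unfolding set_lebesgue_integral_def
        proof (intro Bochner_Integration.integral_cong refl)
          show "indicator {l - 1..t} s *\<^sub>R \<phi> s = \<phi> s" for s
            using \<phi>0[of s] t lu' by (cases "l \<le> s \<and> s \<le> u") auto
        qed
        also have "\<dots> = \<alpha> * (LINT t|lborel. bump x y n t) + \<beta> * (LINT t|lborel. bump c d n t)"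
          unfolding \<phi>_def using int by simp
        finally show ?thesis using eq by simp
      qed
    qed auto
  qed
  moreover have "deriv \<psi> = \<phi>"
    using D DERIV_imp_deriv by blast
  ultimately show ?thesis
    using that by (simp add: \<phi>_def[abs_def])
qed

text \<open>The lemma of du Bois-Reymond. Subtracting a primitive \<open>G\<close> of
  \<open>g\<close> leaves a function \<open>v\<close> with weak derivative zero; testing it against
  mean-zero combinations of two bumps shows that its mean over any subinterval equals its mean over
  one reference interval, so \<open>v\<close> is constant almost everywhere.\<close>

lemma has_weak_derivative_on_imp_primitive:
  assumes S: "open S" "is_interval S" and w: "has_weak_derivative_on f g S"
  obtains F where "primitive_on S F g" "AE t\<in>S in lborel. f t = F t"
proof (cases "S = {}")
  case True
  then show ?thesis by (intro that[of g]) (auto simp: primitive_on_def set_lebesgue_integral_def set_integrable_def)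
next
  case False
  have loc: "f locally_integrable_on S" "g locally_integrable_on S"
    and parts: "\<And>\<psi>. test_function S \<psi> \<Longrightarrow> (LINT y:S|lborel. deriv \<psi> y *\<^sub>R f y) = - (LINT y:S|lborel. \<psi> y *\<^sub>R g y)"
    using w by (auto simp: has_weak_derivative_on_def)
  obtain G where G: "primitive_on S G g"
    using primitive_on_exists[OF S(2) loc(2)] .
  define v where "v t = f t - G t" for t
  have iv: "set_integrable lborel {x..y} v" if "{x..y} \<subseteq> S" for x y
  proof -
    have "set_integrable lborel {x..y} f"
      using that loc(1) by (simp add: locally_integrable_on_def)
    moreover have "set_integrable lborel {x..y} G"
      by (intro borel_integrable_atLeastAtMost' primitive_on_continuous_on_Icc[OF G that])
    ultimately show ?thesis
      unfolding v_def by (rule set_integral_diff(1))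
  qed
  obtain s where s: "s \<in> S" using False by auto
  then obtain e where e: "e > 0" "cball s e \<subseteq> S"
    using S(1) open_contains_cball by blast
  define c d where "c = s - e" and "d = s + e"
  have cd: "c < d" "{c..d} \<subseteq> S"
    using e by (auto simp: c_def d_def cball_eq_atLeastAtMost)
  define \<kappa> where "\<kappa> = (LINT t:{c..d}|lborel. v t) / of_real (d - c)"
  have mean: "(LINT t:{x..y}|lborel. v t) = of_real (y - x) * \<kappa>" if xy: "x \<le> y" "{x..y} \<subseteq> S" for x y
  proof -
    define A where "A p q n = (LINT t|lborel. bump p q n t)" for p q n
    define B where "B p q n = (LINT t:S|lborel. bump p q n t *\<^sub>R v t)" for p q n
    have A: "A p q \<longlonglongrightarrow> q - p" if "p \<le> q" for p q
    proof -
      have "(\<lambda>n. LINT t:UNIV|lborel. bump p q n t *\<^sub>R (1::real)) \<longlonglongrightarrow> (LINT t:{p..q}|lborel. (1::real))"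
        by (intro bump_integral_tendsto borel_integrable_atLeastAtMost' continuous_intros) auto
      then show ?thesis using that by (simp add: A_def[abs_def] set_lebesgue_integral_def)
    qed
    have B: "B p q \<longlonglongrightarrow> (LINT t:{p..q}|lborel. v t)" if "{p..q} \<subseteq> S" for p q
      unfolding B_def by (intro bump_integral_tendsto iv that)
    \<comment> \<open>Each bump is weighted by the integral of the other, which makes the
      combination mean-zero and hence the derivative of a test function.\<close>
    have eq: "A c d n *\<^sub>R B x y n = A x y n *\<^sub>R B c d n" for n
    proof -
      have "A c d n * (LINT t|lborel. bump x y n t) + (- A x y n) * (LINT t|lborel. bump c d n t) = 0"
        by (simp add: A_def)
      then obtain \<psi> where \<psi>: "test_function S \<psi>"
          "deriv \<psi> = (\<lambda>t. A c d n * bump x y n t + (- A x y n) * bump c d n t)"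
        using mean_zero_combination_has_primitive[OF S(2) xy(2) cd(2) xy(1) less_imp_le[OF cd(1)]] by blast
      obtain K where K: "compact K" "K \<subseteq> S" "\<And>x. x \<notin> K \<Longrightarrow> \<psi> x = 0"
        using \<psi>(1) unfolding test_function_def by blast
      then have "K \<inter> S = K" by auto
      note G' = integral_by_parts_test_function[OF S G \<psi>(1), of K, unfolded \<open>K \<inter> S = K\<close>, OF K(1,3)]
      have fi: "set_integrable lborel S (\<lambda>y. deriv \<psi> y *\<^sub>R f y)"
      proof -
        have i: "set_integrable lborel {p..q} f" if "{p..q} \<subseteq> S" for p q
          using loc(1) that by (auto simp: locally_integrable_on_def)
        have "set_integrable lborel S (\<lambda>t. A c d n *\<^sub>R (bump x y n t *\<^sub>R f t) + (- A x y n) *\<^sub>R (bump c d n t *\<^sub>R f t))"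
          by (intro set_integral_add set_integrable_scaleR_right bump_integral_tendsto i xy cd)
        then show ?thesis by (simp add: \<psi>(2) scaleR_add_left scaleR_diff_left)
      qed
      have "(LINT t:S|lborel. deriv \<psi> t *\<^sub>R v t) = 0"
        unfolding v_def scaleR_diff_right
        using parts[OF \<psi>(1)] G'(3) set_integral_diff(2)[OF fi G'(1)] by simp
      moreover have "(LINT t:S|lborel. deriv \<psi> t *\<^sub>R v t) = A c d n *\<^sub>R B x y n - A x y n *\<^sub>R B c d n"
      proof -
        have "deriv \<psi> t *\<^sub>R v t = A c d n *\<^sub>R (bump x y n t *\<^sub>R v t) - A x y n *\<^sub>R (bump c d n t *\<^sub>R v t)" for t
          by (simp add: \<psi>(2) scaleR_diff_left)
        then show ?thesis
          using set_integral_diff(2)[OF set_integrable_scaleR_right[OF bump_integral_tendsto(1)[OF iv[OF xy(2)] xy(2)]]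
              set_integrable_scaleR_right[OF bump_integral_tendsto(1)[OF iv[OF cd(2)] cd(2)]]]
          by (simp only: B_def set_integral_scaleR_right)
      qed
      ultimately show ?thesis by simp
    qed
    have "(\<lambda>n. A c d n *\<^sub>R B x y n) \<longlonglongrightarrow> (d - c) *\<^sub>R (LINT t:{x..y}|lborel. v t)"
      by (intro tendsto_intros A B xy less_imp_le cd)
    moreover have "(\<lambda>n. A c d n *\<^sub>R B x y n) \<longlonglongrightarrow> (y - x) *\<^sub>R (LINT t:{c..d}|lborel. v t)"
      unfolding eq by (intro tendsto_intros A B xy less_imp_le cd)
    ultimately have "(d - c) *\<^sub>R (LINT t:{x..y}|lborel. v t) = (y - x) *\<^sub>R (LINT t:{c..d}|lborel. v t)"
      by (rule LIMSEQ_unique)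
    moreover have "complex_of_real d - complex_of_real c \<noteq> 0"
      using cd(1) by (metis less_irrefl of_real_eq_iff right_minus_eq)
    ultimately show ?thesis
      by (simp add: \<kappa>_def scaleR_conv_of_real field_simps)
  qed
  have const: "set_integrable lborel {x..y} (\<lambda>_. \<kappa>)" for x y :: real
    by (intro borel_integrable_atLeastAtMost' continuous_intros)
  have cI: "(LINT t:{x..y}|lborel. \<kappa>) = of_real (y - x) * \<kappa>" if "x \<le> y" for x y
    using that by (simp add: set_lebesgue_integral_def scaleR_conv_of_real)
  have "AE t\<in>S in lborel. v t - \<kappa> = 0"
  proof (rule AE_open_if_AE_Icc[OF S(1)])
    fix x y assume xy: "{x..y} \<subseteq> S"
    show "AE t\<in>{x..y} in lborel. v t - \<kappa> = 0"
    proof (rule AE_Icc_eq_0)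
      show "set_integrable lborel {x..y} (\<lambda>t. v t - \<kappa>)"
        by (intro set_integral_diff iv xy const)
      fix p q assume pq: "x \<le> p" "p \<le> q" "q \<le> y"
      then have "{p..q} \<subseteq> S" using xy by auto
      then show "(LINT t:{p..q}|lborel. v t - \<kappa>) = 0"
        using set_integral_diff(2)[OF iv const] mean[OF pq(2)] cI[OF pq(2)] by simp
    qed
  qed
  then have "AE t\<in>S in lborel. f t = G t + \<kappa>"
    by (rule eventually_mono) (auto simp: v_def algebra_simps)
  moreover have "primitive_on S (\<lambda>t. G t + \<kappa>) g"
    using G by (simp add: primitive_on_def)
  ultimately show ?thesis using that by blast
qed

lemma locally_integrable_on_subset:
  "f locally_integrable_on S \<Longrightarrow> T \<subseteq> S \<Longrightarrow> f locally_integrable_on T"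
  by (auto simp: locally_integrable_on_def)

lemma has_weak_derivative_on_subset:
  assumes w: "has_weak_derivative_on f g S" and T: "open T" "T \<subseteq> S"
  shows "has_weak_derivative_on f g T"
  unfolding has_weak_derivative_on_def
proof (intro conjI allI impI)
  show "f locally_integrable_on T" "g locally_integrable_on T"
    using w T(2) by (auto simp: has_weak_derivative_on_def intro: locally_integrable_on_subset)
  fix \<psi> assume \<psi>: "test_function T \<psi>"
  then obtain K where K: "compact K" "K \<subseteq> T" "\<And>x. x \<notin> K \<Longrightarrow> \<psi> x = 0"
    unfolding test_function_def by blast
  have d0: "deriv \<psi> x = 0" if "x \<notin> K" for x
    using K that by (intro test_function_deriv_eq_0[OF \<psi>, of "- K"]) (auto dest: compact_imp_closed)
  have eq: "(LINT y:T|lborel. r y *\<^sub>R h y) = (LINT y:S|lborel. r y *\<^sub>R h y)"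
    if "\<And>x. x \<notin> K \<Longrightarrow> r x = 0" for r :: "real \<Rightarrow> real" and h :: "real \<Rightarrow> complex"
    unfolding set_lebesgue_integral_def
  proof (intro Bochner_Integration.integral_cong refl)
    fix x show "indicator T x *\<^sub>R r x *\<^sub>R h x = indicator S x *\<^sub>R r x *\<^sub>R h x"
    proof (cases "x \<in> K")
      case True
      then have "x \<in> T" "x \<in> S" using K(2) T(2) by auto
      then show ?thesis by simp
    qed (simp add: that)
  qed
  have "(LINT y:S|lborel. deriv \<psi> y *\<^sub>R f y) = - (LINT y:S|lborel. \<psi> y *\<^sub>R g y)"
    using w test_function_mono[OF \<psi> T(2)] by (simp add: has_weak_derivative_on_def)
  then show "(LINT y:T|lborel. deriv \<psi> y *\<^sub>R f y) = - (LINT y:T|lborel. \<psi> y *\<^sub>R g y)"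
    using eq[of "deriv \<psi>" f] eq[of \<psi> g] d0 K(3) by simp
qed

lemma has_weak_derivative_on_cong_AE:
  assumes "has_weak_derivative_on f g S" "open S" "AE t\<in>S in lborel. f t = f' t"
    "set_borel_measurable lborel S f'"
  shows "has_weak_derivative_on f' g S"
  unfolding has_weak_derivative_on_def
proof (intro conjI allI impI)
  have S: "S \<in> sets borel" using assms(2) by simp
  have ae: "AE t\<in>K in lborel. f t = f' t" if "K \<subseteq> S" for K
    using assms(3) by (rule eventually_mono) (use that in auto)
  show "f' locally_integrable_on S"
    unfolding locally_integrable_on_def
  proof (intro allI impI)
    fix K assume K: "compact K" "K \<subseteq> S"
    show "set_integrable lborel K f'"
      using assms(1) K
      by (intro set_integrable_cong_AE'[OF _ set_borel_measurable_subset'[OF assms(4)] ae[OF K(2)]])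
        (auto simp: has_weak_derivative_on_def locally_integrable_on_def intro: borel_compact)
  qed
  show "g locally_integrable_on S"
    using assms(1) by (simp add: has_weak_derivative_on_def)
  fix \<psi> assume \<psi>: "test_function S \<psi>"
  have "(LINT y:S|lborel. deriv \<psi> y *\<^sub>R f y) = (LINT y:S|lborel. deriv \<psi> y *\<^sub>R f' y)"
  proof -
    have "(LINT y|lborel. deriv \<psi> y *\<^sub>R (indicator S y *\<^sub>R f y)) = (LINT y|lborel. deriv \<psi> y *\<^sub>R (indicator S y *\<^sub>R f' y))"
    proof (rule Bochner_Integration.integral_cong_AE)
      obtain K where K: "compact K" "K \<subseteq> S" "\<And>x. x \<notin> K \<Longrightarrow> \<psi> x = 0"
        using \<psi> unfolding test_function_def by blast
      have d0: "deriv \<psi> x = 0" if "x \<notin> K" for x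
        using K that by (intro test_function_deriv_eq_0[OF \<psi>, of "- K"]) (auto dest: compact_imp_closed)
      have "set_integrable lborel K f"
        using assms(1) K(1,2) by (simp add: has_weak_derivative_on_def locally_integrable_on_def)
      then have "(\<lambda>y. indicator K y *\<^sub>R f y) \<in> borel_measurable lborel"
        unfolding set_integrable_def by (rule borel_measurable_integrable)
      then have "(\<lambda>y. deriv \<psi> y *\<^sub>R (indicator K y *\<^sub>R f y)) \<in> borel_measurable lborel"
        by (rule borel_measurable_scaleR[rotated]) (use test_function_measurable(2)[OF \<psi>] in simp)
      moreover have "deriv \<psi> y *\<^sub>R (indicator K y *\<^sub>R f y) = deriv \<psi> y *\<^sub>R (indicator S y *\<^sub>R f y)" for y
        using d0[of y] K(2) by (cases "y \<in> K") auto
      ultimately show "(\<lambda>y. deriv \<psi> y *\<^sub>R (indicator S y *\<^sub>R f y)) \<in> borel_measurable lborel"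
        by (simp only:)
      show "(\<lambda>y. deriv \<psi> y *\<^sub>R (indicator S y *\<^sub>R f' y)) \<in> borel_measurable lborel"
        by (rule borel_measurable_scaleR)
          (use assms(4) test_function_measurable(2)[OF \<psi>] in \<open>simp_all add: set_borel_measurable_def\<close>)
      show "AE y in lborel. deriv \<psi> y *\<^sub>R (indicator S y *\<^sub>R f y) = deriv \<psi> y *\<^sub>R (indicator S y *\<^sub>R f' y)"
        using assms(3) by (rule eventually_mono) (auto simp: indicator_def)
    qed
    then show ?thesis
      by (simp only: set_lebesgue_integral_def scaleR_left_commute)
  qed
  then show "(LINT y:S|lborel. deriv \<psi> y *\<^sub>R f' y) = - (LINT y:S|lborel. \<psi> y *\<^sub>R g y)"
    using assms(1) \<psi> by (simp add: has_weak_derivative_on_def)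
qed

lemma AE_eq_continuous_imp_eq:
  fixes f g :: "real \<Rightarrow> complex"
  assumes "open S" "continuous_on S f" "continuous_on S g" "AE t\<in>S in lborel. f t = g t" "x \<in> S"
  shows "f x = g x"
proof (rule ccontr)
  assume ne: "f x \<noteq> g x"
  have "continuous_on S (\<lambda>t. f t - g t)"
    using assms by (intro continuous_intros)
  then have "open (S \<inter> (\<lambda>t. f t - g t) -` (- {0}))"
    using assms(1) by (rule continuous_open_preimage) auto
  then have U: "open {t \<in> S. f t \<noteq> g t}"
    by (rule back_subst[of "open"]) auto
  then obtain e where e: "e > 0" "cball x e \<subseteq> {t \<in> S. f t \<noteq> g t}"
    using assms(5) ne open_contains_cball by blast
  have "AE t in lborel. t \<notin> {x - e..x + e}"
    using assms(4) by (rule eventually_mono) (use e in \<open>auto simp: cball_eq_atLeastAtMost subset_iff\<close>)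
  then have "emeasure lborel {x - e..x + e} = 0"
    using AE_iff_measurable[of "{x - e..x + e}" lborel "\<lambda>t. t \<notin> {x - e..x + e}"] by (auto simp: set_eq_iff)
  then show False using e(1) by simp
qed

text \<open>\<open>f\<close> and \<open>f'\<close> have continuous representatives which then
  coincide, so \<open>g\<close> and \<open>g'\<close> are densities of one primitive. This is what
  makes \<open>weak_deriv\<close> computable although its value is an arbitrary choice.\<close>

lemma has_weak_derivative_on_unique:
  assumes S: "open S" "is_interval S"
    and w: "has_weak_derivative_on f g S" "has_weak_derivative_on f' g' S"
    and ae: "AE t\<in>S in lborel. f t = f' t"
  shows "AE t\<in>S in lborel. g t = g' t"
proof -
  obtain F where F: "primitive_on S F g" "AE t\<in>S in lborel. f t = F t"
    using has_weak_derivative_on_imp_primitive[OF S w(1)] .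
  obtain F' where F': "primitive_on S F' g'" "AE t\<in>S in lborel. f' t = F' t"
    using has_weak_derivative_on_imp_primitive[OF S w(2)] .
  have "AE t\<in>S in lborel. F t = F' t"
    using ae F(2) F'(2) by eventually_elim auto
  then have eq: "F x = F' x" if "x \<in> S" for x
    using that by (intro AE_eq_continuous_imp_eq[OF S(1)] primitive_on_continuous_on[OF F(1) S(2)]
      primitive_on_continuous_on[OF F'(1) S(2)])
  have "primitive_on S F g'"
    unfolding primitive_on_def
  proof (intro allI impI)
    fix x y :: real assume xy: "x \<le> y" "{x..y} \<subseteq> S"
    then have "x \<in> S" "y \<in> S" by auto
    then show "set_integrable lborel {x..y} g' \<and> (LINT t:{x..y}|lborel. g' t) = F y - F x"
      using primitive_onD[OF F'(1) xy] eq by simp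
  qed
  then show ?thesis
    by (rule primitive_on_unique_AE[OF S(1) F(1)])
qed

lemma weak_deriv_works:
  "has_weak_derivative_on f g S \<Longrightarrow> has_weak_derivative_on f (weak_deriv S f) S"
  unfolding weak_deriv_def by (rule someI[of "\<lambda>g. has_weak_derivative_on f g S"])

section \<open>Square integrability and measurability on subsets\<close>

lemma square_integrable_on_cong_AE:
  assumes "f square_integrable_on S" "set_borel_measurable lborel S g" "S \<in> sets borel"
    "AE t\<in>S in lborel. f t = g t"
  shows "g square_integrable_on S"
proof -
  have [measurable]: "(\<lambda>t. indicator S t *\<^sub>R g t) \<in> borel_measurable borel"
    using assms(2) by (simp add: set_borel_measurable_def)
  have eq: "indicator S t *\<^sub>R (norm (g t))\<^sup>2 = (norm (indicator S t *\<^sub>R g t))\<^sup>2" for t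
    by (simp add: indicator_def)
  have "integrable lborel (\<lambda>t. indicator S t *\<^sub>R (norm (f t))\<^sup>2)"
    using assms(1) by (simp add: square_integrable_on_def set_integrable_def)
  moreover have "(\<lambda>t. indicator S t *\<^sub>R (norm (g t))\<^sup>2) \<in> borel_measurable lborel"
    unfolding eq by measurable
  moreover have "AE t in lborel. indicator S t *\<^sub>R (norm (f t))\<^sup>2 = indicator S t *\<^sub>R (norm (g t))\<^sup>2"
    using assms(4) by (rule eventually_mono) (simp add: indicator_def)
  ultimately have "integrable lborel (\<lambda>t. indicator S t *\<^sub>R (norm (g t))\<^sup>2)"
    by (subst integrable_cong_AE[symmetric]) (auto dest: borel_measurable_integrable)
  then show ?thesis
    using assms(2) by (simp add: square_integrable_on_def set_integrable_def)
qed

lemma square_integrable_on_subset: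
  assumes "f square_integrable_on S" "T \<subseteq> S" "T \<in> sets borel"
  shows "f square_integrable_on T"
  using assms set_borel_measurable_subset'[OF _ assms(2,3)] set_integrable_subset[of lborel S "\<lambda>y. (norm (f y))\<^sup>2" T]
  by (simp add: square_integrable_on_def)

lemma square_integrable_on_iff:
  "f square_integrable_on S \<longleftrightarrow> (\<lambda>t. indicator S t *\<^sub>R f t) square_integrable_on UNIV"
proof -
  have "(norm (indicator S t *\<^sub>R f t))\<^sup>2 = indicator S t * (norm (f t))\<^sup>2" for t
    by (simp add: indicator_def)
  then show ?thesis
    by (simp add: square_integrable_on_def set_borel_measurable_def set_integrable_def)
qed

lemma square_integrable_on_insert:
  assumes "f square_integrable_on S" "S \<in> sets borel"
  shows "f square_integrable_on (insert a S)"
proof (cases "a \<in> S")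
  case True
  then show ?thesis using assms by (simp add: insert_absorb)
next
  case False
  have m: "(\<lambda>t. indicator S t *\<^sub>R f t) \<in> borel_measurable borel"
    using assms(1) by (simp add: square_integrable_on_def set_borel_measurable_def)
  have "(\<lambda>t. indicator S t *\<^sub>R f t + indicator {a} t *\<^sub>R f a) \<in> borel_measurable borel"
    using m by measurable
  moreover have "indicator (insert a S) t *\<^sub>R f t = indicator S t *\<^sub>R f t + indicator {a} t *\<^sub>R f a" for t
    using False by (cases "t = a") (auto simp: indicator_def)
  ultimately have m': "set_borel_measurable lborel (insert a S) f"
    by (simp add: set_borel_measurable_def)
  have 1: "(\<lambda>t. indicator S t *\<^sub>R f t) square_integrable_on UNIV"
    using assms(1) square_integrable_on_iff by blast
  have 2: "AE t\<in>UNIV in lborel. indicator S t *\<^sub>R f t = indicator (insert a S) t *\<^sub>R f t"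
    using AE_lborel_singleton[of a] by (rule eventually_mono) (simp add: indicator_def)
  have "(\<lambda>t. indicator (insert a S) t *\<^sub>R f t) square_integrable_on UNIV"
    by (rule square_integrable_on_cong_AE[OF 1 _ _ 2]) (use m' in \<open>simp_all add: set_borel_measurable_def\<close>)
  then show ?thesis
    using square_integrable_on_iff by blast
qed

lemma square_integrable_imp_locally_integrable:
  assumes "f square_integrable_on S"
  shows "f locally_integrable_on S"
  unfolding locally_integrable_on_def
proof (intro allI impI)
  fix K assume K: "compact K" "K \<subseteq> S"
  then have Kb: "K \<in> sets borel" by (simp add: borel_compact)
  have f: "f square_integrable_on K"
    using assms K(2) Kb by (rule square_integrable_on_subset)
  have "set_integrable lborel K (\<lambda>t. 1 + (norm (f t))\<^sup>2)"
  proof (rule set_integral_add(1))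
    show "set_integrable lborel K (\<lambda>t. 1 :: real)"
      using K(1) unfolding set_integrable_def by (intro borel_integrable_compact) auto
    show "set_integrable lborel K (\<lambda>t. (norm (f t))\<^sup>2)"
      using f by (simp add: square_integrable_on_def)
  qed
  then show "set_integrable lborel K f"
  proof (rule set_integrable_bound)
    show "set_borel_measurable lborel K f"
      using f by (simp add: square_integrable_on_def)
    have "norm (f t) \<le> norm (1 + (norm (f t))\<^sup>2)" for t
    proof -
      have "0 \<le> (norm (f t) - 1)\<^sup>2 + (norm (f t))\<^sup>2"
        by simp
      moreover have "0 \<le> norm (f t)" by simp
      ultimately show ?thesis
        by (simp add: power2_eq_square algebra_simps)
    qed
    then show "AE t in lborel. t \<in> K \<longrightarrow> norm (f t) \<le> norm (1 + (norm (f t))\<^sup>2)"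
      by simp
  qed
qed

text \<open>A weak derivative picked by \<open>SOME\<close> is known only to be integrable on
  compact subsets. Covering the open set by rational intervals and making them disjoint exhibits it
  as a pointwise limit of measurable functions.\<close>

lemma locally_integrable_on_set_borel_measurable:
  fixes f :: "real \<Rightarrow> complex"
  assumes "open S" "f locally_integrable_on S"
  shows "set_borel_measurable lborel S f"
proof -
  define Q where "Q = {(p, q) \<in> \<rat> \<times> \<rat>. {p..q :: real} \<subseteq> S}"
  have Q: "countable Q"
    by (rule countable_subset[of _ "\<rat> \<times> \<rat>"]) (auto simp: Q_def countable_rat)
  have m: "set_borel_measurable lborel {p..q} f" if "(p, q) \<in> Q" for p q
    using that assms(2) unfolding locally_integrable_on_def Q_def
    by (auto simp: set_integrable_def set_borel_measurable_def dest!: spec[of _ "{p..q}"])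
  have S: "(\<Union>i\<in>Q. {fst i..snd i}) = S"
  proof (intro equalityI subsetI)
    fix t assume "t \<in> S"
    then obtain e where e: "e > 0" "ball t e \<subseteq> S"
      using assms(1) openE by blast
    obtain p q where pq: "p \<in> \<rat>" "t - e < p" "p < t" "q \<in> \<rat>" "t < q" "q < t + e"
      using Rats_dense_in_real[of "t - e" t] Rats_dense_in_real[of t "t + e"] e(1) by auto
    have "{p..q} \<subseteq> ball t e"
      using pq by (auto simp: dist_real_def)
    then have "(p, q) \<in> Q" using pq e by (auto simp: Q_def)
    then show "t \<in> (\<Union>i\<in>Q. {fst i..snd i})" using pq by force
  qed (auto simp: Q_def)
  show ?thesis
  proof (cases "Q = {}")
    case True
    then show ?thesis using S by (simp add: set_borel_measurable_def)
  next
    case False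
    define A where "A n = {fst (from_nat_into Q n)..snd (from_nat_into Q n)}" for n
    have A: "set_borel_measurable lborel (A n) f" for n
      using m[of "fst (from_nat_into Q n)" "snd (from_nat_into Q n)"] from_nat_into[OF False, of n]
      by (simp add: A_def)
    have SA: "S = (\<Union>n. A n)"
    proof -
      have "(\<Union>n. A n) = (\<Union>i\<in>range (from_nat_into Q). {fst i..snd i})"
        by (simp add: A_def)
      then show ?thesis
        unfolding range_from_nat_into[OF False Q] S by simp
    qed
    define B where "B n = disjointed A n" for n
    have Bs: "B n \<in> sets borel" for n
      unfolding B_def disjointed_def by (auto simp: A_def)
    have "set_borel_measurable lborel (B n) f" for n
      using A[of n] by (rule set_borel_measurable_subset') (auto simp: B_def Bs[unfolded B_def] disjointed_subset)
    then have mB: "(\<lambda>t. \<Sum>i<n. indicator (B i) t *\<^sub>R f t) \<in> borel_measurable borel" for n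
      by (intro borel_measurable_sum) (simp add: set_borel_measurable_def)
    have "(\<lambda>n. \<Sum>i<n. indicator (B i) t *\<^sub>R f t) \<longlonglongrightarrow> indicator S t *\<^sub>R f t" for t
    proof -
      have "(\<lambda>i. indicator (B i) t :: real) sums indicator (\<Union>i. B i) t"
        by (rule indicator_sums) (use disjoint_family_disjointed[of A] in \<open>auto simp: disjoint_family_on_def B_def\<close>)
      then have "(\<lambda>i. indicator (B i) t *\<^sub>R f t) sums (indicator S t *\<^sub>R f t)"
        using sums_scaleR_left[of "\<lambda>i. indicator (B i) t :: real" _ "f t"] by (simp add: SA B_def UN_disjointed_eq)
      then show ?thesis by (simp add: sums_def)
    qed
    then have "(\<lambda>t. indicator S t *\<^sub>R f t) \<in> borel_measurable borel"
      by (intro borel_measurable_LIMSEQ_metric[OF mB]) auto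
    then show ?thesis by (simp add: set_borel_measurable_def)
  qed
qed

text \<open>The description by \<open>THE\<close> is unambiguous: two continuous representatives
  agree almost everywhere on the open set, hence on it, hence on its closure.\<close>

lemma trace_at_eq:
  assumes S: "open S" and R: "continuous_on (closure S) R" "AE t\<in>S in lborel. \<phi> t = R t"
    and x: "x \<in> closure S"
  shows "trace_at S \<phi> x = R x"
  unfolding trace_at_def
proof (rule the_equality)
  show "\<exists>g. continuous_on (closure S) g \<and> (AE y\<in>S in lborel. g y = \<phi> y) \<and> g x = R x"
    using R by (intro exI[of _ R]) (auto elim: eventually_mono)
next
  fix c assume "\<exists>g. continuous_on (closure S) g \<and> (AE y\<in>S in lborel. g y = \<phi> y) \<and> g x = c"
  then obtain g where g: "continuous_on (closure S) g" "AE y\<in>S in lborel. g y = \<phi> y" "g x = c"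
    by blast
  have "AE y\<in>S in lborel. g y = R y"
    using g(2) R(2) by eventually_elim auto
  then have eq: "g y - R y = 0" if "y \<in> S" for y
    using AE_eq_continuous_imp_eq[OF S continuous_on_subset[OF g(1) closure_subset]
        continuous_on_subset[OF R(1) closure_subset] _ that] by simp
  have "g x - R x = 0"
    by (rule continuous_constant_on_closure[of S "\<lambda>y. g y - R y"]) (use g R x eq in \<open>auto intro!: continuous_intros\<close>)
  then show "c = R x" using g(3) by simp
qed

section \<open>Sobolev functions of order two\<close>

text \<open>The concrete form of a function in H^2: continuous function, continuous derivative,
  second derivative as a density. Unlike \<open>sobolev_H\<close> it makes sense on a closed
  half-line, so boundary data at 0 are simply \<open>R 0\<close> and \<open>R1 0\<close>.\<close>

definition H2_rep :: "real set \<Rightarrow> (real \<Rightarrow> complex) \<Rightarrow> (real \<Rightarrow> complex) \<Rightarrow> (real \<Rightarrow> complex) \<Rightarrow> bool"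
  where "H2_rep C R R1 R2 \<longleftrightarrow> primitive_on C R R1 \<and> primitive_on C R1 R2 \<and>
    R square_integrable_on C \<and> R1 square_integrable_on C \<and> R2 square_integrable_on C"

lemma primitive_on_extend:
  assumes S: "is_interval S" "S \<noteq> {}" "S \<subseteq> C" and C: "is_interval C"
    and F: "primitive_on S F g" and g: "g locally_integrable_on C"
  obtains G where "primitive_on C G g" "\<And>t. t \<in> S \<Longrightarrow> G t = F t"
proof -
  obtain G where G: "primitive_on C G g"
    using primitive_on_exists[OF C g] .
  obtain s where s: "s \<in> S" using S(2) by blast
  have eq: "F t - F s = G t - G s" if "t \<in> S" for t
  proof (cases "s \<le> t")
    case True
    have "{s..t} \<subseteq> S"
      using mem_is_interval_1_I[OF S(1) s that] by auto
    then show ?thesis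
      using primitive_onD(2)[OF F True] primitive_onD(2)[OF G True] S(3) by auto
  next
    case False
    then have ts: "t \<le> s" by simp
    have "{t..s} \<subseteq> S"
      using mem_is_interval_1_I[OF S(1) that s] by auto
    then have "F s - F t = G s - G t"
      using primitive_onD(2)[OF F ts] primitive_onD(2)[OF G ts] S(3) by auto
    then show ?thesis
      by (simp add: algebra_simps)
  qed
  have "primitive_on C (\<lambda>t. G t + (F s - G s)) g"
    using G by (simp add: primitive_on_def)
  moreover have "G t + (F s - G s) = F t" if "t \<in> S" for t
    using eq[OF that] by (simp add: algebra_simps)
  ultimately show ?thesis by (rule that)
qed

text \<open>\<open>C\<close> may add one endpoint to the open interval: a single point costs no
  integrability, and square-integrable densities are locally integrable up to it, so the primitives
  extend continuously.\<close>

lemma sobolev_H2_imp_H2_rep: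
  assumes S: "open S" "is_interval S" "S \<noteq> {}" and C: "is_interval C" "C \<in> {S, insert a S}"
    and H: "sobolev_H 2 S \<phi>"
  obtains R R1 R2 where "H2_rep C R R1 R2" "AE t\<in>S in lborel. \<phi> t = R t"
proof -
  have Sb: "S \<in> sets borel" using S by simp
  obtain g h where gh: "\<phi> square_integrable_on S" "has_weak_derivative_on \<phi> g S"
      "g square_integrable_on S" "has_weak_derivative_on g h S" "h square_integrable_on S"
    using H by (auto simp: numeral_2_eq_2)
  have sq: "f square_integrable_on C" if "f square_integrable_on S" for f
    using C(2) that square_integrable_on_insert[OF that Sb] by auto
  obtain F1 where F1: "primitive_on S F1 h" "AE t\<in>S in lborel. g t = F1 t"
    using has_weak_derivative_on_imp_primitive[OF S(1,2) gh(4)] .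
  obtain R1 where R1: "primitive_on C R1 h" "\<And>t. t \<in> S \<Longrightarrow> R1 t = F1 t"
    using primitive_on_extend[OF S(2,3) _ C(1) F1(1)
        square_integrable_imp_locally_integrable[OF sq[OF gh(5)]]] C(2) by blast
  have gR1: "AE t\<in>S in lborel. g t = R1 t"
    using F1(2) by (rule eventually_mono) (simp add: R1(2))
  obtain F where F: "primitive_on S F g" "AE t\<in>S in lborel. \<phi> t = F t"
    using has_weak_derivative_on_imp_primitive[OF S(1,2) gh(2)] .
  have meas: "set_borel_measurable lborel S f" if "primitive_on C f f'" for f f'
  proof -
    have "continuous_on S f"
      using primitive_on_continuous_on[OF primitive_on_subset[OF that] S(2)] C(2) by auto
    then show ?thesis using Sb by (rule continuous_on_set_borel_measurable)
  qed
  have R1sq: "R1 square_integrable_on S"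
    by (rule square_integrable_on_cong_AE[OF gh(3) meas[OF R1(1)] Sb gR1])
  \<comment> \<open>The weak derivative \<open>g\<close> is exchanged under the integral for its
    continuous version \<open>R1\<close>, which makes the representative continuously
    differentiable.\<close>
  have F': "primitive_on S F R1"
    unfolding primitive_on_def
  proof (intro allI impI)
    fix x y :: real assume xy: "x \<le> y" "{x..y} \<subseteq> S"
    note g = primitive_onD[OF F(1) xy]
    have i: "set_integrable lborel {x..y} R1"
      by (intro borel_integrable_atLeastAtMost' primitive_on_continuous_on_Icc[OF R1(1)]) (use xy C in auto)
    moreover have "(LINT t:{x..y}|lborel. g t) = (LINT t:{x..y}|lborel. R1 t)"
    proof (rule set_integral_cong_AE')
      show "set_borel_measurable lborel {x..y} g" "set_borel_measurable lborel {x..y} R1"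
        using g(1) i by (auto simp: set_integrable_def set_borel_measurable_def)
      show "AE t\<in>{x..y} in lborel. g t = R1 t"
        using gR1 by (rule eventually_mono) (use xy in auto)
    qed
    ultimately show "set_integrable lborel {x..y} R1 \<and> (LINT t:{x..y}|lborel. R1 t) = F y - F x"
      using g by simp
  qed
  obtain R where R: "primitive_on C R R1" "\<And>t. t \<in> S \<Longrightarrow> R t = F t"
    using primitive_on_extend[OF S(2,3) _ C(1) F'
        square_integrable_imp_locally_integrable[OF sq[OF R1sq]]] C(2) by blast
  have \<phi>R: "AE t\<in>S in lborel. \<phi> t = R t"
    using F(2) by (rule eventually_mono) (simp add: R(2))
  have Rsq: "R square_integrable_on S"
    by (rule square_integrable_on_cong_AE[OF gh(1) meas[OF R(1)] Sb \<phi>R])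
  have "H2_rep C R R1 h"
    unfolding H2_rep_def using R(1) R1(1) sq[OF Rsq] sq[OF R1sq] sq[OF gh(5)] by simp
  then show ?thesis using \<phi>R by (rule that)
qed

lemma H2_rep_imp_weak_derivatives:
  assumes S: "open S" "is_interval S" "S \<subseteq> C"
    and R: "H2_rep C R R1 R2" "AE t\<in>S in lborel. \<phi> t = R t" "set_borel_measurable lborel S \<phi>"
  shows "sobolev_H 2 S \<phi>"
    and "has_weak_derivative_on \<phi> R1 S"
    and "AE t\<in>S in lborel. weak_deriv S \<phi> t = R1 t"
    and "AE t\<in>S in lborel. weak_deriv S (weak_deriv S \<phi>) t = R2 t"
    and "set_borel_measurable lborel S (weak_deriv S (weak_deriv S \<phi>))"
proof -
  have Sb: "S \<in> sets borel" using S by simp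
  have p: "primitive_on S R R1" "primitive_on S R1 R2"
    using R(1) S(3) by (auto simp: H2_rep_def intro: primitive_on_subset)
  have m: "set_borel_measurable lborel S R" "set_borel_measurable lborel S R1"
    using primitive_on_continuous_on[OF p(1) S(2)] primitive_on_continuous_on[OF p(2) S(2)] Sb
    by (auto intro: continuous_on_set_borel_measurable)
  show w: "has_weak_derivative_on \<phi> R1 S"
    by (rule has_weak_derivative_on_primitive[OF S(1,2) p(1) R(3,2)])
  have w1: "has_weak_derivative_on R1 R2 S"
    by (rule has_weak_derivative_on_primitive[OF S(1,2) p(2) m(2)]) simp
  have sq: "R square_integrable_on S" "R1 square_integrable_on S" "R2 square_integrable_on S"
    using R(1) S(3) Sb by (auto simp: H2_rep_def intro: square_integrable_on_subset)
  have "AE t\<in>S in lborel. R t = \<phi> t"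
    using R(2) by (rule eventually_mono) simp
  then have "\<phi> square_integrable_on S"
    by (rule square_integrable_on_cong_AE[OF sq(1) R(3) Sb])
  then show "sobolev_H 2 S \<phi>"
    using w w1 sq by (auto simp: numeral_2_eq_2)
  show ae1: "AE t\<in>S in lborel. weak_deriv S \<phi> t = R1 t"
    by (rule has_weak_derivative_on_unique[OF S(1,2) weak_deriv_works[OF w] w]) simp
  have loc: "weak_deriv S \<phi> locally_integrable_on S"
    using weak_deriv_works[OF w] by (simp add: has_weak_derivative_on_def)
  \<comment> \<open>The second weak derivative is taken of the chosen
    \<open>weak_deriv S \<phi>\<close>, not of \<open>R1\<close>; it has to be carried over along
    almost everywhere equality.\<close>
  have w1': "has_weak_derivative_on (weak_deriv S \<phi>) R2 S"
  proof (cases "S = {}")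
    case True
    then show ?thesis
      by (simp add: has_weak_derivative_on_def locally_integrable_on_def set_lebesgue_integral_def)
  next
    case False
    obtain G where G: "primitive_on S G (weak_deriv S \<phi>)"
      using primitive_on_exists[OF S(2) loc] .
    have "set_borel_measurable lborel S (weak_deriv S \<phi>)"
      using locally_integrable_on_set_borel_measurable[OF S(1) loc] .
    moreover have "AE t\<in>S in lborel. R1 t = weak_deriv S \<phi> t"
      using ae1 by (rule eventually_mono) simp
    ultimately show ?thesis
      by (intro has_weak_derivative_on_cong_AE[OF w1 S(1)])
  qed
  show "AE t\<in>S in lborel. weak_deriv S (weak_deriv S \<phi>) t = R2 t"
    by (rule has_weak_derivative_on_unique[OF S(1,2) weak_deriv_works[OF w1'] w1']) simp
  show "set_borel_measurable lborel S (weak_deriv S (weak_deriv S \<phi>))"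
    using weak_deriv_works[OF w1'] S(1)
    by (auto simp: has_weak_derivative_on_def intro: locally_integrable_on_set_borel_measurable)
qed

lemma square_integrable_on_uminus:
  assumes "f square_integrable_on C"
  shows "(\<lambda>t. f (- t)) square_integrable_on (uminus ` C)"
proof -
  have eq: "indicator (uminus ` C) t = (indicator C (0 + (-1) * t) :: real)" for t :: real
    by (auto simp: indicator_def image_iff) (metis minus_minus)
  have "(\<lambda>t. indicator C t *\<^sub>R f t) \<in> borel_measurable borel"
    using assms by (simp add: square_integrable_on_def set_borel_measurable_def)
  then have "(\<lambda>t. indicator C (0 + (-1) * t) *\<^sub>R f (0 + (-1) * t)) \<in> borel_measurable borel"
    by (rule measurable_compose[rotated]) measurable
  moreover have "integrable lborel (\<lambda>t. indicator C (0 + (-1) * t) *\<^sub>R (norm (f (0 + (-1) * t)))\<^sup>2)"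
    using assms unfolding square_integrable_on_def set_integrable_def
    by (intro lborel_integrable_real_affine[where f = "\<lambda>t. indicator C t *\<^sub>R (norm (f t))\<^sup>2"]) auto
  ultimately show ?thesis
    by (simp add: square_integrable_on_def set_borel_measurable_def set_integrable_def eq)
qed

lemma H2_rep_uminus:
  assumes "H2_rep C R R1 R2"
  shows "H2_rep (uminus ` C) (\<lambda>t. R (- t)) (\<lambda>t. - R1 (- t)) (\<lambda>t. R2 (- t))"
proof -
  have "primitive_on (uminus ` C) (\<lambda>t. R (- t)) (\<lambda>t. - R1 (- t))"
    using assms by (intro primitive_on_uminus) (simp add: H2_rep_def)
  moreover have "primitive_on (uminus ` C) (\<lambda>t. (-1) * R1 (- t)) (\<lambda>t. (-1) * - R2 (- t))"
    using assms by (intro primitive_on_cmult primitive_on_uminus) (simp add: H2_rep_def)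
  moreover have "(\<lambda>t. (-1) * R1 (- t)) square_integrable_on (uminus ` C)"
    using assms square_integrable_on_uminus[of R1 C]
    unfolding H2_rep_def square_integrable_on_iff[of _ "uminus ` C"]
    using square_integrable_cmult[of "\<lambda>t. indicator (uminus ` C) t *\<^sub>R R1 (- t)" "-1"] by simp
  ultimately show ?thesis
    using assms by (simp add: H2_rep_def square_integrable_on_uminus)
qed

lemma AE_uminus:
  assumes "AE t\<in>S in lborel. P t"
  shows "AE t\<in>uminus ` S in lborel. P (- t :: real)"
proof -
  have "AE t in distr lborel borel uminus. t \<in> S \<longrightarrow> P t"
    unfolding lborel_distr_uminus by (rule assms)
  then have "AE t in lborel. - t \<in> S \<longrightarrow> P (- t)"
    by (rule AE_distrD[rotated]) measurable
  then show ?thesis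
    by (rule eventually_mono) auto
qed

lemma primitive_on_cong_AE:
  assumes F: "primitive_on S F f" "\<And>t. t \<in> S \<Longrightarrow> F' t = F t"
    and f: "AE t\<in>S in lborel. f t = f' t" "set_borel_measurable lborel S f'"
  shows "primitive_on S F' f'"
  unfolding primitive_on_def
proof (intro allI impI)
  fix x y :: real assume xy: "x \<le> y" "{x..y} \<subseteq> S"
  note fi = primitive_onD[OF F(1) xy]
  have m: "set_borel_measurable lborel {x..y} f'"
    using f(2) xy(2) by (rule set_borel_measurable_subset') simp
  have ae: "AE t\<in>{x..y} in lborel. f t = f' t"
    using f(1) by (rule eventually_mono) (use xy(2) in auto)
  have "x \<in> S" "y \<in> S" using xy by auto
  moreover have "set_borel_measurable lborel {x..y} f"
    using fi(1) by (auto simp: set_integrable_def set_borel_measurable_def)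
  ultimately show "set_integrable lborel {x..y} f' \<and> (LINT t:{x..y}|lborel. f' t) = F' y - F' x"
    using set_integrable_cong_AE'[OF fi(1) m ae] set_integral_cong_AE'[OF _ m ae] fi(2) F(2) by simp
qed

lemma H2_rep_cong_AE:
  assumes "H2_rep C R R1 R2" "C \<in> sets borel"
    and "AE t\<in>C in lborel. R2 t = R2' t" "set_borel_measurable lborel C R2'"
  shows "H2_rep C R R1 R2'"
  using assms primitive_on_cong_AE[of C R1 R2 R1 R2'] square_integrable_on_cong_AE[of R2 C R2']
  by (simp add: H2_rep_def)

lemma AE_half_lines:
  assumes "AE t\<in>{0<..} in lborel. P t" "AE t\<in>{..<0} in lborel. P (t :: real)"
  shows "AE t in lborel. P t"
  using assms AE_lborel_singleton[of "0 :: real"] by eventually_elim (metis greaterThan_iff lessThan_iff linorder_neqE)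

lemma has_weak_derivative_on_cong:
  assumes "has_weak_derivative_on f g S" "\<And>t. t \<in> S \<Longrightarrow> g t = g' t"
  shows "has_weak_derivative_on f g' S"
proof -
  have "set_integrable lborel K g' = set_integrable lborel K g" if "K \<subseteq> S" for K
    by (rule set_integrable_cong) (use assms(2) that in auto)
  moreover have "(LINT y:S|lborel. \<psi> y *\<^sub>R g' y) = (LINT y:S|lborel. \<psi> y *\<^sub>R g y)" for \<psi>
    unfolding set_lebesgue_integral_def
    by (rule Bochner_Integration.integral_cong) (auto simp: indicator_def assms(2))
  ultimately show ?thesis
    using assms(1) by (simp add: has_weak_derivative_on_def locally_integrable_on_def)
qed

text \<open>The punctured line is no interval, so primitives do not apply to it directly. A test
  function on it is supported away from 0, hence the two halves of its support are compact and one
  may integrate by parts on each half-line without boundary terms.\<close>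

lemma has_weak_derivative_on_punctured:
  assumes w: "has_weak_derivative_on f g {0<..}" "has_weak_derivative_on f g {..<0}"
  shows "has_weak_derivative_on f g (- {0})"
proof -
  \<comment> \<open>As \<open>K\<close> avoids 0, cutting it with an open half-line is the same as
    cutting it with the closed one, which preserves compactness.\<close>
  have half: "K \<inter> {0<..} = K \<inter> {0..}" "K \<inter> {..<0} = K \<inter> {..0}" "K = (K \<inter> {0<..}) \<union> (K \<inter> {..<0})"
    if "K \<subseteq> - {0 :: real}" for K
    using that by (auto simp: less_le subset_iff)
  have cpt: "compact (K \<inter> {0<..})" "compact (K \<inter> {..<0})" if "K \<subseteq> - {0 :: real}" "compact K" for K
    unfolding half(1,2)[OF that(1)] using that(2) by (auto intro: compact_Int_closed)
  have loc: "h locally_integrable_on (- {0})"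
    if h: "h locally_integrable_on {0<..}" "h locally_integrable_on {..<0}" for h
    unfolding locally_integrable_on_def
  proof (intro allI impI)
    fix K :: "real set" assume K: "compact K" "K \<subseteq> - {0}"
    have "set_integrable lborel ((K \<inter> {0<..}) \<union> (K \<inter> {..<0})) h"
      using h cpt[OF K(2,1)]
      by (intro set_integrable_Un) (auto simp: locally_integrable_on_def intro: borel_compact)
    then show "set_integrable lborel K h"
      using half(3)[OF K(2)] by simp
  qed
  obtain F where F: "primitive_on {0<..} F g" "AE t\<in>{0<..} in lborel. f t = F t"
    using has_weak_derivative_on_imp_primitive[OF _ _ w(1)] by auto
  obtain G where G: "primitive_on {..<0} G g" "AE t\<in>{..<0} in lborel. f t = G t"
    using has_weak_derivative_on_imp_primitive[OF _ _ w(2)] by auto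
  have loc2: "f locally_integrable_on {0<..}" "f locally_integrable_on {..<0}"
    "g locally_integrable_on {0<..}" "g locally_integrable_on {..<0}"
    using w by (auto simp: has_weak_derivative_on_def)
  have mf: "set_borel_measurable lborel {0<..} f" "set_borel_measurable lborel {..<0} f"
    using loc2 by (auto intro: locally_integrable_on_set_borel_measurable)
  show ?thesis
    unfolding has_weak_derivative_on_def
  proof (intro conjI allI impI loc loc2)
    fix \<psi> assume \<psi>: "test_function (- {0}) \<psi>"
    then obtain K where K: "compact K" "K \<subseteq> - {0}" "\<And>x. x \<notin> K \<Longrightarrow> \<psi> x = 0"
      unfolding test_function_def by blast
    note 1 = integral_by_parts_test_function'[OF _ _ F(1) mf(1) F(2) \<psi> cpt(1)[OF K(2,1)] K(3)]
    note 2 = integral_by_parts_test_function'[OF _ _ G(1) mf(2) G(2) \<psi> cpt(2)[OF K(2,1)] K(3)]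
    have un: "- {0 :: real} = {0<..} \<union> {..<0}" by auto
    have e: "(LINT y:- {0}|lborel. h y) = (LINT y:{0<..}|lborel. h y) + (LINT y:{..<0}|lborel. h y)"
      if "set_integrable lborel {0<..} h" "set_integrable lborel {..<0} h" for h :: "real \<Rightarrow> complex"
      unfolding un using that by (intro set_integral_Un) auto
    show "(LINT y:- {0}|lborel. deriv \<psi> y *\<^sub>R f y) = - (LINT y:- {0}|lborel. \<psi> y *\<^sub>R g y)"
      using 1 2 by (simp add: e)
  qed
qed

section \<open>The operators in terms of their restrictions to the two half-lines\<close>

definition glue :: "(real \<Rightarrow> complex) \<Rightarrow> (real \<Rightarrow> complex) \<Rightarrow> real \<Rightarrow> complex"
  where "glue R L y = (if 0 \<le> y then R y else L (- y))"

text \<open>\<open>R\<close> and \<open>L\<close> describe a function on the two half-lines, both oriented outwards from \<open>0\<close>,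
  so that the jump of the derivative at \<open>0\<close> is \<open>R1 0 + L1 0\<close>.\<close>

definition jump_rep where
  "jump_rep \<gamma> R R1 R2 L L1 L2 \<longleftrightarrow> H2_rep {0..} R R1 R2 \<and> H2_rep {0..} L L1 L2 \<and>
    R 0 = L 0 \<and> R1 0 + L1 0 = - of_real \<gamma> * R 0"

lemma uminus_image_half_lines:
  "uminus ` {0..} = {..0 :: real}" "uminus ` {..0} = {0 :: real..}"
  "uminus ` {0<..} = {..<0 :: real}" "uminus ` {..<0} = {0 :: real<..}"
  by (auto simp: image_iff intro: exI[of _ "- _"] bexI[of _ "- _"])

lemma glue_square_integrable:
  assumes "R square_integrable_on {0..}" "L square_integrable_on {0..}"
  shows "glue R L square_integrable_on UNIV"
proof -
  have "(\<lambda>t. L (- t)) square_integrable_on {..<0}"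
    using square_integrable_on_uminus[OF assms(2)]
    by (intro square_integrable_on_subset[where T = "{..<0}" and S = "uminus ` {0..}"]) (auto simp: uminus_image_half_lines)
  then have "(\<lambda>t. indicator {0..} t *\<^sub>R R t + indicator {..<0} t *\<^sub>R L (- t)) square_integrable_on UNIV"
    by (rule square_integrable_add[OF assms(1)[unfolded square_integrable_on_iff[of R]]
        iffD1[OF square_integrable_on_iff[of "\<lambda>t. L (- t)"]]])
  moreover have "(\<lambda>t. indicator {0..} t *\<^sub>R R t + indicator {..<0} t *\<^sub>R L (- t)) = glue R L"
    by (auto simp: glue_def indicator_def)
  ultimately show ?thesis by simp
qed

lemma AE_glue_iff:
  "(AE y in lborel. f y = glue R L y) \<longleftrightarrow>
    (AE y\<in>{0<..} in lborel. f y = R y) \<and> (AE y\<in>{..<0} in lborel. f y = L (- y))"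
proof (intro iffI conjI)
  assume *: "AE y in lborel. f y = glue R L y"
  show "AE y\<in>{0<..} in lborel. f y = R y"
    using * by (rule eventually_mono) (simp add: glue_def)
  show "AE y\<in>{..<0} in lborel. f y = L (- y)"
    using * by (rule eventually_mono) (simp add: glue_def)
next
  assume *: "(AE y\<in>{0<..} in lborel. f y = R y) \<and> (AE y\<in>{..<0} in lborel. f y = L (- y))"
  show "AE y in lborel. f y = glue R L y"
  proof (rule AE_half_lines)
    show "AE y\<in>{0<..} in lborel. f y = glue R L y"
      using conjunct1[OF *] by (rule eventually_mono) (simp add: glue_def)
    show "AE y\<in>{..<0} in lborel. f y = glue R L y"
      using conjunct2[OF *] by (rule eventually_mono) (simp add: glue_def)
  qed
qed

section \<open>Passing between equivalence classes and functions\<close>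

lemma rep_L2_sq: "rep_L2 u square_integrable_on UNIV"
  using Quotient_rep_reflp[OF Quotient_L2, of u] by (simp add: L2_rel_def)

lemma abs_rep_L2: "abs_L2 (rep_L2 u) = u"
  by (rule Quotient_abs_rep[OF Quotient_L2])

lemma rep_abs_L2:
  assumes "f square_integrable_on UNIV"
  shows "AE y in lborel. rep_L2 (abs_L2 f) y = f y"
proof -
  have "L2_rel f f" using assms by (simp add: L2_rel_def)
  then have "L2_rel (rep_L2 (abs_L2 f)) f"
    by (rule Quotient_rep_abs[OF Quotient_L2])
  then show ?thesis by (simp add: L2_rel_def)
qed

lemma abs_L2_cong_AE:
  assumes "f square_integrable_on UNIV" "g \<in> borel_measurable borel" "AE y in lborel. f y = g y"
  shows "abs_L2 g = abs_L2 f"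
proof -
  have "g square_integrable_on UNIV"
    by (rule square_integrable_on_cong_AE[OF assms(1)]) (use assms in \<open>auto simp: set_borel_measurable_def\<close>)
  then have "L2_rel f g" using assms by (simp add: L2_rel_def)
  then show ?thesis
    using Quotient_rel_abs[OF Quotient_L2] by metis
qed

lemma L2_eqI:
  assumes "AE y in lborel. rep_L2 u y = rep_L2 v y"
  shows "u = v"
proof -
  have "L2_rel (rep_L2 u) (rep_L2 v)"
    using assms rep_L2_sq by (simp add: L2_rel_def)
  then show ?thesis
    using Quotient_rel_rep[OF Quotient_L2] by metis
qed

lemma H2_rep_continuous_on: 
  assumes "H2_rep C R R1 R2" "is_interval C"
  shows "continuous_on C R" "continuous_on C R1"
  using assms by (auto simp: H2_rep_def intro: primitive_on_continuous_on)

lemma sq_UNIV_measurable: "f square_integrable_on UNIV \<Longrightarrow> f \<in> borel_measurable borel"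
  by (simp add: square_integrable_on_UNIV_iff)

lemma set_borel_measurable_of_measurable:
  "f \<in> borel_measurable borel \<Longrightarrow> S \<in> sets borel \<Longrightarrow> set_borel_measurable lborel S (f :: real \<Rightarrow> complex)"
  by (simp add: set_borel_measurable_def)

lemma H2_rep_left:
  assumes "H2_rep {0..} L L1 L2"
  shows "H2_rep {..0} (\<lambda>t. L (- t)) (\<lambda>t. - L1 (- t)) (\<lambda>t. L2 (- t))"
  using H2_rep_uminus[OF assms] by (simp add: uminus_image_half_lines)

text \<open>The minus sign comes from reflecting the left half; equality of the values at 0 is what
  excludes a point mass in the derivative.\<close>

lemma primitive_on_glue_half_lines:
  assumes R: "primitive_on {0..} R R1" "R1 square_integrable_on {0..}"
    and L: "primitive_on {0..} L L1" "L1 square_integrable_on {0..}"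
    and RL: "R 0 = L 0"
  shows "primitive_on UNIV (glue R L) (glue R1 (\<lambda>t. - L1 t))"
proof (rule primitive_on_glue[of 0])
  have "(\<lambda>t. - L1 t) square_integrable_on {0..}"
    using L(2) by (simp add: square_integrable_on_def set_borel_measurable_def)
  then have m: "glue R1 (\<lambda>t. - L1 t) \<in> borel_measurable borel"
    by (intro sq_UNIV_measurable glue_square_integrable R)
  show "primitive_on {0..} (glue R L) (glue R1 (\<lambda>t. - L1 t))"
    by (rule primitive_on_cong_AE[OF R(1)])
      (use m in \<open>auto simp: glue_def set_borel_measurable_of_measurable\<close>)
  have L': "primitive_on {..0} (\<lambda>t. L (- t)) (\<lambda>t. - L1 (- t))"
    using primitive_on_uminus[OF L(1)] by (simp add: uminus_image_half_lines)
  show "primitive_on {..0} (glue R L) (glue R1 (\<lambda>t. - L1 t))"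
  proof (rule primitive_on_cong_AE[OF L'])
    show "AE t\<in>{..0} in lborel. - L1 (- t) = glue R1 (\<lambda>t. - L1 t) t"
      using AE_lborel_singleton[of 0] by (rule eventually_mono) (auto simp: glue_def)
  qed (use m RL in \<open>auto simp: glue_def set_borel_measurable_of_measurable\<close>)
qed

lemma jump_rep_primitive:
  assumes "jump_rep \<gamma> R R1 R2 L L1 L2"
  shows "primitive_on UNIV (glue R L) (glue R1 (\<lambda>t. - L1 t))"
  using assms by (intro primitive_on_glue_half_lines) (auto simp: jump_rep_def H2_rep_def)

lemma glue_restrict:
  assumes "AE y in lborel. \<phi> y = glue R L y"
  shows "AE y\<in>{0<..} in lborel. \<phi> y = R y" "AE y\<in>{..<0} in lborel. \<phi> y = L (- y)"
  using assms AE_glue_iff by blast+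

lemma jump_rep_traces:
  assumes J: "H2_rep {0..} R R1 R2" "H2_rep {0..} L L1 L2"
    and \<phi>: "\<phi> square_integrable_on UNIV" "AE y in lborel. \<phi> y = glue R L y"
  shows "sobolev_H 2 {0<..} \<phi>" "sobolev_H 2 {..<0} \<phi>"
    "trace_at {0<..} \<phi> 0 = R 0" "trace_at {..<0} \<phi> 0 = L 0"
    "trace_at {0<..} (weak_deriv {0<..} \<phi>) 0 = R1 0"
    "trace_at {..<0} (weak_deriv {..<0} \<phi>) 0 = - L1 0"
    "has_weak_derivative_on \<phi> R1 {0<..}" "has_weak_derivative_on \<phi> (\<lambda>t. - L1 (- t)) {..<0}"
proof -
  note l = H2_rep_left[OF J(2)]
  note ae = glue_restrict[OF \<phi>(2)]
  have m: "set_borel_measurable lborel {0<..} \<phi>" "set_borel_measurable lborel {..<0} \<phi>"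
    using sq_UNIV_measurable[OF \<phi>(1)] by (auto intro: set_borel_measurable_of_measurable)
  have sub: "{0<..} \<subseteq> {0 :: real..}" "{..<0} \<subseteq> {..0 :: real}"
    by auto
  note wr = H2_rep_imp_weak_derivatives[OF _ _ sub(1) J(1) ae(1) m(1)]
  note wl = H2_rep_imp_weak_derivatives[OF _ _ sub(2) l ae(2) m(2)]
  show "sobolev_H 2 {0<..} \<phi>" "has_weak_derivative_on \<phi> R1 {0<..}"
    using wr(1,2) by auto
  show "sobolev_H 2 {..<0} \<phi>" "has_weak_derivative_on \<phi> (\<lambda>t. - L1 (- t)) {..<0}"
    using wl(1,2) by auto
  note cr = H2_rep_continuous_on[OF J(1)] and cl = H2_rep_continuous_on[OF l]
  show "trace_at {0<..} \<phi> 0 = R 0"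
    by (rule trace_at_eq) (use ae cr in auto)
  show "trace_at {0<..} (weak_deriv {0<..} \<phi>) 0 = R1 0"
    by (rule trace_at_eq) (use wr(3) cr in auto)
  have "trace_at {..<0} \<phi> 0 = L (- 0)"
    by (rule trace_at_eq) (use ae cl in auto)
  then show "trace_at {..<0} \<phi> 0 = L 0" by simp
  have "trace_at {..<0} (weak_deriv {..<0} \<phi>) 0 = - L1 (- 0)"
    by (rule trace_at_eq) (use wl(3) cl in auto)
  then show "trace_at {..<0} (weak_deriv {..<0} \<phi>) 0 = - L1 0" by simp
qed

lemma sobolev_H1_primitive:
  assumes "sobolev_H 1 UNIV \<phi>"
  obtains F where "continuous_on UNIV F" "AE y in lborel. \<phi> y = F y"
proof -
  obtain g where "has_weak_derivative_on \<phi> g UNIV"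
    using assms by auto
  then obtain F where F: "primitive_on UNIV F g" "AE t\<in>UNIV in lborel. \<phi> t = F t"
    using has_weak_derivative_on_imp_primitive[of UNIV \<phi> g] by auto
  then show ?thesis
    using that primitive_on_continuous_on[OF F(1)] by simp
qed

text \<open>H^2 on each half-line gives the two pieces with their boundary values; H^1 across 0
  gives a continuous representative on the whole line, which forces the two values at 0 to
  coincide.\<close>

lemma L_dom_imp_jump_rep:
  assumes "u \<in> L_dom \<alpha> k"
  obtains R R1 R2 L L1 L2 where "jump_rep ((real k)\<^sup>2 * \<alpha>) R R1 R2 L L1 L2"
    "AE y in lborel. rep_L2 u y = glue R L y"
proof -
  define \<phi> where "\<phi> = rep_L2 u"
  have \<phi>: "\<phi> square_integrable_on UNIV" "sobolev_H 1 UNIV \<phi>" "sobolev_H 2 {..<0} \<phi>" "sobolev_H 2 {0<..} \<phi>"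
    "trace_at {0<..} (weak_deriv {0<..} \<phi>) 0 - trace_at {..<0} (weak_deriv {..<0} \<phi>) 0
      = - of_real ((real k)\<^sup>2 * \<alpha>) * trace_at UNIV \<phi> 0"
    using assms rep_L2_sq by (auto simp: L_dom_def Let_def \<phi>_def)
  obtain R R1 R2 where R: "H2_rep {0..} R R1 R2" "AE t\<in>{0<..} in lborel. \<phi> t = R t"
    by (rule sobolev_H2_imp_H2_rep[OF _ _ _ _ _ \<phi>(4), of "{0..}" 0]) auto
  obtain M M1 M2 where M: "H2_rep {..0} M M1 M2" "AE t\<in>{..<0} in lborel. \<phi> t = M t"
    by (rule sobolev_H2_imp_H2_rep[OF _ _ _ _ _ \<phi>(3), of "{..0}" 0]) auto
  define L where "L t = M (- t)" for t
  have L: "H2_rep {0..} L (\<lambda>t. - M1 (- t)) (\<lambda>t. M2 (- t))"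
    using H2_rep_uminus[OF M(1)] by (simp add: uminus_image_half_lines L_def[abs_def])
  have ae: "AE y in lborel. \<phi> y = glue R L y"
    unfolding AE_glue_iff using R(2) M(2) by (simp add: L_def)
  note tr = jump_rep_traces[OF R(1) L \<phi>(1) ae]
  obtain F where F: "continuous_on UNIV F" "AE y in lborel. \<phi> y = F y"
    using sobolev_H1_primitive[OF \<phi>(2)] .
  have F0: "trace_at S \<phi> 0 = F 0" if "open S" "0 \<in> closure S" for S
    by (rule trace_at_eq[OF that(1) continuous_on_subset[OF F(1)] _ that(2)])
      (use F(2) in \<open>auto elim: eventually_mono\<close>)
  have "R 0 = F 0" "L 0 = F 0"
    using F0[of "{0<..}"] F0[of "{..<0}"] tr(3,4) by auto
  then have "jump_rep ((real k)\<^sup>2 * \<alpha>) R R1 R2 L (\<lambda>t. - M1 (- t)) (\<lambda>t. M2 (- t))"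
    using R(1) L \<phi>(5) tr(5,6) F0[of UNIV] by (simp add: jump_rep_def)
  then show ?thesis
    using that ae by (simp add: \<phi>_def)
qed

lemma jump_rep_imp_L_dom:
  assumes J: "jump_rep ((real k)\<^sup>2 * \<alpha>) R R1 R2 L L1 L2"
    and u: "AE y in lborel. rep_L2 u y = glue R L y"
  shows "u \<in> L_dom \<alpha> k"
proof -
  define \<phi> where "\<phi> = rep_L2 u"
  have \<phi>: "\<phi> square_integrable_on UNIV" "AE y in lborel. \<phi> y = glue R L y"
    using u rep_L2_sq by (auto simp: \<phi>_def)
  have H: "H2_rep {0..} R R1 R2" "H2_rep {0..} L L1 L2" "R 0 = L 0"
    "R1 0 + L1 0 = - of_real ((real k)\<^sup>2 * \<alpha>) * R 0"
    using J by (auto simp: jump_rep_def)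
  note tr = jump_rep_traces[OF H(1,2) \<phi>]
  note P = jump_rep_primitive[OF J]
  have m: "set_borel_measurable lborel UNIV \<phi>"
    using sq_UNIV_measurable[OF \<phi>(1)] by (auto intro: set_borel_measurable_of_measurable)
  have w: "has_weak_derivative_on \<phi> (glue R1 (\<lambda>t. - L1 t)) UNIV"
    by (rule has_weak_derivative_on_primitive[OF _ _ P m]) (use \<phi>(2) in auto)
  have "(\<lambda>t. - L1 t) square_integrable_on {0..}"
    using H(2) by (simp add: H2_rep_def square_integrable_on_def set_borel_measurable_def)
  then have "glue R1 (\<lambda>t. - L1 t) square_integrable_on UNIV"
    using H(1) by (intro glue_square_integrable) (auto simp: H2_rep_def)
  then have "sobolev_H 1 UNIV \<phi>"
    using w \<phi>(1) by auto
  moreover have "trace_at UNIV \<phi> 0 = glue R L 0"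
    by (rule trace_at_eq) (use \<phi>(2) primitive_on_continuous_on[OF P] in auto)
  then have "trace_at UNIV \<phi> 0 = R 0" by (simp add: glue_def)
  ultimately show ?thesis
    using tr(1,2,5,6) H(4) by (simp add: L_dom_def Let_def \<phi>_def)
qed

text \<open>Both chosen weak derivatives on the punctured line are identified separately on the two
  half-lines, where uniqueness is available. The jump of the first derivative at 0 does not enter
  because test functions vanish near 0.\<close>

lemma jump_rep_weak_derivatives:
  assumes J: "jump_rep \<gamma> R R1 R2 L L1 L2"
    and \<phi>: "\<phi> square_integrable_on UNIV" "AE y in lborel. \<phi> y = glue R L y"
  shows "weak_deriv (- {0}) (weak_deriv (- {0}) \<phi>) \<in> borel_measurable borel"
    and "AE y in lborel. weak_deriv (- {0}) (weak_deriv (- {0}) \<phi>) y = glue R2 L2 y"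
proof -
  have H: "H2_rep {0..} R R1 R2" "H2_rep {0..} L L1 L2"
    using J by (auto simp: jump_rep_def)
  note l = H2_rep_left[OF H(2)]
  note tr = jump_rep_traces[OF H \<phi>]
  have m: "set_borel_measurable lborel UNIV \<phi>"
    using sq_UNIV_measurable[OF \<phi>(1)] by (auto intro: set_borel_measurable_of_measurable)
  have "has_weak_derivative_on \<phi> (glue R1 (\<lambda>t. - L1 t)) UNIV"
    by (rule has_weak_derivative_on_primitive[OF _ _ jump_rep_primitive[OF J] m]) (use \<phi>(2) in auto)
  then have "has_weak_derivative_on \<phi> (glue R1 (\<lambda>t. - L1 t)) (- {0})"
    by (rule has_weak_derivative_on_subset) auto
  define g where "g = weak_deriv (- {0}) \<phi>"
  have g: "has_weak_derivative_on \<phi> g (- {0})"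
    unfolding g_def by (rule weak_deriv_works) fact
  have gr: "has_weak_derivative_on \<phi> g {0<..}" and gl: "has_weak_derivative_on \<phi> g {..<0}"
    by (rule has_weak_derivative_on_subset[OF g]; auto)+
  have "AE t\<in>{0<..} in lborel. R1 t = g t"
    by (rule has_weak_derivative_on_unique[OF _ _ tr(7) gr]) auto
  moreover have "AE t\<in>{..<0} in lborel. - L1 (- t) = g t"
    by (rule has_weak_derivative_on_unique[OF _ _ tr(8) gl]) auto
  moreover have gm: "set_borel_measurable lborel {0<..} g" "set_borel_measurable lborel {..<0} g"
    using gr gl by (auto simp: has_weak_derivative_on_def intro: locally_integrable_on_set_borel_measurable)
  moreover have "has_weak_derivative_on R1 R2 {0<..}"
  proof (rule has_weak_derivative_on_primitive)
    show "primitive_on {0<..} R1 R2" using H(1) by (auto simp: H2_rep_def intro: primitive_on_subset)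
    show "set_borel_measurable lborel {0<..} R1"
      by (rule continuous_on_set_borel_measurable, rule continuous_on_subset[OF H2_rep_continuous_on(2)[OF H(1)]]) auto
  qed auto
  moreover have "has_weak_derivative_on (\<lambda>t. - L1 (- t)) (\<lambda>t. L2 (- t)) {..<0}"
  proof (rule has_weak_derivative_on_primitive)
    show "primitive_on {..<0} (\<lambda>t. - L1 (- t)) (\<lambda>t. L2 (- t))"
      using l by (auto simp: H2_rep_def intro: primitive_on_subset)
    show "set_borel_measurable lborel {..<0} (\<lambda>t. - L1 (- t))"
      by (rule continuous_on_set_borel_measurable, rule continuous_on_subset[OF H2_rep_continuous_on(2)[OF l]]) auto
  qed auto
  ultimately have "has_weak_derivative_on g R2 {0<..}" "has_weak_derivative_on g (\<lambda>t. L2 (- t)) {..<0}"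
    by (auto intro: has_weak_derivative_on_cong_AE)
  then have w2: "has_weak_derivative_on g (glue R2 L2) {0<..}" "has_weak_derivative_on g (glue R2 L2) {..<0}"
    by (auto elim!: has_weak_derivative_on_cong simp: glue_def)
  define h where "h = weak_deriv (- {0}) g"
  have h: "has_weak_derivative_on g h (- {0})"
    unfolding h_def by (rule weak_deriv_works[OF has_weak_derivative_on_punctured[OF w2]])
  have hr: "has_weak_derivative_on g h {0<..}" and hl: "has_weak_derivative_on g h {..<0}"
    by (rule has_weak_derivative_on_subset[OF h]; auto)+
  have 1: "AE t\<in>{0<..} in lborel. h t = glue R2 L2 t"
    by (rule has_weak_derivative_on_unique[OF _ _ hr w2(1)]) auto
  have 2: "AE t\<in>{..<0} in lborel. h t = glue R2 L2 t"
    by (rule has_weak_derivative_on_unique[OF _ _ hl w2(2)]) auto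
  show "AE y in lborel. weak_deriv (- {0}) (weak_deriv (- {0}) \<phi>) y = glue R2 L2 y"
    using AE_half_lines[OF 1 2] by (simp add: h_def g_def)
  \<comment> \<open>Measurability is known only off 0; the value at the single point 0 is added by
    hand.\<close>
  have "(\<lambda>t. indicator (- {0}) t *\<^sub>R h t) \<in> borel_measurable borel"
    using locally_integrable_on_set_borel_measurable[of "- {0}" h, OF open_Compl] h
    by (simp add: has_weak_derivative_on_def set_borel_measurable_def)
  then have "(\<lambda>t. indicator (- {0}) t *\<^sub>R h t + indicator {0} t *\<^sub>R h 0) \<in> borel_measurable borel"
    by measurable
  moreover have "(\<lambda>t. indicator (- {0}) t *\<^sub>R h t + indicator {0} t *\<^sub>R h 0) = h"
    by (auto simp: indicator_def)
  ultimately show "weak_deriv (- {0}) (weak_deriv (- {0}) \<phi>) \<in> borel_measurable borel"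
    by (simp add: h_def g_def)
qed

section \<open>The step potential and the action of the operators on half-line data\<close>

definition pot :: "real \<Rightarrow> real \<Rightarrow> nat \<Rightarrow> real \<Rightarrow> real \<Rightarrow> real"
  where "pot b \<beta> k lam y = (real k)\<^sup>2 * (1 - lam * V0 b y - W b \<beta> y)"

lemma V0_measurable [measurable]: "V0 b \<in> borel_measurable borel"
  unfolding V0_def by measurable

lemma W_measurable [measurable]: "W b \<beta> \<in> borel_measurable borel"
  unfolding W_def by measurable

lemma V0_minus: "V0 b (- y) = V0 b y"
  by (simp add: V0_def indicator_def)

lemma W_minus: "W b \<beta> (- y) = W b \<beta> y"
  by (simp add: W_def indicator_def)

lemma pot_measurable [measurable]: "pot b \<beta> k lam \<in> borel_measurable borel"
  unfolding pot_def by measurable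

lemma pot_minus: "pot b \<beta> k lam (- y) = pot b \<beta> k lam y"
  by (simp add: pot_def V0_minus W_minus)

lemma pot_eq: "pot b \<beta> k lam y = (real k)\<^sup>2 * (if \<bar>y\<bar> < b then 1 - \<beta> else 1 - lam)"
  by (auto simp: pot_def V0_def W_def)

lemma pot_bounded: "\<bar>pot b \<beta> k lam y\<bar> \<le> (real k)\<^sup>2 * (\<bar>1 - \<beta>\<bar> + \<bar>1 - lam\<bar>)"
  by (auto simp: pot_eq abs_mult intro!: mult_left_mono)

lemma square_integrable_on_add:
  assumes "f square_integrable_on S" "g square_integrable_on S"
  shows "(\<lambda>y. f y + g y) square_integrable_on S"
  using square_integrable_add[of "\<lambda>t. indicator S t *\<^sub>R f t" "\<lambda>t. indicator S t *\<^sub>R g t"] assms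
    square_integrable_on_iff[of f S] square_integrable_on_iff[of g S] square_integrable_on_iff[of "\<lambda>y. f y + g y" S]
  by (simp add: scaleR_add_right)

lemma square_integrable_on_bounded_mult:
  fixes p :: "real \<Rightarrow> complex"
  assumes f: "f square_integrable_on S" and p: "p \<in> borel_measurable borel" "\<And>y. norm (p y) \<le> B"
  shows "(\<lambda>y. p y * f y) square_integrable_on S"
proof -
  define g where "g = (\<lambda>t. indicator S t *\<^sub>R f t)"
  have g: "g \<in> borel_measurable borel" "integrable lborel (\<lambda>t. (norm (g t))\<^sup>2)"
    using f unfolding square_integrable_on_iff[of f S] by (simp_all add: square_integrable_on_UNIV_iff g_def)
  have "integrable lborel (\<lambda>t. (norm (p t * g t))\<^sup>2)"
  proof (rule Bochner_Integration.integrable_bound)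
    show "integrable lborel (\<lambda>t. B\<^sup>2 * (norm (g t))\<^sup>2)"
      using g(2) by simp
    show "(\<lambda>t. (norm (p t * g t))\<^sup>2) \<in> borel_measurable lborel"
      using g(1) p(1) by measurable
    have "(norm (p t * g t))\<^sup>2 \<le> B\<^sup>2 * (norm (g t))\<^sup>2" for t
      unfolding norm_mult power_mult_distrib
      by (intro mult_right_mono power_mono p) auto
    then show "AE t in lborel. norm ((norm (p t * g t))\<^sup>2) \<le> norm (B\<^sup>2 * (norm (g t))\<^sup>2)"
      by simp
  qed
  moreover have "(\<lambda>t. p t * g t) \<in> borel_measurable borel"
    using g(1) p(1) by measurable
  ultimately have "(\<lambda>t. p t * g t) square_integrable_on UNIV"
    by (simp add: square_integrable_on_UNIV_iff)
  then show ?thesis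
    unfolding square_integrable_on_iff[of "\<lambda>y. p y * f y" S] by (simp add: g_def)
qed

lemma square_integrable_on_uminus_fun:
  "f square_integrable_on S \<Longrightarrow> (\<lambda>y. - f y) square_integrable_on S"
  by (simp add: square_integrable_on_def set_borel_measurable_def)

lemma square_integrable_on_pot:
  assumes "f square_integrable_on S"
  shows "(\<lambda>y. of_real (pot b \<beta> k lam y) * f y) square_integrable_on S"
proof (rule square_integrable_on_bounded_mult[OF assms])
  show "norm (complex_of_real (pot b \<beta> k lam y)) \<le> (real k)\<^sup>2 * (\<bar>1 - \<beta>\<bar> + \<bar>1 - lam\<bar>)" for y
    using pot_bounded by simp
qed measurable

text \<open>One expression serves both half-lines: the potential is even and reflection leaves
  second derivatives unchanged.\<close>

definition schr :: "real \<Rightarrow> real \<Rightarrow> nat \<Rightarrow> real \<Rightarrow> (real \<Rightarrow> complex) \<Rightarrow> (real \<Rightarrow> complex) \<Rightarrow> real \<Rightarrow> complex"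
  where "schr b \<beta> k lam R R2 y = - R2 y + of_real (pot b \<beta> k lam y) * R y"

lemma schr_square_integrable:
  assumes "H2_rep C R R1 R2"
  shows "schr b \<beta> k lam R R2 square_integrable_on C"
  unfolding schr_def[abs_def] using assms
  by (intro square_integrable_on_add square_integrable_on_uminus_fun square_integrable_on_pot) (auto simp: H2_rep_def)

lemma abs_diff_expr_eq:
  assumes sq: "glue (schr b \<beta> k lam R R2) (schr b \<beta> k lam L L2) square_integrable_on UNIV"
    and \<phi>: "\<phi> square_integrable_on UNIV" "AE y in lborel. \<phi> y = glue R L y"
    and d: "weak_deriv S (weak_deriv S \<phi>) \<in> borel_measurable borel"
      "AE y in lborel. weak_deriv S (weak_deriv S \<phi>) y = glue R2 L2 y"
  shows "abs_L2 (diff_expr b \<beta> k lam S \<phi>) = abs_L2 (glue (schr b \<beta> k lam R R2) (schr b \<beta> k lam L L2))"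
proof (rule abs_L2_cong_AE[OF sq])
  have "diff_expr b \<beta> k lam S \<phi> = (\<lambda>y. - weak_deriv S (weak_deriv S \<phi>) y + of_real (pot b \<beta> k lam y) * \<phi> y)"
    by (simp add: diff_expr_def pot_def fun_eq_iff)
  then show "diff_expr b \<beta> k lam S \<phi> \<in> borel_measurable borel"
    using sq_UNIV_measurable[OF \<phi>(1)] d(1) by simp
  show "AE y in lborel. glue (schr b \<beta> k lam R R2) (schr b \<beta> k lam L L2) y = diff_expr b \<beta> k lam S \<phi> y"
    using \<phi>(2) d(2)
  proof eventually_elim
    case (elim y)
    then show ?case
      using pot_minus[of b \<beta> k lam y]
      by (simp add: diff_expr_def pot_def glue_def schr_def V0_minus W_minus)
  qed
qed

lemma L_op_eq:
  assumes J: "jump_rep \<gamma> R R1 R2 L L1 L2"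
    and u: "AE y in lborel. rep_L2 u y = glue R L y"
  shows "L_op b \<beta> k lam u = abs_L2 (glue (schr b \<beta> k lam R R2) (schr b \<beta> k lam L L2))"
  unfolding L_op_def
proof (rule abs_diff_expr_eq[OF _ rep_L2_sq u jump_rep_weak_derivatives[OF J rep_L2_sq u]])
  show "glue (schr b \<beta> k lam R R2) (schr b \<beta> k lam L L2) square_integrable_on UNIV"
    using J schr_square_integrable by (auto simp: jump_rep_def intro!: glue_square_integrable)
qed

lemma H2_rep_subset:
  "H2_rep C R R1 R2 \<Longrightarrow> D \<subseteq> C \<Longrightarrow> D \<in> sets borel \<Longrightarrow> H2_rep D R R1 R2"
  by (auto simp: H2_rep_def intro: primitive_on_subset square_integrable_on_subset)

lemma L0_dom_imp_jump_rep:
  assumes "u \<in> L0_dom"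
  obtains R R1 R2 L L1 L2 where "jump_rep 0 R R1 R2 L L1 L2"
    "AE y in lborel. rep_L2 u y = glue R L y"
proof -
  have s: "sobolev_H 2 UNIV (rep_L2 u)"
    using assms by (simp add: L0_dom_def)
  obtain U U1 U2 where U: "H2_rep UNIV U U1 U2" "AE t\<in>UNIV in lborel. rep_L2 u t = U t"
    by (rule sobolev_H2_imp_H2_rep[OF _ _ _ _ _ s, of UNIV 0]) auto
  have "H2_rep {0..} U U1 U2"
    using U(1) by (rule H2_rep_subset) auto
  moreover have "H2_rep {..0} U U1 U2"
    using U(1) by (rule H2_rep_subset) auto
  then have "H2_rep {0..} (\<lambda>t. U (- t)) (\<lambda>t. - U1 (- t)) (\<lambda>t. U2 (- t))"
    using H2_rep_uminus[of "{..0}"] by (simp add: uminus_image_half_lines)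
  ultimately have "jump_rep 0 U U1 U2 (\<lambda>t. U (- t)) (\<lambda>t. - U1 (- t)) (\<lambda>t. U2 (- t))"
    by (simp add: jump_rep_def)
  moreover have "AE y in lborel. rep_L2 u y = glue U (\<lambda>t. U (- t)) y"
    using U(2) by (simp add: glue_def)
  ultimately show ?thesis by (rule that)
qed

lemma jump_rep_0_imp_H2_rep:
  assumes J: "jump_rep 0 R R1 R2 L L1 L2"
  shows "H2_rep UNIV (glue R L) (glue R1 (\<lambda>t. - L1 t)) (glue R2 L2)"
proof -
  have H: "H2_rep {0..} R R1 R2" "H2_rep {0..} L L1 L2" "R1 0 = - L1 0"
    using J by (auto simp: jump_rep_def add_eq_0_iff2)
  have "primitive_on {0..} (\<lambda>t. (-1) * L1 t) (\<lambda>t. (-1) * L2 t)"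
    using H(2) by (intro primitive_on_cmult) (simp add: H2_rep_def)
  moreover have "(\<lambda>t. - L2 t) square_integrable_on {0..}" "(\<lambda>t. - L1 t) square_integrable_on {0..}"
    using H(2) by (auto simp: H2_rep_def intro: square_integrable_on_uminus_fun)
  ultimately show ?thesis
    using H jump_rep_primitive[OF J] primitive_on_glue_half_lines[of R1 R2 "\<lambda>t. - L1 t" "\<lambda>t. - L2 t"]
    by (simp add: H2_rep_def glue_square_integrable)
qed

lemma jump_rep_imp_L0_dom:
  assumes J: "jump_rep 0 R R1 R2 L L1 L2"
    and u: "AE y in lborel. rep_L2 u y = glue R L y"
  shows "u \<in> L0_dom" "L0_op b \<beta> k lam u = abs_L2 (glue (schr b \<beta> k lam R R2) (schr b \<beta> k lam L L2))"
proof -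
  have m: "set_borel_measurable lborel UNIV (rep_L2 u)"
    using sq_UNIV_measurable[OF rep_L2_sq] by (auto intro: set_borel_measurable_of_measurable)
  have u': "AE t\<in>UNIV in lborel. rep_L2 u t = glue R L t"
    using u by simp
  note w = H2_rep_imp_weak_derivatives[OF _ _ _ jump_rep_0_imp_H2_rep[OF J] u' m]
  show "u \<in> L0_dom"
    using w(1) by (simp add: L0_dom_def)
  show "L0_op b \<beta> k lam u = abs_L2 (glue (schr b \<beta> k lam R R2) (schr b \<beta> k lam L L2))"
    unfolding L0_op_def
  proof (rule abs_diff_expr_eq[OF _ rep_L2_sq u])
    show "glue (schr b \<beta> k lam R R2) (schr b \<beta> k lam L L2) square_integrable_on UNIV"
      using J schr_square_integrable by (auto simp: jump_rep_def intro!: glue_square_integrable)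
  qed (use w(4,5) in \<open>simp_all add: set_borel_measurable_def\<close>)
qed

text \<open>A jump condition with coupling 0 says that the derivative is continuous at 0, so the
  pieces glue to an H^2 function on the line. Every statement on the operator without point
  interaction thereby becomes the case \<alpha> = 0.\<close>

lemma L0_dom_eq: "L0_dom = L_dom 0 k"
proof (intro equalityI subsetI)
  fix u assume "u \<in> L0_dom"
  then obtain R R1 R2 L L1 L2 where "jump_rep 0 R R1 R2 L L1 L2" "AE y in lborel. rep_L2 u y = glue R L y"
    by (rule L0_dom_imp_jump_rep)
  then show "u \<in> L_dom 0 k"
    by (intro jump_rep_imp_L_dom) auto
next
  fix u assume "u \<in> L_dom 0 k"
  then obtain R R1 R2 L L1 L2 where "jump_rep ((real k)\<^sup>2 * 0) R R1 R2 L L1 L2" "AE y in lborel. rep_L2 u y = glue R L y"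
    by (rule L_dom_imp_jump_rep)
  then show "u \<in> L0_dom"
    by (intro jump_rep_imp_L0_dom(1)) auto
qed

lemma L0_op_eq:
  assumes "u \<in> L0_dom"
  shows "L0_op b \<beta> k lam u = L_op b \<beta> k lam u"
proof -
  obtain R R1 R2 L L1 L2 where J: "jump_rep 0 R R1 R2 L L1 L2" "AE y in lborel. rep_L2 u y = glue R L y"
    using assms by (rule L0_dom_imp_jump_rep)
  show ?thesis
    using jump_rep_imp_L0_dom(2)[OF J] L_op_eq[OF J] by simp
qed

lemma resolvent_set_L0:
  "resolvent_set L0_dom (L0_op b \<beta> k lam) = resolvent_set (L_dom 0 k) (L_op b \<beta> k lam)"
proof -
  have "bij_betw (\<lambda>u. L0_op b \<beta> k lam u - z *\<^sub>C u) L0_dom UNIV =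
      bij_betw (\<lambda>u. L_op b \<beta> k lam u - z *\<^sub>C u) L0_dom UNIV" for z
    by (rule bij_betw_cong) (simp add: L0_op_eq)
  moreover have "(\<exists>C. \<forall>u\<in>L0_dom. norm u \<le> C * norm (L0_op b \<beta> k lam u - z *\<^sub>C u)) =
      (\<exists>C. \<forall>u\<in>L0_dom. norm u \<le> C * norm (L_op b \<beta> k lam u - z *\<^sub>C u))" for z
    by (intro ex_cong1 ball_cong refl) (simp add: L0_op_eq)
  ultimately show ?thesis
    unfolding resolvent_set_def by (simp add: L0_dom_eq[of k, symmetric])
qed

text \<open>Turns the equation holding almost everywhere into one between primitives, the form
  required by Wronskian arguments. Measurability of \<open>\<phi>\<close> is listed separately
  because almost everywhere equality to \<open>R\<close> does not provide it.\<close>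

lemma half_line_solution_iff:
  "half_line_solution b \<beta> k lam \<phi> \<longleftrightarrow> set_borel_measurable lborel {0<..} \<phi> \<and>
    (\<exists>R R1. H2_rep {0..} R R1 (\<lambda>y. of_real (pot b \<beta> k lam y) * R y) \<and>
      (AE y\<in>{0<..} in lborel. \<phi> y = R y) \<and> R 0 = 1)"
proof
  assume h: "half_line_solution b \<beta> k lam \<phi>"
  then have s: "sobolev_H 2 {0<..} \<phi>" by (simp add: half_line_solution_def)
  then have m: "set_borel_measurable lborel {0<..} \<phi>"
    by (simp add: numeral_2_eq_2 square_integrable_on_def)
  obtain R R1 R2 where R: "H2_rep {0..} R R1 R2" "AE t\<in>{0<..} in lborel. \<phi> t = R t"
    by (rule sobolev_H2_imp_H2_rep[OF _ _ _ _ _ s, of "{0..}" 0]) auto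
  have "{0<..} \<subseteq> {0 :: real..}" by auto
  note w = H2_rep_imp_weak_derivatives[OF _ _ this R m]
  have "AE t\<in>{0<..} in lborel. diff_expr b \<beta> k lam {0<..} \<phi> t = 0"
    using h by (simp add: half_line_solution_def)
  moreover have "AE t\<in>{0<..} in lborel. weak_deriv {0<..} (weak_deriv {0<..} \<phi>) t = R2 t"
    by (rule w(4)) auto
  ultimately have "AE t\<in>{0..} in lborel. R2 t = of_real (pot b \<beta> k lam t) * R t"
    using R(2) AE_lborel_singleton[of 0]
  proof eventually_elim
    case (elim t)
    then show ?case by (auto simp: diff_expr_def pot_def)
  qed
  then have "H2_rep {0..} R R1 (\<lambda>y. of_real (pot b \<beta> k lam y) * R y)"
  proof (rule H2_rep_cong_AE[OF R(1), rotated])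
    have "R square_integrable_on {0..}" using R(1) by (simp add: H2_rep_def)
    then have "(\<lambda>y. of_real (pot b \<beta> k lam y) * R y) square_integrable_on {0..}"
      by (rule square_integrable_on_pot)
    then show "set_borel_measurable lborel {0..} (\<lambda>y. of_real (pot b \<beta> k lam y) * R y)"
      by (simp add: square_integrable_on_def)
  qed simp
  moreover have "trace_at {0<..} \<phi> 0 = R 0"
    by (rule trace_at_eq) (use R H2_rep_continuous_on[OF R(1)] in auto)
  ultimately show "set_borel_measurable lborel {0<..} \<phi> \<and>
    (\<exists>R R1. H2_rep {0..} R R1 (\<lambda>y. of_real (pot b \<beta> k lam y) * R y) \<and>
      (AE y\<in>{0<..} in lborel. \<phi> y = R y) \<and> R 0 = 1)"
    using m R(2) h by (auto simp: half_line_solution_def)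
next
  assume "set_borel_measurable lborel {0<..} \<phi> \<and>
    (\<exists>R R1. H2_rep {0..} R R1 (\<lambda>y. of_real (pot b \<beta> k lam y) * R y) \<and>
      (AE y\<in>{0<..} in lborel. \<phi> y = R y) \<and> R 0 = 1)"
  then obtain R R1 where m: "set_borel_measurable lborel {0<..} \<phi>"
    and R: "H2_rep {0..} R R1 (\<lambda>y. of_real (pot b \<beta> k lam y) * R y)"
      "AE y\<in>{0<..} in lborel. \<phi> y = R y" "R 0 = 1"
    by blast
  have "{0<..} \<subseteq> {0 :: real..}" by auto
  note w = H2_rep_imp_weak_derivatives[OF open_greaterThan _ this R(1,2) m]
  have "trace_at {0<..} \<phi> 0 = R 0"
    by (rule trace_at_eq) (use R H2_rep_continuous_on[OF R(1)] in auto)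
  moreover have "AE t\<in>{0<..} in lborel. diff_expr b \<beta> k lam {0<..} \<phi> t = 0"
  proof -
    have "AE t\<in>{0<..} in lborel. weak_deriv {0<..} (weak_deriv {0<..} \<phi>) t = of_real (pot b \<beta> k lam t) * R t"
      by (rule w(4)) auto
    then show ?thesis
      using R(2)
    proof eventually_elim
      case (elim t)
      then show ?case by (auto simp: diff_expr_def pot_def)
    qed
  qed
  ultimately show "half_line_solution b \<beta> k lam \<phi>"
    using w(1) R(3) by (simp add: half_line_solution_def)
qed

section \<open>The Dirichlet problem on the half-line\<close>

lemma nn_integral_exp_abs_le:
  assumes "a > 0"
  shows "(\<integral>\<^sup>+t. ennreal (exp (- a * \<bar>y - t\<bar>)) \<partial>lborel) \<le> ennreal (2 / a)"
proof -
  have half: "(\<integral>\<^sup>+t. ennreal (exp (- a * t)) * indicator {0..} t \<partial>lborel) = ennreal (1 / a)"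
  proof -
    have "((\<lambda>t. - exp (- a * t) / a) \<longlongrightarrow> 0) at_top"
      using assms by real_asymp
    then have "(\<integral>\<^sup>+t. ennreal (exp (- a * t)) * indicator {0..} t \<partial>lborel) = ennreal (0 - (- exp (- a * 0) / a))"
      using assms by (intro nn_integral_FTC_atLeast) (auto intro!: derivative_eq_intros)
    then show ?thesis by simp
  qed
  have m: "(\<lambda>t. ennreal (exp (- a * t)) * indicator {0..} t) \<in> borel_measurable borel"
    by measurable
  have "(\<integral>\<^sup>+t. ennreal (exp (- a * \<bar>y - t\<bar>)) \<partial>lborel)
    \<le> (\<integral>\<^sup>+t. ennreal (exp (- a * (- y + 1 * t))) * indicator {0..} (- y + 1 * t)
        + ennreal (exp (- a * (y + (-1) * t))) * indicator {0..} (y + (-1) * t) \<partial>lborel)"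
    by (rule nn_integral_mono) (auto simp: indicator_def abs_if)
  also have "\<dots> = (\<integral>\<^sup>+t. ennreal (exp (- a * (- y + 1 * t))) * indicator {0..} (- y + 1 * t) \<partial>lborel)
      + (\<integral>\<^sup>+t. ennreal (exp (- a * (y + (-1) * t))) * indicator {0..} (y + (-1) * t) \<partial>lborel)"
    by (rule nn_integral_add) measurable
  also have "\<dots> = ennreal (1 / a) + ennreal (1 / a)"
    using nn_integral_real_affine[OF m, of 1 "- y"] nn_integral_real_affine[OF m, of "-1" y] half by simp
  also have "\<dots> = ennreal (2 / a)"
    using assms by (simp flip: ennreal_plus)
  finally show ?thesis .
qed

text \<open>Young's inequality for the kernel \<open>exp (- a |y - t|)\<close>: Cauchy-Schwarz with respect to the
  weight, followed by Tonelli.\<close>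

lemma exp_convolution:
  fixes g :: "real \<Rightarrow> real"
  assumes a: "a > 0" and g: "g \<in> borel_measurable borel" "integrable lborel (\<lambda>t. (g t)\<^sup>2)" "\<And>t. g t \<ge> 0"
  shows "integrable lborel (\<lambda>t. exp (- a * \<bar>y - t\<bar>) * g t)"
    and "integrable lborel (\<lambda>y. (LINT t|lborel. exp (- a * \<bar>y - t\<bar>) * g t)\<^sup>2)"
    and "(LINT y|lborel. (LINT t|lborel. exp (- a * \<bar>y - t\<bar>) * g t)\<^sup>2) \<le> (2 / a)\<^sup>2 * (LINT t|lborel. (g t)\<^sup>2)"
proof -
  note [measurable] = g(1)
  define e where "e y t = exp (- a * \<bar>y - t\<bar>)" for y t :: real
  define H where "H y = (\<integral>\<^sup>+t. ennreal (e y t * g t) \<partial>lborel)" for y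
  have em: "(\<lambda>(y, t). ennreal (e y t * (g t)\<^sup>2)) \<in> borel_measurable (lborel \<Otimes>\<^sub>M lborel)"
    "(\<lambda>(y, t). ennreal (e y t * g t)) \<in> borel_measurable (lborel \<Otimes>\<^sub>M lborel)"
    unfolding e_def by measurable
  have em1 [measurable]: "(\<lambda>t. e y t) \<in> borel_measurable borel" for y
    unfolding e_def by measurable
  have Hm: "H \<in> borel_measurable lborel"
    unfolding H_def using em(2) by (rule lborel.borel_measurable_nn_integral)
  have eint: "(\<integral>\<^sup>+t. ennreal (e y t) \<partial>lborel) \<le> ennreal (2 / a)" for y
    unfolding e_def by (rule nn_integral_exp_abs_le[OF a])
  have G: "(\<integral>\<^sup>+t. ennreal ((g t)\<^sup>2) \<partial>lborel) = ennreal (LINT t|lborel. (g t)\<^sup>2)"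
    by (rule nn_integral_eq_integral[OF g(2)]) simp
  have CS: "(H y)\<^sup>2 \<le> ennreal (2 / a) * (\<integral>\<^sup>+t. ennreal (e y t * (g t)\<^sup>2) \<partial>lborel)" for y
  proof -
    have e0: "e y t \<ge> 0" for t by (simp add: e_def)
    have eq: "ennreal (e y t * g t) = ennreal (sqrt (e y t)) * ennreal (sqrt (e y t) * g t)" for t
      using g(3)[of t] e0[of t] by (simp add: ennreal_mult'[symmetric] mult.assoc[symmetric])
    have "(H y)\<^sup>2 \<le> (\<integral>\<^sup>+t. (ennreal (sqrt (e y t)))\<^sup>2 \<partial>lborel) * (\<integral>\<^sup>+t. (ennreal (sqrt (e y t) * g t))\<^sup>2 \<partial>lborel)"
      unfolding H_def eq by (rule Cauchy_Schwarz_nn_integral) measurable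
    also have "(\<integral>\<^sup>+t. (ennreal (sqrt (e y t)))\<^sup>2 \<partial>lborel) = (\<integral>\<^sup>+t. ennreal (e y t) \<partial>lborel)"
      using e0 by (simp add: ennreal_power)
    also have "(\<integral>\<^sup>+t. (ennreal (sqrt (e y t) * g t))\<^sup>2 \<partial>lborel) = (\<integral>\<^sup>+t. ennreal (e y t * (g t)\<^sup>2) \<partial>lborel)"
      using e0 g(3) by (simp add: ennreal_power power_mult_distrib)
    finally show ?thesis
      by (rule order_trans) (intro mult_right_mono eint, simp)
  qed
  \<comment> \<open>Finiteness at every single y comes first, since only then does the Bochner
    integral \<open>h\<close> agree with \<open>H\<close>.\<close>
  have Hfin: "H y < \<infinity>" for y
  proof -
    have "(\<integral>\<^sup>+t. ennreal (e y t * (g t)\<^sup>2) \<partial>lborel) \<le> (\<integral>\<^sup>+t. ennreal ((g t)\<^sup>2) \<partial>lborel)"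
    proof (rule nn_integral_mono, rule ennreal_leI)
      fix t have "e y t \<le> 1" using a by (simp add: e_def)
      then show "e y t * (g t)\<^sup>2 \<le> (g t)\<^sup>2"
        using mult_right_mono[of "e y t" 1 "(g t)\<^sup>2"] by simp
    qed
    then have "(\<integral>\<^sup>+t. ennreal (e y t * (g t)\<^sup>2) \<partial>lborel) < \<infinity>"
      unfolding G using order_le_less_trans ennreal_less_top by (metis infinity_ennreal_def)
    then have "ennreal (2 / a) * (\<integral>\<^sup>+t. ennreal (e y t * (g t)\<^sup>2) \<partial>lborel) < \<infinity>"
      by (simp add: ennreal_mult_less_top)
    with CS[of y] have "(H y)\<^sup>2 < \<infinity>"
      by (rule order_le_less_trans)
    then show ?thesis
      by (simp add: power2_eq_square ennreal_mult_less_top) (metis ennreal_mult_less_top less_top top_neq_ennreal zero_less_one not_gr_zero ennreal_zero_less_top)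
  qed
  have int: "integrable lborel (\<lambda>t. e y t * g t)" for y
    using Hfin[of y] g(3) by (intro integrableI_nonneg) (auto simp: H_def e_def)
  then show "integrable lborel (\<lambda>t. exp (- a * \<bar>y - t\<bar>) * g t)"
    by (simp add: e_def)
  define h where "h y = (LINT t|lborel. e y t * g t)" for y
  have Hh: "H y = ennreal (h y)" for y
    unfolding H_def h_def using g(3) by (intro nn_integral_eq_integral int) (auto simp: e_def)
  have h0: "h y \<ge> 0" for y
    unfolding h_def using g(3) by (intro Bochner_Integration.integral_nonneg) (auto simp: e_def)
  have "h = (\<lambda>y. enn2real (H y))"
    using h0 by (simp add: Hh fun_eq_iff)
  then have hm [measurable]: "h \<in> borel_measurable borel"
    using Hm by simp
  have "(\<integral>\<^sup>+y. ennreal ((h y)\<^sup>2) \<partial>lborel) = (\<integral>\<^sup>+y. (H y)\<^sup>2 \<partial>lborel)"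
    using h0 by (simp add: Hh ennreal_power)
  also have "\<dots> \<le> (\<integral>\<^sup>+y. ennreal (2 / a) * (\<integral>\<^sup>+t. ennreal (e y t * (g t)\<^sup>2) \<partial>lborel) \<partial>lborel)"
    by (rule nn_integral_mono) (rule CS)
  also have "\<dots> = ennreal (2 / a) * (\<integral>\<^sup>+y. (\<integral>\<^sup>+t. ennreal (e y t * (g t)\<^sup>2) \<partial>lborel) \<partial>lborel)"
    by (rule nn_integral_cmult) (use lborel.borel_measurable_nn_integral[OF em(1)] in simp)
  also have "(\<integral>\<^sup>+y. (\<integral>\<^sup>+t. ennreal (e y t * (g t)\<^sup>2) \<partial>lborel) \<partial>lborel)
      = (\<integral>\<^sup>+t. (\<integral>\<^sup>+y. ennreal (e y t * (g t)\<^sup>2) \<partial>lborel) \<partial>lborel)"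
    using lborel_pair.Fubini'[OF em(1)] by simp
  also have "\<dots> \<le> (\<integral>\<^sup>+t. ennreal (2 / a) * ennreal ((g t)\<^sup>2) \<partial>lborel)"
  proof (rule nn_integral_mono)
    fix t
    have sym: "e y t = e t y" for y by (simp add: e_def abs_minus_commute)
    have "(\<integral>\<^sup>+y. ennreal (e y t * (g t)\<^sup>2) \<partial>lborel) = (\<integral>\<^sup>+y. ennreal (e t y) * ennreal ((g t)\<^sup>2) \<partial>lborel)"
      by (simp add: sym ennreal_mult'' )
    also have "\<dots> = (\<integral>\<^sup>+y. ennreal (e t y) \<partial>lborel) * ennreal ((g t)\<^sup>2)"
      by (rule nn_integral_multc) simp
    also have "\<dots> \<le> ennreal (2 / a) * ennreal ((g t)\<^sup>2)"
      by (intro mult_right_mono eint) simp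
    finally show "(\<integral>\<^sup>+y. ennreal (e y t * (g t)\<^sup>2) \<partial>lborel) \<le> ennreal (2 / a) * ennreal ((g t)\<^sup>2)" .
  qed
  also have "\<dots> = ennreal (2 / a) * ennreal (LINT t|lborel. (g t)\<^sup>2)"
    by (subst nn_integral_cmult) (simp_all add: G)
  also have "ennreal (2 / a) * (ennreal (2 / a) * ennreal (LINT t|lborel. (g t)\<^sup>2))
      = ennreal ((2 / a)\<^sup>2 * (LINT t|lborel. (g t)\<^sup>2))"
    using a by (simp add: ennreal_mult'[symmetric] power2_eq_square mult.assoc)
  finally have le: "(\<integral>\<^sup>+y. ennreal ((h y)\<^sup>2) \<partial>lborel) \<le> ennreal ((2 / a)\<^sup>2 * (LINT t|lborel. (g t)\<^sup>2))"
    by (simp add: mult_left_mono)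
  have hint: "integrable lborel (\<lambda>y. (h y)\<^sup>2)"
    using le by (intro integrableI_nonneg) (auto simp: order_le_less_trans[OF _ ennreal_less_top])
  then show "integrable lborel (\<lambda>y. (LINT t|lborel. exp (- a * \<bar>y - t\<bar>) * g t)\<^sup>2)"
    by (simp add: h_def e_def)
  have "ennreal (LINT y|lborel. (h y)\<^sup>2) \<le> ennreal ((2 / a)\<^sup>2 * (LINT t|lborel. (g t)\<^sup>2))"
    using le nn_integral_eq_integral[OF hint] by simp
  then show "(LINT y|lborel. (LINT t|lborel. exp (- a * \<bar>y - t\<bar>) * g t)\<^sup>2) \<le> (2 / a)\<^sup>2 * (LINT t|lborel. (g t)\<^sup>2)"
    by (simp add: h_def e_def)
qed

lemma primitive_on_zero_const:
  assumes "primitive_on S F (\<lambda>_. 0)" "is_interval S" "x \<in> S" "y \<in> S"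
  shows "F x = F y"
proof -
  have *: "F u = F v" if "u \<le> v" "u \<in> S" "v \<in> S" for u v
  proof -
    have "{u..v} \<subseteq> S"
      using mem_is_interval_1_I[OF assms(2) that(2,3)] by auto
    then show ?thesis
      using primitive_onD(2)[OF assms(1) that(1)] by (simp add: set_lebesgue_integral_def)
  qed
  show ?thesis
  proof (cases "x \<le> y")
    case True
    then show ?thesis by (rule *[OF _ assms(3,4)])
  next
    case False
    then show ?thesis by (intro *[OF _ assms(4,3), symmetric]) simp
  qed
qed

text \<open>By the product rule the density of F G1 - F1 G is F p G - p F G = 0. No conjugation
  occurs, so a complex \<open>p\<close> is allowed.\<close>

lemma primitive_on_wronskian:
  assumes F: "primitive_on S F F1" "primitive_on S F1 (\<lambda>y. p y * F y)"
    and G: "primitive_on S G G1" "primitive_on S G1 (\<lambda>y. p y * G y)"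
    and S: "is_interval S" "x \<in> S" "y \<in> S"
  shows "F x * G1 x - F1 x * G x = F y * G1 y - F1 y * G y"
proof (rule primitive_on_zero_const[of S])
  show "primitive_on S (\<lambda>y. F y * G1 y - F1 y * G y) (\<lambda>_. 0)"
    using primitive_on_diff[OF primitive_on_mult[OF F(1) G(2)] primitive_on_mult[OF F(2) G(1)]]
    by (simp add: algebra_simps)
qed (use S in auto)

section \<open>Pairings of square-integrable functions\<close>

lemma square_integrable_on_mult_integrable:
  assumes "f square_integrable_on S" "g square_integrable_on S"
  shows "set_integrable lborel S (\<lambda>t. f t * g t)"
proof -
  define f' g' where "f' t = indicator S t *\<^sub>R f t" and "g' t = indicator S t *\<^sub>R g t" for t
  have sq: "f' square_integrable_on UNIV" "g' square_integrable_on UNIV"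
    using assms square_integrable_on_iff unfolding f'_def g'_def by blast+
  have "integrable lborel (\<lambda>t. f' t * g' t)"
  proof (rule Bochner_Integration.integrable_bound[OF square_integrable_mult[OF sq]])
    show "(\<lambda>t. f' t * g' t) \<in> borel_measurable lborel"
      using sq[THEN sq_UNIV_measurable] by measurable
  qed (simp add: norm_mult)
  moreover have "(\<lambda>t. f' t * g' t) = (\<lambda>t. indicator S t *\<^sub>R (f t * g t))"
    by (auto simp: f'_def g'_def indicator_def)
  ultimately show ?thesis
    by (simp add: set_integrable_def)
qed

lemma integral_Cauchy_Schwarz:
  assumes "f square_integrable_on S" "g square_integrable_on S"
  shows "(norm (LINT t:S|lborel. f t * g t))\<^sup>2
    \<le> (LINT t:S|lborel. (norm (f t))\<^sup>2) * (LINT t:S|lborel. (norm (g t))\<^sup>2)"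
proof -
  define f' g' where "f' t = indicator S t *\<^sub>R f t" and "g' t = indicator S t *\<^sub>R g t" for t
  have sq: "f' square_integrable_on UNIV" "g' square_integrable_on UNIV"
    using assms square_integrable_on_iff unfolding f'_def g'_def by blast+
  note m = sq[THEN sq_UNIV_measurable]
  have i: "integrable lborel (\<lambda>t. (norm (f' t))\<^sup>2)" "integrable lborel (\<lambda>t. (norm (g' t))\<^sup>2)"
    using sq by (simp_all add: square_integrable_on_UNIV_iff)
  note im = square_integrable_mult[OF sq]
  define I where "I = (LINT t|lborel. norm (f' t) * norm (g' t))"
  have I0: "I \<ge> 0"
    unfolding I_def by (intro Bochner_Integration.integral_nonneg) simp
  have "norm (LINT t:S|lborel. f t * g t) = norm (LINT t|lborel. f' t * g' t)"
    unfolding set_lebesgue_integral_def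
    by (intro arg_cong[where f = norm] Bochner_Integration.integral_cong) (auto simp: f'_def g'_def indicator_def)
  also have "\<dots> \<le> I"
    unfolding I_def norm_mult[symmetric] by (rule integral_norm_bound)
  finally have le: "(norm (LINT t:S|lborel. f t * g t))\<^sup>2 \<le> I\<^sup>2"
    by (rule power_mono) simp
  have "(\<integral>\<^sup>+t. ennreal (norm (f' t)) * ennreal (norm (g' t)) \<partial>lborel)\<^sup>2
      \<le> (\<integral>\<^sup>+t. (ennreal (norm (f' t)))\<^sup>2 \<partial>lborel) * (\<integral>\<^sup>+t. (ennreal (norm (g' t)))\<^sup>2 \<partial>lborel)"
    by (rule Cauchy_Schwarz_nn_integral) (use m in measurable)
  moreover have "(\<integral>\<^sup>+t. ennreal (norm (f' t)) * ennreal (norm (g' t)) \<partial>lborel) = ennreal I"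
    unfolding I_def ennreal_mult''[OF norm_ge_zero, symmetric] by (rule nn_integral_eq_integral[OF im]) simp
  moreover have "(\<integral>\<^sup>+t. (ennreal (norm (h t)))\<^sup>2 \<partial>lborel) = ennreal (LINT t|lborel. (norm (h t))\<^sup>2)"
    if "integrable lborel (\<lambda>t. (norm (h t))\<^sup>2)" for h :: "real \<Rightarrow> complex"
    using nn_integral_eq_integral[OF that] by (simp add: ennreal_power)
  ultimately have "(ennreal I)\<^sup>2 \<le> ennreal (LINT t|lborel. (norm (f' t))\<^sup>2) * ennreal (LINT t|lborel. (norm (g' t))\<^sup>2)"
    using i by simp
  then have "ennreal (I\<^sup>2) \<le> ennreal ((LINT t|lborel. (norm (f' t))\<^sup>2) * (LINT t|lborel. (norm (g' t))\<^sup>2))"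
    using I0 by (simp add: ennreal_power ennreal_mult'')
  then have "I\<^sup>2 \<le> (LINT t|lborel. (norm (f' t))\<^sup>2) * (LINT t|lborel. (norm (g' t))\<^sup>2)"
    by (simp add: Bochner_Integration.integral_nonneg)
  moreover have "(norm (indicator S t *\<^sub>R h t))\<^sup>2 = indicator S t *\<^sub>R (norm (h t))\<^sup>2" for t and h :: "real \<Rightarrow> complex"
    by (simp add: indicator_def)
  ultimately show ?thesis
    using le by (simp add: set_lebesgue_integral_def f'_def g'_def)
qed

text \<open>\<open>\<phi>\<close> is the decaying solution normalised at 0 and \<open>\<psi>\<close>
  the solution with Dirichlet data; the initial values make their Wronskian 1. Decay and growth at
  one common rate \<open>a\<close> bound the Green kernel, \<open>\<phi>\<close> at the larger times
  \<open>\<psi>\<close> at the smaller argument, by M^2 exp (- a |y - t|).\<close>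

locale half_line =
  fixes p \<phi> \<phi>1 \<psi> \<psi>1 :: "real \<Rightarrow> complex" and a M B :: real
  assumes a_pos: "a > 0"
    and \<phi>_primitive: "primitive_on {0..} \<phi> \<phi>1" "primitive_on {0..} \<phi>1 (\<lambda>y. p y * \<phi> y)"
    and \<psi>_primitive: "primitive_on {0..} \<psi> \<psi>1" "primitive_on {0..} \<psi>1 (\<lambda>y. p y * \<psi> y)"
    and initial: "\<phi> 0 = 1" "\<psi> 0 = 0" "\<psi>1 0 = 1"
    and \<phi>_bound: "\<And>y. y \<ge> 0 \<Longrightarrow> norm (\<phi> y) \<le> M * exp (- a * y)" "\<And>y. y \<ge> 0 \<Longrightarrow> norm (\<phi>1 y) \<le> M * exp (- a * y)"
    and \<psi>_bound: "\<And>y. y \<ge> 0 \<Longrightarrow> norm (\<psi> y) \<le> M * exp (a * y)" "\<And>y. y \<ge> 0 \<Longrightarrow> norm (\<psi>1 y) \<le> M * exp (a * y)"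
    and p_bound: "p \<in> borel_measurable borel" "\<And>y. norm (p y) \<le> B"
begin

lemma wronskian: "y \<ge> 0 \<Longrightarrow> \<phi> y * \<psi>1 y - \<phi>1 y * \<psi> y = 1"
  using primitive_on_wronskian[OF \<phi>_primitive \<psi>_primitive, of y 0] initial
  by simp

lemma exp_decay_square_integrable:
  assumes "continuous_on {0..} h" "\<And>y. y \<ge> 0 \<Longrightarrow> norm (h y) \<le> M * exp (- a * y)"
  shows "h square_integrable_on {0..}"
  unfolding square_integrable_on_def
proof
  show m: "set_borel_measurable lborel {0..} h"
    using assms(1) by (rule continuous_on_set_borel_measurable) simp
  have "integrable lborel (\<lambda>y. indicator {0..} y * exp (- (2 * a) * y))"
  proof (rule integrableI_nonneg)
    have "((\<lambda>t. - exp (- (2 * a) * t) / (2 * a)) \<longlongrightarrow> 0) at_top"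
      using a_pos by real_asymp
    then have "(\<integral>\<^sup>+t. ennreal (exp (- (2 * a) * t)) * indicator {0..} t \<partial>lborel) = ennreal (0 - (- exp (- (2 * a) * 0) / (2 * a)))"
      using a_pos by (intro nn_integral_FTC_atLeast) (auto intro!: derivative_eq_intros)
    then show "(\<integral>\<^sup>+y. ennreal (indicator {0..} y * exp (- (2 * a) * y)) \<partial>lborel) < \<infinity>"
      by (simp add: ennreal_mult' ennreal_indicator mult.commute)
  qed auto
  then have "integrable lborel (\<lambda>y. M\<^sup>2 * (indicator {0..} y * exp (- (2 * a) * y)))"
    by simp
  then have "integrable lborel (\<lambda>y. (norm (indicator {0..} y *\<^sub>R h y))\<^sup>2)"
  proof (rule Bochner_Integration.integrable_bound)
    show "(\<lambda>y. (norm (indicator {0..} y *\<^sub>R h y))\<^sup>2) \<in> borel_measurable lborel"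
      using m unfolding set_borel_measurable_def by measurable
    have "(norm (indicator {0..} y *\<^sub>R h y))\<^sup>2 \<le> M\<^sup>2 * (indicator {0..} y * exp (- (2 * a) * y))" for y
    proof (cases "y \<ge> 0")
      case True
      have "(norm (h y))\<^sup>2 \<le> (M * exp (- a * y))\<^sup>2"
        using assms(2)[OF True] by (rule power_mono) simp
      also have "\<dots> = M\<^sup>2 * exp (- (2 * a) * y)"
        by (simp add: power_mult_distrib exp_double[symmetric])
      finally show ?thesis using True by simp
    qed simp
    then show "AE y in lborel. norm ((norm (indicator {0..} y *\<^sub>R h y))\<^sup>2)
        \<le> norm (M\<^sup>2 * (indicator {0..} y * exp (- (2 * a) * y)))"
      by simp
  qed
  moreover have "(norm (indicator {0..} y *\<^sub>R h y))\<^sup>2 = indicator {0..} y *\<^sub>R (norm (h y))\<^sup>2" for y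
    by (simp add: indicator_def)
  ultimately show "set_integrable lborel {0..} (\<lambda>y. (norm (h y))\<^sup>2)"
    by (simp add: set_integrable_def)
qed

lemma \<phi>_square_integrable: "\<phi> square_integrable_on {0..}" "\<phi>1 square_integrable_on {0..}"
  by (rule exp_decay_square_integrable; use \<phi>_primitive \<phi>_bound in \<open>auto intro: primitive_on_continuous_on\<close>)+

lemma H2_rep_\<phi>: "H2_rep {0..} \<phi> \<phi>1 (\<lambda>y. p y * \<phi> y)"
  unfolding H2_rep_def using \<phi>_primitive \<phi>_square_integrable
  by (simp add: square_integrable_on_bounded_mult[OF \<phi>_square_integrable(1) p_bound])

text \<open>The Wronskian of \<open>R\<close> and \<open>\<phi>\<close> is constant and, as a
  combination of products of square-integrable functions, integrable on the half-line, hence 0. So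
  the square-integrable solutions form a line.\<close>

lemma H2_rep_homogeneous:
  assumes R: "H2_rep {0..} R R1 (\<lambda>y. p y * R y)" and y: "y \<ge> 0"
  shows "R y = R 0 * \<phi> y" "R1 y = R 0 * \<phi>1 y"
proof -
  have P: "primitive_on {0..} R R1" "primitive_on {0..} R1 (\<lambda>y. p y * R y)"
    and sq: "R square_integrable_on {0..}" "R1 square_integrable_on {0..}"
    using R by (auto simp: H2_rep_def)
  define c where "c = R 0 * \<phi>1 0 - R1 0 * \<phi> 0"
  have c: "R y * \<phi>1 y - R1 y * \<phi> y = c" if "y \<ge> 0" for y
    unfolding c_def using primitive_on_wronskian[OF P \<phi>_primitive, of y 0] that by simp
  have i: "set_integrable lborel {0..} (\<lambda>y. R y * \<phi>1 y - R1 y * \<phi> y)"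
    by (intro set_integral_diff(1) square_integrable_on_mult_integrable sq \<phi>_square_integrable)
  moreover have "set_integrable lborel {0..} (\<lambda>y. R y * \<phi>1 y - R1 y * \<phi> y) = set_integrable lborel {0..} (\<lambda>y :: real. c)"
    unfolding set_integrable_def
    by (rule arg_cong[where f = "integrable lborel"]) (use c in \<open>auto simp: fun_eq_iff indicator_def\<close>)
  ultimately have "set_integrable lborel {0..} (\<lambda>y :: real. c)"
    by simp
  then have ic: "integrable lborel (\<lambda>y :: real. indicator {0..} y * norm c)"
    using integrable_norm[of lborel "\<lambda>y :: real. indicator {0..} y *\<^sub>R c"] by (simp add: set_integrable_def)
  define K where "K = (LINT y :: real|lborel. indicator {0..} y * norm c)"
  \<comment> \<open>Integrating the constant over [0, n] for every n keeps the products bounded,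
    which is possible only for c = 0.\<close>
  have "real n * norm c \<le> K" for n
  proof -
    have "(LINT y|lborel. indicator {0..real n} y * norm c) \<le> K"
      unfolding K_def
    proof (rule Bochner_Integration.integral_mono[OF _ ic])
      show "integrable lborel (\<lambda>y. indicator {0..real n} y * norm c)"
        by simp
      show "indicator {0..real n} y * norm c \<le> indicator {0..} y * norm c" for y
        by (intro mult_right_mono) (auto simp: indicator_def)
    qed
    then show ?thesis by simp
  qed
  then have "norm c \<le> 0"
    using reals_Archimedean3[of "norm c"] by (metis linorder_not_le)
  then have c0: "c = 0" by simp
  have d: "R y * \<psi>1 y - R1 y * \<psi> y = R 0"
    using primitive_on_wronskian[OF P \<psi>_primitive, of y 0] y initial by simp
  \<comment> \<open>Expansion of \<open>R\<close> in the basis \<open>\<phi>\<close>,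
    \<open>\<psi>\<close>, whose coefficients are Wronskians.\<close>
  have 1: "R y * (\<phi> y * \<psi>1 y - \<phi>1 y * \<psi> y) = \<phi> y * (R y * \<psi>1 y - R1 y * \<psi> y) - \<psi> y * (R y * \<phi>1 y - R1 y * \<phi> y)"
    by (simp add: algebra_simps)
  show "R y = R 0 * \<phi> y"
    using 1 unfolding wronskian[OF y] c[OF y] d c0 by simp
  have 2: "R1 y * (\<phi> y * \<psi>1 y - \<phi>1 y * \<psi> y) = \<phi>1 y * (R y * \<psi>1 y - R1 y * \<psi> y) - \<psi>1 y * (R y * \<phi>1 y - R1 y * \<phi> y)"
    by (simp add: algebra_simps)
  show "R1 y = R 0 * \<phi>1 y"
    using 2 unfolding wronskian[OF y] c[OF y] d c0 by simp
qed

text \<open>Variation of constants, with the integral of \<open>\<psi> f\<close> taken from 0 and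
  that of \<open>\<phi> f\<close> taken to infinity, so that R 0 = 0 and the solution stays square
  integrable. The derivative at 0 is recorded because the jump condition sees nothing else of
  \<open>R\<close>. The bound is Young's inequality for the kernel bound M^2 exp (- a |y -
  t|).\<close>

lemma solve_dirichlet:
  assumes f: "f square_integrable_on {0..}"
  obtains R R1 where "H2_rep {0..} R R1 (\<lambda>y. p y * R y - f y)" "R 0 = 0"
    "R1 0 = (LINT t:{0..}|lborel. \<phi> t * f t)"
    "(LINT t:{0..}|lborel. (norm (R t))\<^sup>2) \<le> (M\<^sup>2 * (2 / a))\<^sup>2 * (LINT t:{0..}|lborel. (norm (f t))\<^sup>2)"
proof -
  have M0: "M \<ge> 0"
    using \<phi>_bound(1)[of 0] by (simp add: initial)
  have cont: "continuous_on {0..} h" if "primitive_on {0..} h h'" for h h'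
    using primitive_on_continuous_on[OF that] by simp
  note c = cont[OF \<phi>_primitive(1)] cont[OF \<phi>_primitive(2)] cont[OF \<psi>_primitive(1)] cont[OF \<psi>_primitive(2)]
  define g where "g t = norm (indicator {0..} t *\<^sub>R f t)" for t
  have fm: "(\<lambda>t. indicator {0..} t *\<^sub>R f t) \<in> borel_measurable borel"
    using f by (simp add: square_integrable_on_def set_borel_measurable_def)
  then have gm: "g \<in> borel_measurable borel"
    unfolding g_def[abs_def] by measurable
  have g2: "(g t)\<^sup>2 = indicator {0..} t *\<^sub>R (norm (f t))\<^sup>2" for t
    by (simp add: g_def indicator_def)
  have gi: "integrable lborel (\<lambda>t. (g t)\<^sup>2)"
    using f by (simp add: g2 square_integrable_on_def set_integrable_def)
  have g0: "g t \<ge> 0" for t by (simp add: g_def)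
  note conv = exp_convolution[OF a_pos gm gi g0]
  define e where "e y t = exp (- a * \<bar>y - t\<bar>) * g t" for y t
  define h where "h y = (LINT t|lborel. e y t)" for y
  have ei: "integrable lborel (e y)" for y
    using conv(1)[of y] by (simp add: e_def[abs_def])
  have e0: "e y t \<ge> 0" for y t by (simp add: e_def g0)

  have fl: "f locally_integrable_on {0..}"
    by (rule square_integrable_imp_locally_integrable[OF f])
  have mul: "set_integrable lborel {x..y} (\<lambda>t. q t * f t)" if "continuous_on {0..} q" "0 \<le> x" for q x y
  proof -
    have sub: "{x..y} \<subseteq> {0..}" using that(2) by auto
    have "f square_integrable_on {x..y}"
      by (rule square_integrable_on_subset[OF f sub]) simp
    moreover have cq: "continuous_on {x..y} q"
      using continuous_on_subset[OF that(1) sub] .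
    have "q square_integrable_on {x..y}"
      unfolding square_integrable_on_def
      by (intro conjI continuous_on_set_borel_measurable borel_integrable_atLeastAtMost' continuous_intros cq) auto
    ultimately show ?thesis
      by (intro square_integrable_on_mult_integrable)
  qed
  obtain F where F: "primitive_on {0..} F (\<lambda>t. \<psi> t * f t)"
  proof (rule primitive_on_exists)
    show "(\<lambda>t. \<psi> t * f t) locally_integrable_on {0..}"
      unfolding locally_integrable_on_def
    proof (intro allI impI)
      fix K :: "real set" assume K: "compact K" "K \<subseteq> {0..}"
      obtain x y where xy: "K \<subseteq> {x..y}" "{x..y} \<subseteq> {0..}"
        by (rule compact_subset_Icc[OF K]) auto
      show "set_integrable lborel K (\<lambda>t. \<psi> t * f t)"
      proof (cases "x \<le> y")
        case True
        then have "0 \<le> x" using xy(2) by auto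
        then show ?thesis
          by (rule set_integrable_subset[OF mul[OF c(3)]]) (use K xy in \<open>auto intro: borel_compact\<close>)
      next
        case False
        then show ?thesis using xy by (simp add: set_integrable_def)
      qed
    qed
  qed auto
  define F' where "F' y = F y - F 0" for y
  have F': "primitive_on {0..} F' (\<lambda>t. \<psi> t * f t)" "F' 0 = 0"
    using F by (simp_all add: F'_def[abs_def] primitive_on_def)
  have F'_eq: "F' y = (LINT t:{0..y}|lborel. \<psi> t * f t)" if "y \<ge> 0" for y
    using primitive_onD(2)[OF F'(1) that] F'(2) by auto
  have \<phi>f: "set_integrable lborel {0..} (\<lambda>t. \<phi> t * f t)"
    by (intro square_integrable_on_mult_integrable \<phi>_square_integrable f)
  define J where "J = (LINT t:{0..}|lborel. \<phi> t * f t)"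
  define T where "T y = (if y \<ge> 0 then LINT t:{y<..}|lborel. \<phi> t * f t else J)" for y
  have \<phi>f_sub: "set_integrable lborel A (\<lambda>t. \<phi> t * f t)" if "A \<in> sets borel" "A \<subseteq> {0..}" for A
    by (rule set_integrable_subset[OF \<phi>f]) (use that in auto)
  have T_split: "J = (LINT t:{0..y}|lborel. \<phi> t * f t) + T y" if "y \<ge> 0" for y
  proof -
    have eq: "{0..} = {0..y} \<union> {y<..}" using that by auto
    have "(LINT t:{0..y} \<union> {y<..}|lborel. \<phi> t * f t) = (LINT t:{0..y}|lborel. \<phi> t * f t) + (LINT t:{y<..}|lborel. \<phi> t * f t)"
      using that by (intro set_integral_Un \<phi>f_sub) auto
    then show ?thesis
      using that unfolding J_def T_def eq by simp
  qed
  have T: "primitive_on {0..} T (\<lambda>t. - (\<phi> t * f t))"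
  proof (rule primitive_onI_from[of _ 0])
    fix y :: real assume y: "y \<in> {0..}" "0 \<le> y"
    have "J = T 0"
    proof -
      have "(LINT t:{0..0}|lborel. \<phi> t * f t) = 0"
        unfolding set_lebesgue_integral_def using AE_lborel_singleton[of "0 :: real"]
        by (intro integral_eq_zero_AE, elim eventually_mono) (simp add: indicator_def)
      then show ?thesis using T_split[of 0] by simp
    qed
    then have "(LINT t:{0..y}|lborel. \<phi> t * f t) = T 0 - T y"
      using T_split[OF y(2)] by (metis add_diff_cancel_right')
    then show "set_integrable lborel {0..y} (\<lambda>t. - (\<phi> t * f t)) \<and>
        (LINT t:{0..y}|lborel. - (\<phi> t * f t)) = T y - T 0"
      using \<phi>f_sub[of "{0..y}"] set_integral_uminus[OF \<phi>f_sub[of "{0..y}"]]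
      by (auto simp: set_integrable_def)
  next
    fix y :: real assume "y \<in> {0..}" "y \<le> 0"
    then have y: "y = 0" by auto
    have "(LINT t:{0..0}|lborel. - (\<phi> t * f t)) = 0"
      unfolding set_lebesgue_integral_def using AE_lborel_singleton[of "0 :: real"]
      by (intro integral_eq_zero_AE, elim eventually_mono) (simp add: indicator_def)
    then show "set_integrable lborel {y..0} (\<lambda>t. - (\<phi> t * f t)) \<and>
        (LINT t:{y..0}|lborel. - (\<phi> t * f t)) = T 0 - T y"
      using \<phi>f_sub[of "{0..0}"] by (auto simp: y set_integrable_def)
  qed auto
  \<comment> \<open>The coefficients are chosen so that in the first derivative the terms with
    \<open>f\<close> cancel; \<open>R1\<close> below therefore contains no \<open>f\<close>.\<close>
  define R where "R y = \<phi> y * F' y + \<psi> y * T y" for y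
  define R1 where "R1 y = \<phi>1 y * F' y + \<psi>1 y * T y" for y

  have "primitive_on {0..} R (\<lambda>y. (\<phi>1 y * F' y + \<phi> y * (\<psi> y * f y)) + (\<psi>1 y * T y + \<psi> y * (- (\<phi> y * f y))))"
    unfolding R_def by (intro primitive_on_add primitive_on_mult \<phi>_primitive \<psi>_primitive F' T)
  then have PR: "primitive_on {0..} R R1"
    by (simp add: R1_def[abs_def] algebra_simps)
  have "primitive_on {0..} R1 (\<lambda>y. (p y * \<phi> y * F' y + \<phi>1 y * (\<psi> y * f y)) + (p y * \<psi> y * T y + \<psi>1 y * (- (\<phi> y * f y))))"
    unfolding R1_def by (intro primitive_on_add primitive_on_mult \<phi>_primitive \<psi>_primitive F' T)
  moreover have "p y * \<phi> y * F' y + \<phi>1 y * (\<psi> y * f y) + (p y * \<psi> y * T y + \<psi>1 y * (- (\<phi> y * f y)))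
      = p y * R y - (\<phi> y * \<psi>1 y - \<phi>1 y * \<psi> y) * f y" for y
    by (simp add: R_def algebra_simps)
  \<comment> \<open>The terms with \<open>f\<close> collect the Wronskian as a factor. It equals 1
    only on the half-line, so it is removed later by a change of density there.\<close>
  ultimately have PR1: "primitive_on {0..} R1 (\<lambda>y. p y * R y - (\<phi> y * \<psi>1 y - \<phi>1 y * \<psi> y) * f y)"
    by simp
  have pRf: "(\<lambda>y. p y * R y - f y) square_integrable_on {0..}" if "R square_integrable_on {0..}"
    using square_integrable_on_add[OF square_integrable_on_bounded_mult[OF that p_bound] square_integrable_on_uminus_fun[OF f]]
    by simp
  have Rm: "set_borel_measurable lborel {0..} R" "set_borel_measurable lborel {0..} R1"
  proof -
    show "set_borel_measurable lborel {0..} R"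
      by (rule continuous_on_set_borel_measurable[OF cont[OF PR]]) simp
    show "set_borel_measurable lborel {0..} R1"
      unfolding R1_def
      by (intro continuous_on_set_borel_measurable continuous_intros c cont[OF F'(1)] cont[OF T]) simp
  qed
  have part: "norm (LINT t:A|lborel. q t) \<le> (LINT t|lborel. indicator A t * (M\<^sup>2 * e y t))"
    if A: "A \<in> sets borel" and q: "set_integrable lborel A q" "\<And>t. t \<in> A \<Longrightarrow> norm (q t) \<le> M\<^sup>2 * e y t"
    for A y and q :: "real \<Rightarrow> complex"
    unfolding set_lebesgue_integral_def
  proof (rule Bochner_Integration.integral_norm_bound_integral)
    show "integrable lborel (\<lambda>t. indicator A t *\<^sub>R q t)"
      using q(1) by (simp add: set_integrable_def)
    show "integrable lborel (\<lambda>t. indicator A t * (M\<^sup>2 * e y t))"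
      using integrable_mult_indicator[of A lborel "\<lambda>t. M\<^sup>2 * e y t"] ei[of y] A by simp
    show "norm (indicator A t *\<^sub>R q t) \<le> indicator A t * (M\<^sup>2 * e y t)" for t
      using q(2)[of t] by (cases "t \<in> A") auto
  qed
  \<comment> \<open>Stated for arbitrary coefficients \<open>u\<close> and \<open>v\<close> with the
    right growth, so that one estimate covers \<open>R\<close> and its derivative
    \<open>R1\<close>.\<close>
  have bound: "norm (u * F' y + v * T y) \<le> M\<^sup>2 * h y"
    if y: "y \<ge> 0" and u: "norm u \<le> M * exp (- a * y)" and v: "norm v \<le> M * exp (a * y)" for u v y
  proof -
    have "norm (u * F' y) \<le> (LINT t|lborel. indicator {0..y} t * (M\<^sup>2 * e y t))"
    proof -
      have "u * F' y = (LINT t:{0..y}|lborel. u * (\<psi> t * f t))"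
        using F'_eq[OF y] by simp
      moreover have "norm (LINT t:{0..y}|lborel. u * (\<psi> t * f t)) \<le> (LINT t|lborel. indicator {0..y} t * (M\<^sup>2 * e y t))"
      proof (rule part)
        show "set_integrable lborel {0..y} (\<lambda>t. u * (\<psi> t * f t))"
          using mul[OF c(3), of 0 y] by simp
        fix t assume t: "t \<in> {0..y}"
        have "norm (u * (\<psi> t * f t)) \<le> (M * exp (- a * y)) * ((M * exp (a * t)) * g t)"
          unfolding norm_mult using t M0
          by (intro mult_mono u \<psi>_bound order_refl) (auto simp: g_def)
        also have "\<dots> = M\<^sup>2 * e y t"
          using t by (simp add: e_def power2_eq_square exp_add[symmetric] algebra_simps)
        finally show "norm (u * (\<psi> t * f t)) \<le> M\<^sup>2 * e y t" .
      qed simp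
      ultimately show ?thesis by (simp only:)
    qed
    moreover have "norm (v * T y) \<le> (LINT t|lborel. indicator {y<..} t * (M\<^sup>2 * e y t))"
    proof -
      have "v * T y = (LINT t:{y<..}|lborel. v * (\<phi> t * f t))"
        using y by (simp add: T_def)
      moreover have "norm (LINT t:{y<..}|lborel. v * (\<phi> t * f t)) \<le> (LINT t|lborel. indicator {y<..} t * (M\<^sup>2 * e y t))"
      proof (rule part)
        show "set_integrable lborel {y<..} (\<lambda>t. v * (\<phi> t * f t))"
        proof -
          have "{y<..} \<subseteq> {0..}" using y by auto
          then show ?thesis using \<phi>f_sub[of "{y<..}"] by simp
        qed
        fix t assume t: "t \<in> {y<..}"
        have "norm (v * (\<phi> t * f t)) \<le> (M * exp (a * y)) * ((M * exp (- a * t)) * g t)"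
          unfolding norm_mult using t M0 y
          by (intro mult_mono v \<phi>_bound order_refl) (auto simp: g_def)
        also have "\<dots> = M\<^sup>2 * e y t"
          using t by (simp add: e_def power2_eq_square exp_add[symmetric] algebra_simps)
        finally show "norm (v * (\<phi> t * f t)) \<le> M\<^sup>2 * e y t" .
      qed simp
      ultimately show ?thesis by (simp only:)
    qed
    moreover have "(LINT t|lborel. indicator {0..y} t * (M\<^sup>2 * e y t)) + (LINT t|lborel. indicator {y<..} t * (M\<^sup>2 * e y t)) \<le> M\<^sup>2 * h y"
    proof -
      have i: "integrable lborel (\<lambda>t. indicator A t * (M\<^sup>2 * e y t))" if "A \<in> sets borel" for A
        using integrable_mult_indicator[of A lborel "\<lambda>t. M\<^sup>2 * e y t"] ei[of y] that by simp
      have "(LINT t|lborel. indicator {0..y} t * (M\<^sup>2 * e y t)) + (LINT t|lborel. indicator {y<..} t * (M\<^sup>2 * e y t))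
          = (LINT t|lborel. indicator {0..y} t * (M\<^sup>2 * e y t) + indicator {y<..} t * (M\<^sup>2 * e y t))"
        by (rule Bochner_Integration.integral_add[symmetric]; rule i) auto
      also have "\<dots> \<le> (LINT t|lborel. M\<^sup>2 * e y t)"
      proof (rule Bochner_Integration.integral_mono)
        show "integrable lborel (\<lambda>t. indicator {0..y} t * (M\<^sup>2 * e y t) + indicator {y<..} t * (M\<^sup>2 * e y t))"
          by (intro Bochner_Integration.integrable_add i) auto
        show "integrable lborel (\<lambda>t. M\<^sup>2 * e y t)"
          using ei[of y] by simp
        show "indicator {0..y} t * (M\<^sup>2 * e y t) + indicator {y<..} t * (M\<^sup>2 * e y t) \<le> M\<^sup>2 * e y t" for t
          using e0[of y t] by (cases "t \<in> {0..y}"; cases "t \<in> {y<..}") auto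
      qed
      also have "\<dots> = M\<^sup>2 * h y"
        by (simp add: h_def)
      finally show ?thesis .
    qed
    ultimately show ?thesis
      using norm_triangle_ineq[of "u * F' y" "v * T y"] by linarith
  qed
  have h_int: "integrable lborel (\<lambda>y. (h y)\<^sup>2)" and h_le: "(LINT y|lborel. (h y)\<^sup>2) \<le> (2 / a)\<^sup>2 * (LINT t|lborel. (g t)\<^sup>2)"
    using conv(2,3) by (simp_all add: h_def e_def)
  have L2: "X square_integrable_on {0..} \<and> (LINT t:{0..}|lborel. (norm (X t))\<^sup>2) \<le> (M\<^sup>2 * (2 / a))\<^sup>2 * (LINT t:{0..}|lborel. (norm (f t))\<^sup>2)"
    if X: "set_borel_measurable lborel {0..} X" "\<And>y. y \<ge> 0 \<Longrightarrow> norm (X y) \<le> M\<^sup>2 * h y" for X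
  proof -
    have le: "indicator {0..} y *\<^sub>R (norm (X y))\<^sup>2 \<le> (M\<^sup>2)\<^sup>2 * (h y)\<^sup>2" for y
    proof (cases "y \<ge> 0")
      case True
      then show ?thesis
        using power_mono[OF X(2)[OF True], of 2] by (simp add: power_mult_distrib)
    qed simp
    have eq: "indicator {0..} y *\<^sub>R (norm (X y))\<^sup>2 = (norm (indicator {0..} y *\<^sub>R X y))\<^sup>2" for y
      by (simp add: indicator_def)
    have Xm: "(\<lambda>y. indicator {0..} y *\<^sub>R (norm (X y))\<^sup>2) \<in> borel_measurable lborel"
      unfolding eq using X(1) unfolding set_borel_measurable_def by measurable
    have hi: "integrable lborel (\<lambda>y. (M\<^sup>2)\<^sup>2 * (h y)\<^sup>2)"
      using h_int by simp
    have Xi: "integrable lborel (\<lambda>y. indicator {0..} y *\<^sub>R (norm (X y))\<^sup>2)"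
      by (rule Bochner_Integration.integrable_bound[OF hi Xm]) (use le in \<open>simp add: abs_mult\<close>)
    have "(LINT y|lborel. indicator {0..} y *\<^sub>R (norm (X y))\<^sup>2) \<le> (LINT y|lborel. (M\<^sup>2)\<^sup>2 * (h y)\<^sup>2)"
      by (rule Bochner_Integration.integral_mono[OF Xi hi le])
    also have "\<dots> = (M\<^sup>2)\<^sup>2 * (LINT y|lborel. (h y)\<^sup>2)"
      by simp
    also have "\<dots> \<le> (M\<^sup>2)\<^sup>2 * ((2 / a)\<^sup>2 * (LINT t|lborel. (g t)\<^sup>2))"
      by (rule mult_left_mono[OF h_le]) simp
    also have "\<dots> = (M\<^sup>2 * (2 / a))\<^sup>2 * (LINT t:{0..}|lborel. (norm (f t))\<^sup>2)"
      by (simp only: power_mult_distrib mult.assoc g2 set_lebesgue_integral_def)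
    finally show ?thesis
      using X(1) Xi by (simp only: square_integrable_on_def set_integrable_def set_lebesgue_integral_def simp_thms)
  qed
  have R: "R square_integrable_on {0..}" "(LINT t:{0..}|lborel. (norm (R t))\<^sup>2) \<le> (M\<^sup>2 * (2 / a))\<^sup>2 * (LINT t:{0..}|lborel. (norm (f t))\<^sup>2)"
    using L2[OF Rm(1)] bound[OF _ \<phi>_bound(1) \<psi>_bound(1)] by (auto simp: R_def)
  have R1: "R1 square_integrable_on {0..}"
    using L2[OF Rm(2)] bound[OF _ \<phi>_bound(2) \<psi>_bound(2)] by (auto simp: R1_def)
  have "primitive_on {0..} R1 (\<lambda>y. p y * R y - f y)"
  proof (rule primitive_on_cong_AE[OF PR1])
    show "AE y\<in>{0..} in lborel. p y * R y - (\<phi> y * \<psi>1 y - \<phi>1 y * \<psi> y) * f y = p y * R y - f y"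
      by (simp add: wronskian)
    show "set_borel_measurable lborel {0..} (\<lambda>y. p y * R y - f y)"
      using pRf[OF R(1)] by (simp add: square_integrable_on_def)
  qed simp
  then have "H2_rep {0..} R R1 (\<lambda>y. p y * R y - f y)"
    unfolding H2_rep_def using PR R(1) R1 pRf[OF R(1)] by simp
  moreover have "R 0 = 0"
    by (simp add: R_def initial F'(2))
  moreover have "R1 0 = J"
  proof -
    have "(LINT t:{0..0}|lborel. \<phi> t * f t) = 0"
      unfolding set_lebesgue_integral_def using AE_lborel_singleton[of "0 :: real"]
      by (intro integral_eq_zero_AE, elim eventually_mono) (simp add: indicator_def)
    then show ?thesis
      using T_split[of 0] by (simp add: R1_def initial F'(2))
  qed
  ultimately show ?thesis
    using that R(2) by (simp add: J_def)
qed

end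

section \<open>Solvability on the whole line\<close>

lemma minus_scaleC_L2: "u - z *\<^sub>C v = abs_L2 (\<lambda>y. rep_L2 u y - z * rep_L2 v y)"
proof -
  have r: "L2_rel (rep_L2 w) (rep_L2 w)" for w
    using rep_L2_sq by (simp add: L2_rel_def)
  have rz: "L2_rel (\<lambda>y. z * rep_L2 v y) (\<lambda>y. z * rep_L2 v y)"
    using rep_L2_sq square_integrable_cmult by (simp add: L2_rel_def)
  have rm: "L2_rel (\<lambda>y. - (z * rep_L2 v y)) (\<lambda>y. - (z * rep_L2 v y))"
    using square_integrable_cmult[OF rep_L2_sq, of "- z" v] by (simp add: L2_rel_def)
  have "z *\<^sub>C v = abs_L2 (\<lambda>y. z * rep_L2 v y)"
    using scaleC_L2.abs_eq[OF r, of z v] by (simp add: abs_rep_L2)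
  then have "- (z *\<^sub>C v) = abs_L2 (\<lambda>y. - (z * rep_L2 v y))"
    using uminus_L2.abs_eq[OF rz] by simp
  then show ?thesis
    using plus_L2.abs_eq[OF r rm, of u] by (simp add: minus_L2_def abs_rep_L2)
qed

lemma scaleC_L2_abs: "f square_integrable_on UNIV \<Longrightarrow> c *\<^sub>C abs_L2 f = abs_L2 (\<lambda>y. c * f y)"
  using scaleC_L2.abs_eq[of f c] by (simp add: L2_rel_def)

lemma zero_L2_abs: "0 = abs_L2 (\<lambda>_. 0)"
  by (simp add: zero_L2_def)

lemma abs_L2_eq_iff:
  assumes "f square_integrable_on UNIV" "g square_integrable_on UNIV"
  shows "abs_L2 f = abs_L2 g \<longleftrightarrow> (AE y in lborel. f y = g y)"
  using Quotient_rel[OF Quotient_L2, of f g] assms by (simp add: L2_rel_def)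

lemma norm_L2_power2: "(norm u)\<^sup>2 = (LINT y|lborel. (norm (rep_L2 u y))\<^sup>2)"
proof -
  have r: "L2_rel (rep_L2 u) (rep_L2 u)"
    using rep_L2_sq by (simp add: L2_rel_def)
  have "(norm u)\<^sup>2 = inner u u"
    by (simp add: power2_norm_eq_inner)
  also have "\<dots> = (LINT y|lborel. inner (rep_L2 u y) (rep_L2 u y))"
    using inner_L2.abs_eq[OF r r] by (simp add: abs_rep_L2)
  finally show ?thesis
    by (simp add: power2_norm_eq_inner)
qed

lemma norm_L2_glue:
  assumes "AE y in lborel. rep_L2 u y = glue R L y"
    and RL: "R square_integrable_on {0..}" "L square_integrable_on {0..}"
  shows "(norm u)\<^sup>2 = (LINT t:{0..}|lborel. (norm (R t))\<^sup>2) + (LINT t:{0..}|lborel. (norm (L t))\<^sup>2)"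
proof -
  have g: "glue R L square_integrable_on UNIV"
    by (rule glue_square_integrable[OF RL])
  have i: "integrable lborel (\<lambda>y. indicator {0..} y *\<^sub>R (norm (R y))\<^sup>2)" "integrable lborel (\<lambda>y. indicator {0..} y *\<^sub>R (norm (L y))\<^sup>2)"
    using RL by (simp_all add: square_integrable_on_def set_integrable_def)
  have i2: "integrable lborel (\<lambda>y. indicator {0..} (0 + (-1) * y) *\<^sub>R (norm (L (0 + (-1) * y)))\<^sup>2)"
    by (rule lborel_integrable_real_affine[OF i(2)]) simp
  have "(norm u)\<^sup>2 = (LINT y|lborel. (norm (glue R L y))\<^sup>2)"
    unfolding norm_L2_power2
  proof (rule integral_cong_AE)
    show "(\<lambda>y. (norm (rep_L2 u y))\<^sup>2) \<in> borel_measurable lborel" "(\<lambda>y. (norm (glue R L y))\<^sup>2) \<in> borel_measurable lborel"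
      using sq_UNIV_measurable[OF rep_L2_sq] sq_UNIV_measurable[OF g] by measurable
    show "AE y in lborel. (norm (rep_L2 u y))\<^sup>2 = (norm (glue R L y))\<^sup>2"
      using assms(1) by (rule eventually_mono) simp
  qed
  also have "\<dots> = (LINT y|lborel. indicator {0..} y *\<^sub>R (norm (R y))\<^sup>2 + indicator {0..} (0 + (-1) * y) *\<^sub>R (norm (L (0 + (-1) * y)))\<^sup>2)"
  proof (rule integral_cong_AE)
    show "(\<lambda>y. (norm (glue R L y))\<^sup>2) \<in> borel_measurable lborel"
      using sq_UNIV_measurable[OF g] by measurable
    show "(\<lambda>y. indicator {0..} y *\<^sub>R (norm (R y))\<^sup>2 + indicator {0..} (0 + (-1) * y) *\<^sub>R (norm (L (0 + (-1) * y)))\<^sup>2) \<in> borel_measurable lborel"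
      using i(1) i2 by (intro borel_measurable_add) (auto dest: borel_measurable_integrable)
    show "AE y in lborel. (norm (glue R L y))\<^sup>2 = indicator {0..} y *\<^sub>R (norm (R y))\<^sup>2 + indicator {0..} (0 + (-1) * y) *\<^sub>R (norm (L (0 + (-1) * y)))\<^sup>2"
      using AE_lborel_singleton[of "0 :: real"] by (rule eventually_mono) (auto simp: glue_def indicator_def)
  qed
  also have "\<dots> = (LINT y|lborel. indicator {0..} y *\<^sub>R (norm (R y))\<^sup>2)
      + (LINT y|lborel. indicator {0..} (0 + (-1) * y) *\<^sub>R (norm (L (0 + (-1) * y)))\<^sup>2)"
    by (rule Bochner_Integration.integral_add[OF i(1) i2])
  also have "(LINT y|lborel. indicator {0..} (0 + (-1) * y) *\<^sub>R (norm (L (0 + (-1) * y)))\<^sup>2)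
      = (LINT y|lborel. indicator {0..} y *\<^sub>R (norm (L y))\<^sup>2)"
    using lborel_integral_real_affine[of "-1" "\<lambda>y. indicator {0..} y *\<^sub>R (norm (L y))\<^sup>2" 0] by simp
  finally show ?thesis
    by (simp add: set_lebesgue_integral_def)
qed

lemma H2_rep_diff:
  assumes "H2_rep C R R1 R2" "H2_rep C S S1 S2"
  shows "H2_rep C (\<lambda>t. R t - S t) (\<lambda>t. R1 t - S1 t) (\<lambda>t. R2 t - S2 t)"
proof -
  have "(\<lambda>t. f t - g t) square_integrable_on C" if "f square_integrable_on C" "g square_integrable_on C" for f g
    using square_integrable_on_add[OF that(1) square_integrable_on_uminus_fun[OF that(2)]] by simp
  then show ?thesis
    using assms by (auto simp: H2_rep_def intro: primitive_on_diff)
qed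

lemma H2_rep_add:
  assumes "H2_rep C R R1 R2" "H2_rep C S S1 S2"
  shows "H2_rep C (\<lambda>t. R t + S t) (\<lambda>t. R1 t + S1 t) (\<lambda>t. R2 t + S2 t)"
  using assms by (auto simp: H2_rep_def intro: primitive_on_add square_integrable_on_add)

lemma square_integrable_on_cmult:
  "f square_integrable_on S \<Longrightarrow> (\<lambda>t. c * f t) square_integrable_on S"
  using square_integrable_on_bounded_mult[of f S "\<lambda>_. c" "norm c"] by simp

lemma H2_rep_cmult:
  assumes "H2_rep C R R1 R2"
  shows "H2_rep C (\<lambda>t. c * R t) (\<lambda>t. c * R1 t) (\<lambda>t. c * R2 t)"
  using assms by (auto simp: H2_rep_def intro: primitive_on_cmult square_integrable_on_cmult)

lemma jump_rep_diff:
  assumes "jump_rep \<gamma> R R1 R2 L L1 L2" "jump_rep \<gamma> S S1 S2 K K1 K2"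
  shows "jump_rep \<gamma> (\<lambda>t. R t - S t) (\<lambda>t. R1 t - S1 t) (\<lambda>t. R2 t - S2 t)
    (\<lambda>t. L t - K t) (\<lambda>t. L1 t - K1 t) (\<lambda>t. L2 t - K2 t)"
proof -
  have "(R1 0 - S1 0) + (L1 0 - K1 0) = (R1 0 + L1 0) - (S1 0 + K1 0)"
    by simp
  also have "\<dots> = - of_real \<gamma> * (R 0 - S 0)"
    using assms by (simp add: jump_rep_def algebra_simps)
  finally show ?thesis
    using assms by (simp add: jump_rep_def H2_rep_diff)
qed

text \<open>The spectral parameter is absorbed into the complex potential \<open>p\<close>, so that
  Op u = v reads p R - R2 = v on each half-line and the half-line theory applies for complex
  \<open>z\<close>.\<close>

locale schroedinger = half_line p \<phi> \<phi>1 \<psi> \<psi>1 a M B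
  for p \<phi> \<phi>1 \<psi> \<psi>1 a M B +
  fixes b \<beta> lam \<alpha> :: real and k :: nat and z :: complex
  assumes p_eq: "p = (\<lambda>y. of_real (pot b \<beta> k lam y) - z)"
begin

abbreviation (input) "\<gamma> \<equiv> (real k)\<^sup>2 * \<alpha>"
abbreviation "Op u \<equiv> L_op b \<beta> k lam u - z *\<^sub>C u"

lemma square_integrable_residual:
  assumes "H2_rep C R R1 R2"
  shows "(\<lambda>y. p y * R y - R2 y) square_integrable_on C"
  using assms square_integrable_on_add[OF square_integrable_on_bounded_mult[OF _ p_bound] square_integrable_on_uminus_fun]
  by (simp add: H2_rep_def)

lemma Op_eq:
  assumes J: "jump_rep g R R1 R2 L L1 L2" and u: "AE y in lborel. rep_L2 u y = glue R L y"
  shows "Op u = abs_L2 (glue (\<lambda>y. p y * R y - R2 y) (\<lambda>y. p y * L y - L2 y))"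
proof -
  have H: "H2_rep {0..} R R1 R2" "H2_rep {0..} L L1 L2"
    using J by (auto simp: jump_rep_def)
  have g1: "glue (schr b \<beta> k lam R R2) (schr b \<beta> k lam L L2) square_integrable_on UNIV"
    using H schr_square_integrable by (auto intro!: glue_square_integrable)
  have g2: "glue (\<lambda>y. p y * R y - R2 y) (\<lambda>y. p y * L y - L2 y) square_integrable_on UNIV"
    using H square_integrable_residual by (auto intro!: glue_square_integrable)
  have "Op u = abs_L2 (\<lambda>y. rep_L2 (L_op b \<beta> k lam u) y - z * rep_L2 u y)"
    by (rule minus_scaleC_L2)
  also have "\<dots> = abs_L2 (glue (\<lambda>y. p y * R y - R2 y) (\<lambda>y. p y * L y - L2 y))"
  proof (rule abs_L2_cong_AE[OF g2])
    show "(\<lambda>y. rep_L2 (L_op b \<beta> k lam u) y - z * rep_L2 u y) \<in> borel_measurable borel"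
      using sq_UNIV_measurable[OF rep_L2_sq] by measurable
    show "AE y in lborel. glue (\<lambda>y. p y * R y - R2 y) (\<lambda>y. p y * L y - L2 y) y = rep_L2 (L_op b \<beta> k lam u) y - z * rep_L2 u y"
      using rep_abs_L2[OF g1] u unfolding L_op_eq[OF J u]
    proof eventually_elim
      case (elim y)
      then show ?case
        by (simp add: glue_def schr_def p_eq algebra_simps)
    qed
  qed
  finally show ?thesis .
qed

text \<open>On both half-lines the function is a multiple of \<open>\<phi>\<close>, with the same
  factor by continuity at 0; the jump condition then collapses to one scalar equation for that
  factor.\<close>

lemma jump_rep_homogeneous:
  assumes J: "jump_rep g R R1 R2 L L1 L2"
    and h: "AE t\<in>{0<..} in lborel. R2 t = p t * R t" "AE t\<in>{0<..} in lborel. L2 t = p t * L t"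
  shows "\<And>y. y \<ge> 0 \<Longrightarrow> R y = R 0 * \<phi> y" "\<And>y. y \<ge> 0 \<Longrightarrow> L y = R 0 * \<phi> y" "R 0 * (2 * \<phi>1 0 + of_real g) = 0"
proof -
  have H: "H2_rep {0..} R R1 R2" "H2_rep {0..} L L1 L2" "R 0 = L 0" "R1 0 + L1 0 = - of_real g * R 0"
    using J by (auto simp: jump_rep_def)
  have hom: "H2_rep {0..} X X1 (\<lambda>y. p y * X y)" if X: "H2_rep {0..} X X1 X2" "AE t\<in>{0<..} in lborel. X2 t = p t * X t" for X X1 X2
  proof (rule H2_rep_cong_AE[OF X(1)])
    show "AE t\<in>{0..} in lborel. X2 t = p t * X t"
      using X(2) AE_lborel_singleton[of "0 :: real"] by eventually_elim auto
    have "X square_integrable_on {0..}" using X(1) by (simp add: H2_rep_def)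
    then have "(\<lambda>y. p y * X y) square_integrable_on {0..}"
      using p_bound by (rule square_integrable_on_bounded_mult)
    then show "set_borel_measurable lborel {0..} (\<lambda>y. p y * X y)"
      by (simp add: square_integrable_on_def)
  qed simp
  note r = H2_rep_homogeneous[OF hom[OF H(1) h(1)]] and l = H2_rep_homogeneous[OF hom[OF H(2) h(2)]]
  show "R y = R 0 * \<phi> y" if "y \<ge> 0" for y
    by (rule r(1)[OF that])
  show "L y = R 0 * \<phi> y" if "y \<ge> 0" for y
    unfolding H(3) by (rule l(1)[OF that])
  have r0: "R1 0 = R 0 * \<phi>1 0" using r(2)[of 0] by simp
  have l0: "L1 0 = R 0 * \<phi>1 0" unfolding H(3) using l(2)[of 0] by simp
  show "R 0 * (2 * \<phi>1 0 + of_real g) = 0"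
    using H(4) unfolding r0 l0 by (simp add: algebra_simps eq_neg_iff_add_eq_0)
qed

lemma AE_glue_eq_imp:
  assumes "AE y in lborel. glue X Y y = glue X' Y' y"
  shows "AE t\<in>{0<..} in lborel. X t = X' t" "AE t\<in>{0<..} in lborel. Y t = Y' t"
proof -
  note ae = assms[unfolded AE_glue_iff]
  show "AE t\<in>{0<..} in lborel. X t = X' t"
    using conjunct1[OF ae] by (rule eventually_mono) (simp add: glue_def)
  show "AE t\<in>{0<..} in lborel. Y t = Y' t"
    using AE_uminus[OF conjunct2[OF ae]] unfolding uminus_image_half_lines
    by (rule eventually_mono) (simp add: glue_def)
qed

lemma Op_injective:
  assumes ne: "2 * \<phi>1 0 + of_real \<gamma> \<noteq> 0"
    and u: "u \<in> L_dom \<alpha> k" and v: "v \<in> L_dom \<alpha> k" and eq: "Op u = Op v"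
  shows "u = v"
proof -
  obtain R R1 R2 L L1 L2 where J: "jump_rep \<gamma> R R1 R2 L L1 L2" "AE y in lborel. rep_L2 u y = glue R L y"
    using u by (rule L_dom_imp_jump_rep)
  obtain S S1 S2 K K1 K2 where J': "jump_rep \<gamma> S S1 S2 K K1 K2" "AE y in lborel. rep_L2 v y = glue S K y"
    using v by (rule L_dom_imp_jump_rep)
  have sq: "glue (\<lambda>y. p y * R y - R2 y) (\<lambda>y. p y * L y - L2 y) square_integrable_on UNIV"
    "glue (\<lambda>y. p y * S y - S2 y) (\<lambda>y. p y * K y - K2 y) square_integrable_on UNIV"
    using J(1) J'(1) square_integrable_residual by (auto intro!: glue_square_integrable simp: jump_rep_def)
  have ae: "AE y in lborel. glue (\<lambda>y. p y * R y - R2 y) (\<lambda>y. p y * L y - L2 y) y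
      = glue (\<lambda>y. p y * S y - S2 y) (\<lambda>y. p y * K y - K2 y) y"
    using eq unfolding Op_eq[OF J] Op_eq[OF J'] abs_L2_eq_iff[OF sq] .
  note e = AE_glue_eq_imp[OF ae]
  have "AE t\<in>{0<..} in lborel. R2 t - S2 t = p t * (R t - S t)"
    using e(1) by (rule eventually_mono) (auto simp: algebra_simps)
  moreover have "AE t\<in>{0<..} in lborel. L2 t - K2 t = p t * (L t - K t)"
    using e(2) by (rule eventually_mono) (auto simp: algebra_simps)
  ultimately have h: "\<And>y. y \<ge> 0 \<Longrightarrow> R y - S y = (R 0 - S 0) * \<phi> y" "\<And>y. y \<ge> 0 \<Longrightarrow> L y - K y = (R 0 - S 0) * \<phi> y"
    "(R 0 - S 0) * (2 * \<phi>1 0 + of_real \<gamma>) = 0"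
    using jump_rep_homogeneous[OF jump_rep_diff[OF J(1) J'(1)]] by blast+
  have "R 0 - S 0 = 0" using h(3) ne by simp
  then have "R y = S y" "L y = K y" if "y \<ge> 0" for y
    using h(1,2)[OF that] by auto
  then have eq: "glue R L y = glue S K y" for y
    by (simp add: glue_def)
  have "AE y in lborel. rep_L2 u y = rep_L2 v y"
    using J(2) J'(2) by eventually_elim (simp add: eq)
  then show ?thesis by (rule L2_eqI)
qed

lemma sq_rep_halves:
  "rep_L2 v square_integrable_on {0..}" "(\<lambda>t. rep_L2 v (- t)) square_integrable_on {0..}"
proof -
  show "rep_L2 v square_integrable_on {0..}"
    using rep_L2_sq by (rule square_integrable_on_subset) auto
  have "(\<lambda>t. rep_L2 v (- t)) square_integrable_on (uminus ` UNIV)"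
    by (rule square_integrable_on_uminus[OF rep_L2_sq])
  then show "(\<lambda>t. rep_L2 v (- t)) square_integrable_on {0..}"
    by (rule square_integrable_on_subset) auto
qed

lemma sum_square_le: "(norm (x + y :: complex))\<^sup>2 \<le> 2 * (norm x)\<^sup>2 + 2 * (norm y)\<^sup>2"
proof -
  have "(norm (x + y))\<^sup>2 \<le> (norm x + norm y)\<^sup>2"
    by (rule power_mono[OF norm_triangle_ineq]) simp
  also have "\<dots> \<le> 2 * (norm x)\<^sup>2 + 2 * (norm y)\<^sup>2"
    using sum_squares_bound[of "norm x" "norm y"] by (simp add: power2_sum)
  finally show ?thesis .
qed

text \<open>Dirichlet solutions on the two half-lines are continuous at 0 but violate the jump
  condition. Adding the same multiple of \<open>\<phi>\<close> on both sides keeps continuity and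
  equation, and the multiple is determined by a scalar equation with coefficient
  \<open>D\<close>.\<close>

lemma Op_surjective:
  assumes ne: "2 * \<phi>1 0 + of_real \<gamma> \<noteq> 0"
  shows "\<exists>C\<ge>0. \<forall>v. \<exists>u\<in>L_dom \<alpha> k. Op u = v \<and> norm u \<le> C * norm v"
proof -
  define N where "N = (LINT t:{0..}|lborel. (norm (\<phi> t))\<^sup>2)"
  define D where "D = 2 * \<phi>1 0 + complex_of_real \<gamma>"
  define Q where "Q = (M\<^sup>2 * (2 / a))\<^sup>2"
  \<comment> \<open>The first term stems from the Dirichlet solutions. For the second,
    Cauchy-Schwarz bounds |A|^2 by 2 N |v|^2 / |D|^2, and |A|^2 enters the final estimate with the
    factor 4 N.\<close>
  define C2 where "C2 = 2 * Q + 8 * N * N / (norm D)\<^sup>2"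
  have N0: "N \<ge> 0"
    unfolding N_def set_lebesgue_integral_def by (intro Bochner_Integration.integral_nonneg) simp
  have D0: "norm D > 0" using ne by (simp add: D_def)
  have C20: "C2 \<ge> 0" using N0 by (simp add: C2_def Q_def)
  have "\<exists>u\<in>L_dom \<alpha> k. Op u = v \<and> norm u \<le> sqrt C2 * norm v" for v
  proof -
    define f where "f = rep_L2 v"
    define f' where "f' t = rep_L2 v (- t)" for t
    have sq: "f square_integrable_on {0..}" "f' square_integrable_on {0..}"
      using sq_rep_halves by (simp_all add: f_def f'_def[abs_def])
    define I where "I h = (LINT t:{0..}|lborel. (norm (h t))\<^sup>2)" for h :: "real \<Rightarrow> complex"
    have I0: "I h \<ge> 0" for h
      unfolding I_def set_lebesgue_integral_def by (intro Bochner_Integration.integral_nonneg) simp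
    have vf: "AE y in lborel. rep_L2 v y = glue f f' y"
      by (simp add: glue_def f_def f'_def)
    have nv: "(norm v)\<^sup>2 = I f + I f'"
      using norm_L2_glue[OF vf sq] by (simp add: I_def)
    define j j' where "j = (LINT t:{0..}|lborel. \<phi> t * f t)" and "j' = (LINT t:{0..}|lborel. \<phi> t * f' t)"
    obtain S S1 where S: "H2_rep {0..} S S1 (\<lambda>y. p y * S y - f y)" "S 0 = 0" "S1 0 = j" "I S \<le> Q * I f"
      using solve_dirichlet[OF sq(1)] unfolding I_def Q_def j_def by blast
    obtain K K1 where K: "H2_rep {0..} K K1 (\<lambda>y. p y * K y - f' y)" "K 0 = 0" "K1 0 = j'" "I K \<le> Q * I f'"
      using solve_dirichlet[OF sq(2)] unfolding I_def Q_def j'_def by blast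
    \<comment> \<open>Solves (j + A \<phi>1 0) + (j' + A \<phi>1 0) = - \<gamma> A, the jump
      condition for the corrected function whose value at 0 is A.\<close>
    define A where "A = - (j + j') / D"
    define R R1 R2 where "R t = S t + A * \<phi> t" and "R1 t = S1 t + A * \<phi>1 t" and "R2 t = (p t * S t - f t) + A * (p t * \<phi> t)" for t
    define L L1 L2 where "L t = K t + A * \<phi> t" and "L1 t = K1 t + A * \<phi>1 t" and "L2 t = (p t * K t - f' t) + A * (p t * \<phi> t)" for t
    have HR: "H2_rep {0..} R R1 R2"
      unfolding R_def R1_def R2_def by (intro H2_rep_add S H2_rep_cmult H2_rep_\<phi>)
    have HL: "H2_rep {0..} L L1 L2"
      unfolding L_def L1_def L2_def by (intro H2_rep_add K H2_rep_cmult H2_rep_\<phi>)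
    have AD: "j + j' = - (A * D)"
      using D0 by (simp add: A_def)
    have "(j + A * \<phi>1 0) + (j' + A * \<phi>1 0) = (j + j') + A * (2 * \<phi>1 0)"
      by (simp add: algebra_simps)
    also have "\<dots> = - of_real \<gamma> * A"
      unfolding AD by (simp add: D_def algebra_simps)
    finally have "(j + A * \<phi>1 0) + (j' + A * \<phi>1 0) = - of_real \<gamma> * A" .
    then have J: "jump_rep \<gamma> R R1 R2 L L1 L2"
      using HR HL unfolding jump_rep_def by (simp add: R_def R1_def L_def L1_def S K initial)
    define u where "u = abs_L2 (glue R L)"
    have sqRL: "R square_integrable_on {0..}" "L square_integrable_on {0..}"
      using HR HL by (auto simp: H2_rep_def)
    have u: "AE y in lborel. rep_L2 u y = glue R L y"
      unfolding u_def by (rule rep_abs_L2[OF glue_square_integrable[OF sqRL]])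
    have "u \<in> L_dom \<alpha> k"
      by (rule jump_rep_imp_L_dom[OF J u])
    moreover have "Op u = v"
    proof -
      have "glue (\<lambda>y. p y * R y - R2 y) (\<lambda>y. p y * L y - L2 y) = rep_L2 v"
        by (auto simp: glue_def R_def R2_def L_def L2_def f_def f'_def algebra_simps)
      then show ?thesis
        unfolding Op_eq[OF J u] by (simp add: abs_rep_L2)
    qed
    moreover have "norm u \<le> sqrt C2 * norm v"
    proof -
      have ij: "(norm j)\<^sup>2 \<le> N * I f" "(norm j')\<^sup>2 \<le> N * I f'"
        unfolding j_def j'_def N_def I_def
        by (intro integral_Cauchy_Schwarz \<phi>_square_integrable sq)+
      have "(norm A)\<^sup>2 = (norm (j + j'))\<^sup>2 / (norm D)\<^sup>2"
        unfolding A_def norm_divide norm_minus_cancel power_divide ..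
      also have "\<dots> \<le> (2 * (N * I f) + 2 * (N * I f')) / (norm D)\<^sup>2"
        using sum_square_le[of j j'] ij by (intro divide_right_mono) auto
      finally have nA: "(norm A)\<^sup>2 \<le> (2 * (N * I f) + 2 * (N * I f')) / (norm D)\<^sup>2" .
      have add: "I (\<lambda>t. X t + A * \<phi> t) \<le> 2 * I X + 2 * (norm A)\<^sup>2 * N" if X: "X square_integrable_on {0..}" for X
      proof -
        have i: "set_integrable lborel {0..} (\<lambda>t. (norm (X t))\<^sup>2)" "set_integrable lborel {0..} (\<lambda>t. (norm (\<phi> t))\<^sup>2)"
          "set_integrable lborel {0..} (\<lambda>t. (norm (X t + A * \<phi> t))\<^sup>2)"
          using X \<phi>_square_integrable square_integrable_on_add[OF X square_integrable_on_cmult[OF \<phi>_square_integrable(1), of A]]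
          by (simp_all add: square_integrable_on_def)
        have i': "set_integrable lborel {0..} (\<lambda>t. 2 * (norm (X t))\<^sup>2)" "set_integrable lborel {0..} (\<lambda>t. 2 * (norm A)\<^sup>2 * (norm (\<phi> t))\<^sup>2)"
          using i by simp_all
        have "I (\<lambda>t. X t + A * \<phi> t) \<le> (LINT t:{0..}|lborel. 2 * (norm (X t))\<^sup>2 + 2 * (norm A)\<^sup>2 * (norm (\<phi> t))\<^sup>2)"
          unfolding I_def
        proof (rule set_integral_mono[OF i(3) set_integral_add(1)[OF i']])
          show "(norm (X t + A * \<phi> t))\<^sup>2 \<le> 2 * (norm (X t))\<^sup>2 + 2 * (norm A)\<^sup>2 * (norm (\<phi> t))\<^sup>2" for t
            using sum_square_le[of "X t" "A * \<phi> t"] by (simp add: norm_mult power_mult_distrib)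
        qed
        also have "\<dots> = 2 * I X + 2 * (norm A)\<^sup>2 * N"
          unfolding set_integral_add(2)[OF i'] by (simp add: I_def N_def)
        finally show ?thesis .
      qed
      have "(norm u)\<^sup>2 = I R + I L"
        using norm_L2_glue[OF u sqRL] by (simp add: I_def)
      also have "\<dots> \<le> (2 * I S + 2 * (norm A)\<^sup>2 * N) + (2 * I K + 2 * (norm A)\<^sup>2 * N)"
        unfolding R_def L_def using S(1) K(1) by (intro add_mono add) (auto simp: H2_rep_def)
      also have "\<dots> = 2 * (I S + I K) + 4 * N * (norm A)\<^sup>2"
        by simp
      also have "\<dots> \<le> 2 * (Q * I f + Q * I f') + 4 * N * ((2 * (N * I f) + 2 * (N * I f')) / (norm D)\<^sup>2)"
        using S(4) K(4) nA N0 by (intro add_mono mult_left_mono) auto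
      also have "\<dots> = C2 * (norm v)\<^sup>2"
        unfolding nv C2_def by (simp add: field_simps)
      finally have "(norm u)\<^sup>2 \<le> C2 * (norm v)\<^sup>2" .
      then have "sqrt ((norm u)\<^sup>2) \<le> sqrt (C2 * (norm v)\<^sup>2)"
        by (rule real_sqrt_le_mono)
      then show ?thesis
        by (simp add: real_sqrt_mult)
    qed
    ultimately show ?thesis by blast
  qed
  then show ?thesis
    using C20 by (intro exI[of _ "sqrt C2"]) simp
qed

theorem resolvent:
  assumes ne: "2 * \<phi>1 0 + of_real \<gamma> \<noteq> 0"
  shows "z \<in> resolvent_set (L_dom \<alpha> k) (L_op b \<beta> k lam)"
proof -
  obtain C where C: "C \<ge> 0" "\<forall>v. \<exists>u\<in>L_dom \<alpha> k. Op u = v \<and> norm u \<le> C * norm v"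
    using Op_surjective[OF ne] by blast
  have "bij_betw (\<lambda>u. Op u) (L_dom \<alpha> k) UNIV"
    unfolding bij_betw_def
  proof
    show "inj_on (\<lambda>u. Op u) (L_dom \<alpha> k)"
      by (rule inj_onI) (rule Op_injective[OF ne])
    show "(\<lambda>u. Op u) ` L_dom \<alpha> k = UNIV"
    proof (intro equalityI subsetI UNIV_I)
      fix v show "v \<in> (\<lambda>u. Op u) ` L_dom \<alpha> k"
        using spec[OF C(2), of v] by (auto intro: rev_image_eqI)
    qed
  qed
  \<comment> \<open>By injectivity the bounded solution constructed for the right-hand side Op u is
    \<open>u\<close> itself.\<close>
  moreover have "norm u \<le> C * norm (Op u)" if "u \<in> L_dom \<alpha> k" for u
    using spec[OF C(2), of "Op u"] Op_injective[OF ne _ that] by metis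
  ultimately show ?thesis
    unfolding resolvent_set_def by blast
qed

end

section \<open>The kernel at a resonance\<close>

lemma primitive_on_cnj:
  assumes "primitive_on S F f"
  shows "primitive_on S (\<lambda>t. cnj (F t)) (\<lambda>t. cnj (f t))"
  unfolding primitive_on_def
proof (intro allI impI)
  fix x y :: real assume xy: "x \<le> y" "{x..y} \<subseteq> S"
  note f = primitive_onD[OF assms xy]
  have "set_integrable lborel {x..y} (\<lambda>t. cnj (f t))"
    using integrable_cnj[of lborel "\<lambda>t. indicator {x..y} t *\<^sub>R f t"] f(1) by (simp add: set_integrable_def)
  moreover have "(LINT t:{x..y}|lborel. cnj (f t)) = cnj (F y - F x)"
  proof -
    have "indicator {x..y} t *\<^sub>R cnj (f t) = cnj (indicator {x..y} t *\<^sub>R f t)" for t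
      by simp
    then show ?thesis
      unfolding f(2)[symmetric] set_lebesgue_integral_def by (simp only: Bochner_Integration.integral_cnj)
  qed
  ultimately show "set_integrable lborel {x..y} (\<lambda>t. cnj (f t)) \<and> (LINT t:{x..y}|lborel. cnj (f t)) = cnj (F y) - cnj (F x)"
    by simp
qed

lemma square_integrable_on_cnj:
  assumes "f square_integrable_on S"
  shows "(\<lambda>t. cnj (f t)) square_integrable_on S"
proof -
  have m: "(\<lambda>t. indicator S t *\<^sub>R f t) \<in> borel_measurable borel"
    using assms by (simp add: square_integrable_on_def set_borel_measurable_def)
  have "(\<lambda>t. cnj (indicator S t *\<^sub>R f t)) \<in> borel_measurable borel"
    by (rule measurable_compose[OF m borel_measurable_cnj])
  then show ?thesis
    using assms by (simp add: square_integrable_on_def set_borel_measurable_def)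
qed

context schroedinger
begin

lemma \<phi>_continuous: "continuous_on {0..} \<phi>"
  by (rule primitive_on_continuous_on[OF \<phi>_primitive(1)]) simp

lemma \<phi>_zero_on_ray:
  assumes "AE t\<in>{c<..} in lborel. \<phi> t = 0" "c \<ge> 0" "t > c"
  shows "\<phi> t = 0"
  using AE_eq_continuous_imp_eq[of "{c<..}" \<phi> "\<lambda>_. 0" t] assms
    continuous_on_subset[OF \<phi>_continuous, of "{c<..}"] by fastforce

lemma \<phi>_not_AE_zero: "\<not> (AE t\<in>{0<..} in lborel. \<phi> t = 0)"
proof
  assume ae: "AE t\<in>{0<..} in lborel. \<phi> t = 0"
  have 0: "\<phi> t = 0" if "t \<in> {0<..}" for t
    using \<phi>_zero_on_ray[OF ae, of t] that by simp
  have "\<phi> 0 = 0"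
    by (rule continuous_constant_on_closure[of "{0<..}"]) (use \<phi>_continuous 0 in auto)
  then show False by (simp add: initial)
qed

lemma sq_glue_\<phi>: "glue \<phi> \<phi> square_integrable_on UNIV"
  by (intro glue_square_integrable \<phi>_square_integrable)

lemma eigenfunction_ne_0: "abs_L2 (glue \<phi> \<phi>) \<noteq> 0"
proof
  assume "abs_L2 (glue \<phi> \<phi>) = 0"
  then have "AE y in lborel. glue \<phi> \<phi> y = 0"
    unfolding zero_L2_abs abs_L2_eq_iff[OF sq_glue_\<phi> square_integrable_zero] .
  then have "AE t\<in>{0<..} in lborel. \<phi> t = 0"
    by (rule eventually_mono) (auto simp: glue_def split: if_splits)
  then show False using \<phi>_not_AE_zero by blast
qed

lemma \<phi>_jump_rep:
  assumes "2 * \<phi>1 0 + of_real \<gamma> = 0"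
  shows "jump_rep \<gamma> (\<lambda>t. c * \<phi> t) (\<lambda>t. c * \<phi>1 t) (\<lambda>t. c * (p t * \<phi> t)) (\<lambda>t. c * \<phi> t) (\<lambda>t. c * \<phi>1 t) (\<lambda>t. c * (p t * \<phi> t))"
proof -
  have "c * \<phi>1 0 + c * \<phi>1 0 = c * (2 * \<phi>1 0)"
    by simp
  also have "2 * \<phi>1 0 = - of_real \<gamma>"
    using assms by (simp only: add_eq_0_iff2)
  also have "c * - of_real \<gamma> = - of_real \<gamma> * (c * \<phi> 0)"
    by (simp add: initial)
  finally show ?thesis
    using H2_rep_cmult[OF H2_rep_\<phi>, of c] by (simp only: jump_rep_def simp_thms)
qed

text \<open>At a resonance the scalar condition is void, so the even extension of
  \<open>\<phi>\<close> lies in the domain and every kernel element is a multiple of it.\<close>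

lemma Op_kernel:
  assumes ev: "2 * \<phi>1 0 + of_real \<gamma> = 0"
  shows "{u \<in> L_dom \<alpha> k. Op u = 0} = L2.span {abs_L2 (glue \<phi> \<phi>)}"
  unfolding L2.span_singleton
proof (intro equalityI subsetI)
  fix u assume "u \<in> {u \<in> L_dom \<alpha> k. Op u = 0}"
  then have u: "u \<in> L_dom \<alpha> k" "Op u = 0" by auto
  obtain R R1 R2 L L1 L2 where J: "jump_rep \<gamma> R R1 R2 L L1 L2" "AE y in lborel. rep_L2 u y = glue R L y"
    using u(1) by (rule L_dom_imp_jump_rep)
  have sq: "glue (\<lambda>y. p y * R y - R2 y) (\<lambda>y. p y * L y - L2 y) square_integrable_on UNIV"
    using J(1) square_integrable_residual by (auto intro!: glue_square_integrable simp: jump_rep_def)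
  have "AE y in lborel. glue (\<lambda>y. p y * R y - R2 y) (\<lambda>y. p y * L y - L2 y) y = 0"
    using u(2) unfolding Op_eq[OF J] zero_L2_abs abs_L2_eq_iff[OF sq square_integrable_zero] .
  then have ae: "AE y in lborel. glue (\<lambda>y. p y * R y - R2 y) (\<lambda>y. p y * L y - L2 y) y = glue (\<lambda>_. 0) (\<lambda>_. 0) y"
    by (simp add: glue_def)
  have h1: "AE t\<in>{0<..} in lborel. R2 t = p t * R t"
    using AE_glue_eq_imp(1)[OF ae] by (rule eventually_mono) auto
  have h2: "AE t\<in>{0<..} in lborel. L2 t = p t * L t"
    using AE_glue_eq_imp(2)[OF ae] by (rule eventually_mono) auto
  note h = jump_rep_homogeneous[OF J(1) h1 h2]
  have eq: "glue R L y = R 0 * glue \<phi> \<phi> y" for y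
    using h(1)[of y] h(2)[of "- y"] by (simp add: glue_def)
  have "u = R 0 *\<^sub>C abs_L2 (glue \<phi> \<phi>)"
    unfolding scaleC_L2_abs[OF sq_glue_\<phi>] 
  proof (rule L2_eqI)
    show "AE y in lborel. rep_L2 u y = rep_L2 (abs_L2 (\<lambda>y. R 0 * glue \<phi> \<phi> y)) y"
      using J(2) rep_abs_L2[OF square_integrable_cmult[OF sq_glue_\<phi>, of "R 0"]]
      by eventually_elim (simp add: eq)
  qed
  then show "u \<in> range (\<lambda>c. c *\<^sub>C abs_L2 (glue \<phi> \<phi>))"
    by (rule range_eqI)
next
  fix u assume "u \<in> range (\<lambda>c. c *\<^sub>C abs_L2 (glue \<phi> \<phi>))"
  then obtain c where c: "u = abs_L2 (\<lambda>y. c * glue \<phi> \<phi> y)"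
    using scaleC_L2_abs[OF sq_glue_\<phi>] by auto
  have eq: "(\<lambda>y. c * glue \<phi> \<phi> y) = glue (\<lambda>t. c * \<phi> t) (\<lambda>t. c * \<phi> t)"
    by (auto simp: glue_def)
  note J = \<phi>_jump_rep[OF ev, of c]
  have u: "AE y in lborel. rep_L2 u y = glue (\<lambda>t. c * \<phi> t) (\<lambda>t. c * \<phi> t) y"
    unfolding c eq[symmetric] by (rule rep_abs_L2[OF square_integrable_cmult[OF sq_glue_\<phi>]])
  have "glue (\<lambda>y. p y * (c * \<phi> y) - c * (p y * \<phi> y)) (\<lambda>y. p y * (c * \<phi> y) - c * (p y * \<phi> y)) = (\<lambda>_. 0)"
    by (auto simp: glue_def)
  then have "Op u = 0"
    unfolding Op_eq[OF J u] zero_L2_abs by (simp only:)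
  then show "u \<in> {u \<in> L_dom \<alpha> k. Op u = 0}"
    using jump_rep_imp_L_dom[OF J u] by simp
qed

text \<open>For real \<open>p\<close> the conjugate of \<open>\<phi>\<close> is again a
  square-integrable solution with value 1 at 0, hence equal to \<open>\<phi>\<close>.\<close>

lemma \<phi>_real:
  assumes "\<And>y. cnj (p y) = p y" "y \<ge> 0"
  shows "cnj (\<phi> y) = \<phi> y"
proof -
  have "primitive_on {0..} (\<lambda>t. cnj (\<phi>1 t)) (\<lambda>t. cnj (p t * \<phi> t))"
    by (rule primitive_on_cnj[OF \<phi>_primitive(2)])
  then have "primitive_on {0..} (\<lambda>t. cnj (\<phi>1 t)) (\<lambda>t. p t * cnj (\<phi> t))"
    by (simp add: assms(1))
  moreover have sq: "(\<lambda>t. cnj (\<phi> t)) square_integrable_on {0..}" "(\<lambda>t. cnj (\<phi>1 t)) square_integrable_on {0..}"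
    by (intro square_integrable_on_cnj \<phi>_square_integrable)+
  ultimately have "H2_rep {0..} (\<lambda>t. cnj (\<phi> t)) (\<lambda>t. cnj (\<phi>1 t)) (\<lambda>t. p t * cnj (\<phi> t))"
    unfolding H2_rep_def using primitive_on_cnj[OF \<phi>_primitive(1)] square_integrable_on_bounded_mult[OF sq(1) p_bound]
    by simp
  from H2_rep_homogeneous(1)[OF this assms(2)] show ?thesis
    by (simp add: initial)
qed

lemma \<phi>_square_integral_pos:
  "(LINT t:{0..}|lborel. (norm (\<phi> t))\<^sup>2) \<noteq> 0"
proof
  assume 0: "(LINT t:{0..}|lborel. (norm (\<phi> t))\<^sup>2) = 0"
  have i: "integrable lborel (\<lambda>t. indicator {0..} t *\<^sub>R (norm (\<phi> t))\<^sup>2)"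
    using \<phi>_square_integrable(1) by (simp add: square_integrable_on_def set_integrable_def)
  have "AE t in lborel. indicator {0..} t *\<^sub>R (norm (\<phi> t))\<^sup>2 = 0"
    using 0 integral_nonneg_eq_0_iff_AE[OF i] by (simp add: set_lebesgue_integral_def)
  then have "AE t\<in>{0<..} in lborel. \<phi> t = 0"
    by (rule eventually_mono) auto
  then show False using \<phi>_not_AE_zero by blast
qed

text \<open>A Jordan chain \<open>Op u = c \<phi>\<close> would force the orthogonality \<open>c \<integral> \<phi>\<^sup>2 = 0\<close>.\<close>

lemma Op_no_jordan_chain:
  assumes ev: "2 * \<phi>1 0 + of_real \<gamma> = 0" and real: "\<And>y. cnj (p y) = p y"
    and u: "u \<in> L_dom \<alpha> k" "Op u \<in> {u \<in> L_dom \<alpha> k. Op u = 0}"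
  shows "Op u = 0"
proof -
  obtain c where c: "Op u = c *\<^sub>C abs_L2 (glue \<phi> \<phi>)"
    using u(2) unfolding Op_kernel[OF ev] L2.span_singleton by auto
  obtain R R1 R2 L L1 L2 where J: "jump_rep \<gamma> R R1 R2 L L1 L2" "AE y in lborel. rep_L2 u y = glue R L y"
    using u(1) by (rule L_dom_imp_jump_rep)
  have sq: "glue (\<lambda>y. p y * R y - R2 y) (\<lambda>y. p y * L y - L2 y) square_integrable_on UNIV"
    using J(1) square_integrable_residual by (auto intro!: glue_square_integrable simp: jump_rep_def)
  have eq: "(\<lambda>y. c * glue \<phi> \<phi> y) = glue (\<lambda>t. c * \<phi> t) (\<lambda>t. c * \<phi> t)"
    by (auto simp: glue_def)
  have sqc: "glue (\<lambda>t. c * \<phi> t) (\<lambda>t. c * \<phi> t) square_integrable_on UNIV"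
    unfolding eq[symmetric] by (rule square_integrable_cmult[OF sq_glue_\<phi>])
  have ae: "AE y in lborel. glue (\<lambda>y. p y * R y - R2 y) (\<lambda>y. p y * L y - L2 y) y = glue (\<lambda>t. c * \<phi> t) (\<lambda>t. c * \<phi> t) y"
    using c unfolding Op_eq[OF J] scaleC_L2_abs[OF sq_glue_\<phi>] eq abs_L2_eq_iff[OF sq sqc] .
  have sqf: "(\<lambda>t. c * \<phi> t) square_integrable_on {0..}"
    by (rule square_integrable_on_cmult[OF \<phi>_square_integrable(1)])
  obtain S S1 where S: "H2_rep {0..} S S1 (\<lambda>y. p y * S y - c * \<phi> y)" "S 0 = 0" "S1 0 = (LINT t:{0..}|lborel. \<phi> t * (c * \<phi> t))"
    using solve_dirichlet[OF sqf] by blast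
  have H: "H2_rep {0..} R R1 R2" "H2_rep {0..} L L1 L2" "R 0 = L 0" "R1 0 + L1 0 = - of_real \<gamma> * R 0"
    using J(1) by (auto simp: jump_rep_def)
  \<comment> \<open>Subtracting the Dirichlet solution \<open>S\<close> for the right-hand side c
    \<phi> leaves a homogeneous solution, so each half has derivative S1 0 plus its own value at 0
    times \<phi>1 0.\<close>
  have hom: "X1 0 = S1 0 + X 0 * \<phi>1 0"
    if X: "H2_rep {0..} X X1 X2" "AE t\<in>{0<..} in lborel. p t * X t - X2 t = c * \<phi> t" for X X1 X2
  proof -
    have "H2_rep {0..} (\<lambda>t. X t - S t) (\<lambda>t. X1 t - S1 t) (\<lambda>t. p t * (X t - S t))"
    proof (rule H2_rep_cong_AE[OF H2_rep_diff[OF X(1) S(1)]])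
      show "AE t\<in>{0..} in lborel. X2 t - (p t * S t - c * \<phi> t) = p t * (X t - S t)"
        using X(2) AE_lborel_singleton[of "0 :: real"]
      proof eventually_elim
        case (elim t)
        have "X2 t - (p t * S t - c * \<phi> t) = p t * (X t - S t)" if "p t * X t - X2 t = c * \<phi> t"
          unfolding that[symmetric] by (simp add: algebra_simps)
        then show ?case using elim by auto
      qed
      have "(\<lambda>t. X t - S t) square_integrable_on {0..}"
        using H2_rep_diff[OF X(1) S(1)] by (simp add: H2_rep_def)
      then have "(\<lambda>t. p t * (X t - S t)) square_integrable_on {0..}"
        using p_bound by (rule square_integrable_on_bounded_mult)
      then show "set_borel_measurable lborel {0..} (\<lambda>t. p t * (X t - S t))"
        by (simp add: square_integrable_on_def)
    qed simp
    from H2_rep_homogeneous(2)[OF this, of 0] show ?thesis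
      by (simp add: S(2) algebra_simps)
  qed
  have "R1 0 = S1 0 + R 0 * \<phi>1 0"
    by (rule hom[OF H(1) AE_glue_eq_imp(1)[OF ae]])
  moreover have "L1 0 = S1 0 + L 0 * \<phi>1 0"
    by (rule hom[OF H(2) AE_glue_eq_imp(2)[OF ae]])
  \<comment> \<open>At a resonance the homogeneous contributions cancel against the jump term, which
    leaves S1 0 = 0, and S1 0 is c times the integral of \<phi>^2.\<close>
  ultimately have "2 * S1 0 + R 0 * (2 * \<phi>1 0 + of_real \<gamma>) = R1 0 + L1 0 + of_real \<gamma> * R 0"
    using H(3) by (simp add: algebra_simps)
  then have S10: "S1 0 = 0"
    using H(4) ev by simp
  have "(LINT t:{0..}|lborel. \<phi> t * (c * \<phi> t)) = (LINT t:{0..}|lborel. c * of_real ((norm (\<phi> t))\<^sup>2))"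
    unfolding set_lebesgue_integral_def
  proof (intro Bochner_Integration.integral_cong refl)
    fix t :: real
    have "\<phi> t * \<phi> t = of_real ((norm (\<phi> t))\<^sup>2)" if "t \<ge> 0"
      using \<phi>_real[OF real that] complex_norm_square[of "\<phi> t"] by simp
    then show "indicator {0..} t *\<^sub>R (\<phi> t * (c * \<phi> t)) = indicator {0..} t *\<^sub>R (c * complex_of_real ((norm (\<phi> t))\<^sup>2))"
      by (cases "t \<ge> 0") (auto simp: mult.left_commute)
  qed
  also have "\<dots> = c * of_real (LINT t:{0..}|lborel. (norm (\<phi> t))\<^sup>2)"
    by (simp only: set_integral_mult_right set_integral_complex_of_real)
  finally have "c = 0"
    using S(3) S10 \<phi>_square_integral_pos by simp
  then show ?thesis using c by simp
qed

theorem simple_eigenvalue_resonance: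
  assumes ev: "2 * \<phi>1 0 + of_real \<gamma> = 0" and real: "\<And>y. cnj (p y) = p y"
  shows "simple_eigenvalue (L_dom \<alpha> k) (L_op b \<beta> k lam) z"
proof -
  have ker: "kernel (L_dom \<alpha> k) (\<lambda>u. Op u) = L2.span {abs_L2 (glue \<phi> \<phi>)}"
    using Op_kernel[OF ev] by (simp add: kernel_def)
  have "L2.dim (kernel (L_dom \<alpha> k) (\<lambda>u. Op u)) = 1"
    unfolding ker L2.dim_span using eigenfunction_ne_0 by (subst L2.dim_eq_card_independent) auto
  then show ?thesis
    unfolding simple_eigenvalue_def kernel_def using Op_no_jordan_chain[OF ev real] by blast
qed

lemma resonance_in_spectrum:
  assumes ev: "2 * \<phi>1 0 + of_real \<gamma> = 0"
  shows "z \<in> spectrum (L_dom \<alpha> k) (L_op b \<beta> k lam)"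
proof -
  have e: "abs_L2 (glue \<phi> \<phi>) \<in> {u \<in> L_dom \<alpha> k. Op u = 0}" "0 \<in> {u \<in> L_dom \<alpha> k. Op u = 0}"
    unfolding Op_kernel[OF ev] using L2.span_base[of "abs_L2 (glue \<phi> \<phi>)"] L2.span_zero by auto
  have "\<not> inj_on (\<lambda>u. Op u) (L_dom \<alpha> k)"
  proof
    assume inj: "inj_on (\<lambda>u. Op u) (L_dom \<alpha> k)"
    have "abs_L2 (glue \<phi> \<phi>) = 0"
      by (rule inj_onD[OF inj]) (use e in auto)
    then show False using eigenfunction_ne_0 by simp
  qed
  then show ?thesis
    by (auto simp: spectrum_def resolvent_set_def bij_betw_def)
qed

text \<open>The form is the integral of |w|^2 over |y| \<ge> b. It could vanish only if
  \<open>\<phi>\<close> were 0 almost everywhere beyond b, hence by continuity everywhere there,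
  against the value at b + 1.\<close>

theorem V0_form_nonzero:
  assumes ev: "2 * \<phi>1 0 + of_real \<gamma> = 0" and b: "b \<ge> 0" "\<phi> (b + 1) \<noteq> 0"
    and w: "L2.span {w} = {u \<in> L_dom \<alpha> k. Op u = 0}"
  shows "cinner_L2 (mult_L2 (V0 b) w) w \<noteq> 0"
proof
  assume 0: "cinner_L2 (mult_L2 (V0 b) w) w = 0"
  have sp: "L2.span {w} = L2.span {abs_L2 (glue \<phi> \<phi>)}"
    using w Op_kernel[OF ev] by simp
  then have "w \<in> L2.span {abs_L2 (glue \<phi> \<phi>)}"
    using L2.span_base[of w "{w}"] by simp
  then obtain c where c: "w = c *\<^sub>C abs_L2 (glue \<phi> \<phi>)"
    unfolding L2.span_singleton by auto
  have "c \<noteq> 0"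
  proof
    assume "c = 0"
    then have "L2.span {w} = {0}" using c by (simp add: L2.span_singleton)
    moreover have "abs_L2 (glue \<phi> \<phi>) \<in> L2.span {w}"
      unfolding sp using L2.span_base[of "abs_L2 (glue \<phi> \<phi>)"] by simp
    ultimately show False using eigenfunction_ne_0 by simp
  qed
  define f where "f = rep_L2 w"
  have fs: "f square_integrable_on UNIV" by (simp add: f_def rep_L2_sq)
  have f: "AE y in lborel. f y = c * glue \<phi> \<phi> y"
    unfolding f_def c scaleC_L2_abs[OF sq_glue_\<phi>]
    by (rule rep_abs_L2[OF square_integrable_cmult[OF sq_glue_\<phi>]])
  have Vf: "(\<lambda>y. of_real (V0 b y) * f y) square_integrable_on UNIV"
    by (rule square_integrable_on_bounded_mult[OF fs, of _ 1]) (auto simp: V0_def indicator_def)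
  have "cinner_L2 (mult_L2 (V0 b) w) w = (LINT y|lborel. of_real (V0 b y) * f y * cnj (f y))"
    using cinner_L2.abs_eq[of "\<lambda>y. of_real (V0 b y) * f y" f] fs Vf
    by (simp add: mult_L2_def L2_rel_def f_def abs_rep_L2)
  also have "\<dots> = of_real (LINT y|lborel. V0 b y * (norm (f y))\<^sup>2)"
    unfolding integral_complex_of_real[symmetric]
    by (intro Bochner_Integration.integral_cong refl) (simp add: complex_norm_square[symmetric] mult.assoc del: of_real_power)
  finally have I0: "(LINT y|lborel. V0 b y * (norm (f y))\<^sup>2) = 0"
    using 0 by simp
  have "integrable lborel (\<lambda>y. V0 b y * (norm (f y))\<^sup>2)"
  proof -
    have "(\<lambda>y. V0 b y * (norm (f y))\<^sup>2) = (\<lambda>y. (norm (of_real (V0 b y) * f y))\<^sup>2)"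
      by (auto simp: V0_def indicator_def norm_mult)
    then show ?thesis
      using Vf by (simp add: square_integrable_on_UNIV_iff)
  qed
  then have "AE y in lborel. V0 b y * (norm (f y))\<^sup>2 = 0"
    using I0 integral_nonneg_eq_0_iff_AE[of lborel "\<lambda>y. V0 b y * (norm (f y))\<^sup>2"]
    by (auto simp: V0_def)
  then have "AE t\<in>{b<..} in lborel. \<phi> t = 0"
    using f
  proof eventually_elim
    case (elim y)
    then show ?case
      using b(1) \<open>c \<noteq> 0\<close> by (auto simp: V0_def glue_def)
  qed
  then show False
    using \<phi>_zero_on_ray[of b "b + 1"] b by simp
qed

end

section \<open>Explicit solutions for the piecewise constant potential\<close>

text \<open>Together with \<open>ss\<close> the fundamental system of u'' = w^2 u at 0. Both are
  even in \<open>w\<close>, so the choice of root is immaterial, and the case w = 0 of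
  \<open>ss\<close> is the limit; imaginary, real and zero \<open>w\<close> cover the three cases of
  \<beta>.\<close>

definition cc :: "complex \<Rightarrow> real \<Rightarrow> complex"
  where "cc w y = cosh (w * of_real y)"

definition ss :: "complex \<Rightarrow> real \<Rightarrow> complex"
  where "ss w y = (if w = 0 then of_real y else sinh (w * of_real y) / w)"

lemma cc_0 [simp]: "cc w 0 = 1" and ss_0 [simp]: "ss w 0 = 0"
  by (simp_all add: cc_def ss_def)

lemma cc_minus [simp]: "cc w (- y) = cc w y" and ss_minus [simp]: "ss w (- y) = - ss w y"
  by (simp_all add: cc_def ss_def)

lemma cc_deriv: "(cc w has_vector_derivative w\<^sup>2 * ss w y) (at y)"
proof -
  have "((\<lambda>x. cosh (w * x)) has_field_derivative sinh (w * of_real y) * w) (at (of_real y))"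
    by (auto intro!: derivative_eq_intros)
  then have "((\<lambda>y. cosh (w * of_real y)) has_vector_derivative sinh (w * of_real y) * w) (at y)"
    by (rule has_vector_derivative_real_field)
  then show ?thesis
    by (simp add: cc_def[abs_def] ss_def power2_eq_square mult.commute split: if_splits)
qed

lemma ss_deriv: "(ss w has_vector_derivative cc w y) (at y)"
proof (cases "w = 0")
  case True
  have "((\<lambda>y. of_real y :: complex) has_vector_derivative of_real 1) (at y)"
    by (rule has_vector_derivative_of_real) (simp flip: has_real_derivative_iff_has_vector_derivative)
  then show ?thesis
    using True by (simp add: cc_def ss_def[abs_def])
next
  case False
  have "((\<lambda>x. sinh (w * x) / w) has_field_derivative cosh (w * of_real y)) (at (of_real y))"
    using False by (auto intro!: derivative_eq_intros)
  then have "((\<lambda>y. sinh (w * of_real y) / w) has_vector_derivative cosh (w * of_real y)) (at y)"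
    by (rule has_vector_derivative_real_field)
  then show ?thesis
    using False by (simp add: cc_def ss_def[abs_def])
qed

lemma has_vector_derivative_shift:
  fixes f :: "real \<Rightarrow> complex"
  assumes "(f has_vector_derivative f') (at (y - b))"
  shows "((\<lambda>y. f (y - b)) has_vector_derivative f') (at y)"
proof -
  have "((\<lambda>y. y - b) has_vector_derivative 1) (at y)"
    by (auto simp flip: has_real_derivative_iff_has_vector_derivative intro!: derivative_eq_intros)
  from vector_diff_chain_at[OF this assms] show ?thesis
    by (simp add: o_def)
qed

definition join :: "real \<Rightarrow> (real \<Rightarrow> complex) \<Rightarrow> (real \<Rightarrow> complex) \<Rightarrow> real \<Rightarrow> complex"
  where "join b f g y = (if y \<le> b then f y else g (y - b))"

lemma has_vector_derivative_continuous_on: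
  "(\<And>y. (f has_vector_derivative f' y) (at y)) \<Longrightarrow> continuous_on A f"
  by (meson continuous_at_imp_continuous_on has_vector_derivative_continuous)

lemma continuous_on_join:
  assumes "continuous_on UNIV f" "continuous_on UNIV g" "f b = g 0"
  shows "continuous_on A (join b f g)"
proof -
  have "continuous_on ({..b} \<union> {b..}) (join b f g)"
  proof (rule continuous_on_closed_Un)
    show "continuous_on {..b} (join b f g)"
      by (rule continuous_on_eq[OF continuous_on_subset[OF assms(1)]]) (auto simp: join_def)
    have "continuous_on {b..} (\<lambda>y. g (y - b))"
      by (rule continuous_on_compose2[OF assms(2)]) (auto intro!: continuous_intros)
    then show "continuous_on {b..} (join b f g)"
      by (rule continuous_on_eq) (use assms(3) in \<open>auto simp: join_def\<close>)
  qed auto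
  then show ?thesis
    by (rule continuous_on_subset) auto
qed

lemma join_deriv:
  assumes f: "\<And>y. (f has_vector_derivative f1 y) (at y)" and g: "\<And>y. (g has_vector_derivative g1 y) (at y)"
    and t: "t \<noteq> b"
  shows "(join b f g has_vector_derivative join b f1 g1 t) (at t)"
proof (cases "t < b")
  case True
  have "(f has_vector_derivative join b f1 g1 t) (at t)"
    using f[of t] True by (simp add: join_def)
  then show ?thesis
    by (rule has_vector_derivative_transform_within_open[of _ _ _ "{..<b}"]) (use True in \<open>auto simp: join_def\<close>)
next
  case False
  have "((\<lambda>y. g (y - b)) has_vector_derivative join b f1 g1 t) (at t)"
    using has_vector_derivative_shift[OF g[of "t - b"]] False t by (simp add: join_def)
  then show ?thesis
    by (rule has_vector_derivative_transform_within_open[of _ _ _ "{b<..}"]) (use False t in \<open>auto simp: join_def\<close>)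
qed

definition step_pot :: "real \<Rightarrow> complex \<Rightarrow> complex \<Rightarrow> real \<Rightarrow> complex"
  where "step_pot b P Q y = (if \<bar>y\<bar> < b then P else Q)"

lemma step_pot_measurable [measurable]: "step_pot b P Q \<in> borel_measurable borel"
  unfolding step_pot_def by measurable

lemma step_pot_bound: "norm (step_pot b P Q y) \<le> norm P + norm Q"
  by (simp add: step_pot_def)

text \<open>Value and derivative match at b, so only the second derivative jumps, at the one point
  excluded from differentiation.\<close>

lemma join_solution:
  assumes f: "\<And>y. (f has_vector_derivative f1 y) (at y)" "\<And>y. (f1 has_vector_derivative P * f y) (at y)"
    and g: "\<And>y. (g has_vector_derivative g1 y) (at y)" "\<And>y. (g1 has_vector_derivative Q * g y) (at y)"
    and match: "f b = g 0" "f1 b = g1 0"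
  shows "primitive_on {0..} (join b f g) (join b f1 g1)"
    and "primitive_on {0..} (join b f1 g1) (\<lambda>y. step_pot b P Q y * join b f g y)"
proof -
  have c: "continuous_on A (join b f g)" "continuous_on A (join b f1 g1)" for A
    by (intro continuous_on_join has_vector_derivative_continuous_on[OF f(1)] has_vector_derivative_continuous_on[OF f(2)]
      has_vector_derivative_continuous_on[OF g(1)] has_vector_derivative_continuous_on[OF g(2)] match)+
  show "primitive_on {0..} (join b f g) (join b f1 g1)"
    by (rule primitive_on_derivative[where N = "{b}"])
      (auto intro!: c join_deriv f g borel_integrable_atLeastAtMost')
  show "primitive_on {0..} (join b f1 g1) (\<lambda>y. step_pot b P Q y * join b f g y)"
  proof (rule primitive_on_derivative[where N = "{b}"])
    fix t assume t: "t \<in> {0..}" "t \<notin> {b}"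
    have "(join b f1 g1 has_vector_derivative join b (\<lambda>y. P * f y) (\<lambda>y. Q * g y) t) (at t)"
      using t by (intro join_deriv f g) auto
    moreover have "join b (\<lambda>y. P * f y) (\<lambda>y. Q * g y) t = step_pot b P Q t * join b f g t"
      using t by (auto simp: join_def step_pot_def)
    ultimately show "(join b f1 g1 has_vector_derivative step_pot b P Q t * join b f g t) (at t)"
      by simp
  next
    fix x y :: real
    have "join b f g square_integrable_on {x..y}"
      unfolding square_integrable_on_def
      by (intro conjI continuous_on_set_borel_measurable borel_integrable_atLeastAtMost' continuous_intros c) auto
    then have "(\<lambda>t. step_pot b P Q t * join b f g t) square_integrable_on {x..y}"
      by (rule square_integrable_on_bounded_mult) (auto intro: step_pot_bound)
    then show "set_integrable lborel {x..y} (\<lambda>t. step_pot b P Q t * join b f g t)"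
      using square_integrable_imp_locally_integrable unfolding locally_integrable_on_def by blast
  qed (auto intro!: c)
qed

text \<open>The rate \<open>r\<close> may have either sign, as decaying and growing solutions both
  need the bound. On [0, b] compactness gives a constant, and exp (|r| b) compensates the possible
  smallness of exp (r y).\<close>

lemma join_exp_bound:
  assumes "continuous_on UNIV f" and g: "\<And>t. t \<ge> 0 \<Longrightarrow> norm (g t) \<le> C * exp (r * t)" and b: "b > 0"
  obtains M where "\<And>y. y \<ge> 0 \<Longrightarrow> norm (join b f g y) \<le> M * exp (r * y)"
proof -
  have "bounded (f ` {0..b})"
    by (intro compact_imp_bounded compact_continuous_image continuous_on_subset[OF assms(1)]) auto
  then obtain K where K: "\<And>y. y \<in> {0..b} \<Longrightarrow> norm (f y) \<le> K"
    unfolding bounded_iff by (metis imageI)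
  have K0: "K \<ge> 0" using K[of 0] b norm_ge_zero[of "f 0"] by simp (meson order_trans norm_ge_zero)
  have C0: "C \<ge> 0" using g[of 0] by simp (meson order_trans norm_ge_zero)
  have "norm (join b f g y) \<le> (K * exp (\<bar>r\<bar> * b) + C * exp (- r * b)) * exp (r * y)" if y: "y \<ge> 0" for y
  proof (cases "y \<le> b")
    case True
    have "- (r * y) \<le> \<bar>r\<bar> * y"
      using mult_right_mono[OF abs_ge_minus_self[of r] y] by simp
    also have "\<dots> \<le> \<bar>r\<bar> * b"
      using True by (intro mult_left_mono) auto
    finally have "1 \<le> exp (\<bar>r\<bar> * b) * exp (r * y)"
      by (simp flip: exp_add)
    then have "K * 1 \<le> K * (exp (\<bar>r\<bar> * b) * exp (r * y))"
      by (rule mult_left_mono[OF _ K0])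
    moreover have "0 \<le> C * exp (- r * b) * exp (r * y)"
      using C0 by simp
    ultimately show ?thesis
      using K[of y] True y by (simp add: join_def algebra_simps)
  next
    case False
    have "norm (join b f g y) \<le> C * exp (r * (y - b))"
      using g[of "y - b"] False by (simp add: join_def)
    also have "\<dots> = C * exp (- r * b) * exp (r * y)"
      by (simp add: exp_add[symmetric] algebra_simps)
    also have "\<dots> \<le> (K * exp (\<bar>r\<bar> * b) + C * exp (- r * b)) * exp (r * y)"
      using K0 by (intro mult_right_mono) auto
    finally show ?thesis .
  qed
  then show ?thesis by (rule that)
qed

lemma norm_cosh_sinh_le:
  assumes "Re \<kappa> \<ge> 0" "t \<ge> 0"
  shows "norm (cosh (\<kappa> * of_real t)) \<le> exp (Re \<kappa> * t)" "norm (sinh (\<kappa> * of_real t)) \<le> exp (Re \<kappa> * t)"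
proof -
  have e: "norm (exp (\<kappa> * of_real t)) = exp (Re \<kappa> * t)" "norm (exp (- (\<kappa> * of_real t))) \<le> exp (Re \<kappa> * t)"
    using mult_nonneg_nonneg[OF assms] by (simp_all add: norm_exp_eq_Re)
  have "norm (exp (\<kappa> * of_real t) + exp (- (\<kappa> * of_real t))) \<le> 2 * exp (Re \<kappa> * t)"
    using norm_triangle_ineq[of "exp (\<kappa> * of_real t)" "exp (- (\<kappa> * of_real t))"] e by linarith
  then show "norm (cosh (\<kappa> * of_real t)) \<le> exp (Re \<kappa> * t)"
    by (simp add: cosh_field_def norm_divide)
  have "norm (exp (\<kappa> * of_real t) - exp (- (\<kappa> * of_real t))) \<le> 2 * exp (Re \<kappa> * t)"
    using norm_triangle_ineq4[of "exp (\<kappa> * of_real t)" "exp (- (\<kappa> * of_real t))"] e by linarith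
  then show "norm (sinh (\<kappa> * of_real t)) \<le> exp (Re \<kappa> * t)"
    by (simp add: sinh_field_def norm_divide)
qed

text \<open>The solution that equals \<open>exp (- \<kappa> (y - b))\<close> for \<open>y \<ge> b\<close> has value \<open>EE\<close> and
  derivative \<open>- NN\<close> at \<open>0\<close>.\<close>

definition EE :: "complex \<Rightarrow> complex \<Rightarrow> real \<Rightarrow> complex"
  where "EE w \<kappa> b = cc w b + \<kappa> * ss w b"

definition NN :: "complex \<Rightarrow> complex \<Rightarrow> real \<Rightarrow> complex"
  where "NN w \<kappa> b = w\<^sup>2 * ss w b + \<kappa> * cc w b"

text \<open>On [0, b] the backward continuation of the outer exponential with matching data at b;
  division by \<open>EE\<close> normalises the value at 0 to 1.\<close>

definition decaying :: "complex \<Rightarrow> complex \<Rightarrow> real \<Rightarrow> real \<Rightarrow> complex"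
  where "decaying w \<kappa> b = join b (\<lambda>y. (cc w (y - b) - \<kappa> * ss w (y - b)) / EE w \<kappa> b) (\<lambda>t. exp (- \<kappa> * of_real t) / EE w \<kappa> b)"

definition decaying1 :: "complex \<Rightarrow> complex \<Rightarrow> real \<Rightarrow> real \<Rightarrow> complex"
  where "decaying1 w \<kappa> b = join b (\<lambda>y. (w\<^sup>2 * ss w (y - b) - \<kappa> * cc w (y - b)) / EE w \<kappa> b) (\<lambda>t. - \<kappa> * exp (- \<kappa> * of_real t) / EE w \<kappa> b)"

definition dirichlet :: "complex \<Rightarrow> complex \<Rightarrow> real \<Rightarrow> real \<Rightarrow> complex"
  where "dirichlet w \<kappa> b = join b (ss w) (\<lambda>t. ss w b * cosh (\<kappa> * of_real t) + cc w b * sinh (\<kappa> * of_real t) / \<kappa>)"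

definition dirichlet1 :: "complex \<Rightarrow> complex \<Rightarrow> real \<Rightarrow> real \<Rightarrow> complex"
  where "dirichlet1 w \<kappa> b = join b (cc w) (\<lambda>t. ss w b * \<kappa> * sinh (\<kappa> * of_real t) + cc w b * cosh (\<kappa> * of_real t))"

lemma half_line_step:
  assumes b: "b > 0" and \<kappa>: "Re \<kappa> > 0" and E: "EE w \<kappa> b \<noteq> 0"
  obtains M where "half_line (step_pot b (w\<^sup>2) (\<kappa>\<^sup>2)) (decaying w \<kappa> b) (decaying1 w \<kappa> b)
    (dirichlet w \<kappa> b) (dirichlet1 w \<kappa> b) (Re \<kappa>) M (norm (w\<^sup>2) + norm (\<kappa>\<^sup>2))"
proof -
  have \<kappa>0: "\<kappa> \<noteq> 0" using \<kappa> by auto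
  define f f1 where "f y = (cc w (y - b) - \<kappa> * ss w (y - b)) / EE w \<kappa> b"
    and "f1 y = (w\<^sup>2 * ss w (y - b) - \<kappa> * cc w (y - b)) / EE w \<kappa> b" for y
  define g g1 where "g t = exp (- \<kappa> * of_real t) / EE w \<kappa> b"
    and "g1 t = - \<kappa> * exp (- \<kappa> * of_real t) / EE w \<kappa> b" for t
  define h h1 where "h t = ss w b * cosh (\<kappa> * of_real t) + cc w b * sinh (\<kappa> * of_real t) / \<kappa>"
    and "h1 t = ss w b * \<kappa> * sinh (\<kappa> * of_real t) + cc w b * cosh (\<kappa> * of_real t)" for t
  note sh = has_vector_derivative_shift[OF cc_deriv] has_vector_derivative_shift[OF ss_deriv]
  have f: "(f has_vector_derivative f1 y) (at y)" for y
    unfolding f_def f1_def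
    by (intro has_vector_derivative_divide has_vector_derivative_diff has_vector_derivative_mult_right sh)
  have f': "(f1 has_vector_derivative w\<^sup>2 * f y) (at y)" for y
  proof -
    have "(f1 has_vector_derivative (w\<^sup>2 * cc w (y - b) - \<kappa> * (w\<^sup>2 * ss w (y - b))) / EE w \<kappa> b) (at y)"
      unfolding f1_def
      by (intro has_vector_derivative_divide has_vector_derivative_diff has_vector_derivative_mult_right sh)
    then show ?thesis by (simp add: f_def algebra_simps)
  qed
  have g: "(g has_vector_derivative g1 t) (at t)" for t
    unfolding g_def g1_def
    by (rule has_vector_derivative_real_field) (use E in \<open>auto intro!: derivative_eq_intros\<close>)
  have g': "(g1 has_vector_derivative \<kappa>\<^sup>2 * g t) (at t)" for t
    unfolding g_def g1_def
    by (rule has_vector_derivative_real_field) (use E in \<open>auto intro!: derivative_eq_intros simp: power2_eq_square\<close>)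
  have h: "(h has_vector_derivative h1 t) (at t)" for t
    unfolding h_def h1_def
    by (rule has_vector_derivative_real_field) (use \<kappa>0 in \<open>auto intro!: derivative_eq_intros simp: mult_ac\<close>)
  have h': "(h1 has_vector_derivative \<kappa>\<^sup>2 * h t) (at t)" for t
    unfolding h_def h1_def
    by (rule has_vector_derivative_real_field) (use \<kappa>0 in \<open>auto intro!: derivative_eq_intros simp: power2_eq_square algebra_simps\<close>)
  have eq: "decaying w \<kappa> b = join b f g" "decaying1 w \<kappa> b = join b f1 g1"
    "dirichlet w \<kappa> b = join b (ss w) h" "dirichlet1 w \<kappa> b = join b (cc w) h1"
    unfolding decaying_def decaying1_def dirichlet_def dirichlet1_def f_def f1_def g_def g1_def h_def h1_def by auto
  have m: "f b = g 0" "f1 b = g1 0" "ss w b = h 0" "cc w b = h1 0"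
    by (simp_all add: f_def f1_def g_def g1_def h_def h1_def)
  note sol\<phi> = join_solution[OF f f' g g' m(1,2)]
  note sol\<psi> = join_solution[OF ss_deriv cc_deriv h h' m(3,4)]
  have gb: "norm (g t) \<le> (1 / norm (EE w \<kappa> b)) * exp (- Re \<kappa> * t)" for t
    by (simp add: g_def norm_divide norm_exp_eq_Re)
  have g1b: "norm (g1 t) \<le> (norm \<kappa> / norm (EE w \<kappa> b)) * exp (- Re \<kappa> * t)" for t
    by (simp add: g1_def norm_divide norm_mult norm_exp_eq_Re)
  have hb: "norm (h t) \<le> (norm (ss w b) + norm (cc w b) / norm \<kappa>) * exp (Re \<kappa> * t)" if "t \<ge> 0" for t
  proof -
    have "norm (h t) \<le> norm (ss w b) * norm (cosh (\<kappa> * of_real t)) + norm (cc w b) / norm \<kappa> * norm (sinh (\<kappa> * of_real t))"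
      unfolding h_def by (rule order_trans[OF norm_triangle_ineq]) (simp add: norm_mult norm_divide)
    also have "\<dots> \<le> norm (ss w b) * exp (Re \<kappa> * t) + norm (cc w b) / norm \<kappa> * exp (Re \<kappa> * t)"
      using \<kappa> that by (intro add_mono mult_left_mono norm_cosh_sinh_le) auto
    finally show ?thesis by (simp only: distrib_right)
  qed
  have h1b: "norm (h1 t) \<le> (norm (ss w b) * norm \<kappa> + norm (cc w b)) * exp (Re \<kappa> * t)" if "t \<ge> 0" for t
  proof -
    have "norm (h1 t) \<le> norm (ss w b) * norm \<kappa> * norm (sinh (\<kappa> * of_real t)) + norm (cc w b) * norm (cosh (\<kappa> * of_real t))"
      unfolding h1_def by (rule order_trans[OF norm_triangle_ineq]) (simp add: norm_mult)
    also have "\<dots> \<le> norm (ss w b) * norm \<kappa> * exp (Re \<kappa> * t) + norm (cc w b) * exp (Re \<kappa> * t)"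
      using \<kappa> that by (intro add_mono mult_left_mono norm_cosh_sinh_le) auto
    finally show ?thesis by (simp only: distrib_right)
  qed
  note co = has_vector_derivative_continuous_on
  obtain M1 where M1: "\<And>y. y \<ge> 0 \<Longrightarrow> norm (join b f g y) \<le> M1 * exp (- Re \<kappa> * y)"
    using join_exp_bound[OF co[OF f] gb b] by blast
  obtain M2 where M2: "\<And>y. y \<ge> 0 \<Longrightarrow> norm (join b f1 g1 y) \<le> M2 * exp (- Re \<kappa> * y)"
    using join_exp_bound[OF co[OF f'] g1b b] by blast
  obtain M3 where M3: "\<And>y. y \<ge> 0 \<Longrightarrow> norm (join b (ss w) h y) \<le> M3 * exp (Re \<kappa> * y)"
    using join_exp_bound[OF co[OF ss_deriv] hb b] by blast
  obtain M4 where M4: "\<And>y. y \<ge> 0 \<Longrightarrow> norm (join b (cc w) h1 y) \<le> M4 * exp (Re \<kappa> * y)"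
    using join_exp_bound[OF co[OF cc_deriv] h1b b] by blast
  define M where "M = max (max M1 M2) (max M3 M4)"
  have M: "M1 * exp r \<le> M * exp r" "M2 * exp r \<le> M * exp r" "M3 * exp r \<le> M * exp r" "M4 * exp r \<le> M * exp r" for r
    by (auto simp: M_def intro!: mult_right_mono)
  have "half_line (step_pot b (w\<^sup>2) (\<kappa>\<^sup>2)) (decaying w \<kappa> b) (decaying1 w \<kappa> b)
    (dirichlet w \<kappa> b) (dirichlet1 w \<kappa> b) (Re \<kappa>) M (norm (w\<^sup>2) + norm (\<kappa>\<^sup>2))"
    unfolding eq
  proof
    show "join b f g 0 = 1"
      using b E by (simp add: join_def f_def EE_def[symmetric])
    show "join b (ss w) h 0 = 0" "join b (cc w) h1 0 = 1"
      using b by (simp_all add: join_def)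
    show "norm (join b f g y) \<le> M * exp (- Re \<kappa> * y)" if "y \<ge> 0" for y
      by (rule order_trans[OF M1[OF that] M(1)])
    show "norm (join b f1 g1 y) \<le> M * exp (- Re \<kappa> * y)" if "y \<ge> 0" for y
      by (rule order_trans[OF M2[OF that] M(2)])
    show "norm (join b (ss w) h y) \<le> M * exp (Re \<kappa> * y)" if "y \<ge> 0" for y
      by (rule order_trans[OF M3[OF that] M(3)])
    show "norm (join b (cc w) h1 y) \<le> M * exp (Re \<kappa> * y)" if "y \<ge> 0" for y
      by (rule order_trans[OF M4[OF that] M(4)])
    show "Re \<kappa> > 0" by (rule \<kappa>)
    show "step_pot b (w\<^sup>2) (\<kappa>\<^sup>2) \<in> borel_measurable borel" by measurable
    show "norm (step_pot b (w\<^sup>2) (\<kappa>\<^sup>2) y) \<le> norm (w\<^sup>2) + norm (\<kappa>\<^sup>2)" for y by (rule step_pot_bound)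
  qed (fact sol\<phi> sol\<psi>)+
  then show ?thesis by (rule that)
qed

lemma decaying1_0: "b > 0 \<Longrightarrow> decaying1 w \<kappa> b 0 = - NN w \<kappa> b / EE w \<kappa> b"
proof -
  have "w\<^sup>2 * - ss w b - \<kappa> * cc w b = - NN w \<kappa> b"
    by (simp add: NN_def)
  then show "b > 0 \<Longrightarrow> decaying1 w \<kappa> b 0 = - NN w \<kappa> b / EE w \<kappa> b"
    by (simp add: decaying1_def join_def)
qed

lemma schroedinger_step:
  assumes b: "b > 0" and \<kappa>: "Re \<kappa> > 0" and E: "EE w \<kappa> b \<noteq> 0"
    and w: "w\<^sup>2 = of_real ((real k)\<^sup>2 * (1 - \<beta>)) - z" "\<kappa>\<^sup>2 = of_real ((real k)\<^sup>2 * (1 - lam)) - z"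
  obtains M where "schroedinger (step_pot b (w\<^sup>2) (\<kappa>\<^sup>2)) (decaying w \<kappa> b) (decaying1 w \<kappa> b)
    (dirichlet w \<kappa> b) (dirichlet1 w \<kappa> b) (Re \<kappa>) M (norm (w\<^sup>2) + norm (\<kappa>\<^sup>2)) b \<beta> lam k z"
proof -
  obtain M where M: "half_line (step_pot b (w\<^sup>2) (\<kappa>\<^sup>2)) (decaying w \<kappa> b) (decaying1 w \<kappa> b)
    (dirichlet w \<kappa> b) (dirichlet1 w \<kappa> b) (Re \<kappa>) M (norm (w\<^sup>2) + norm (\<kappa>\<^sup>2))"
    using half_line_step[OF b \<kappa> E] .
  have "step_pot b (w\<^sup>2) (\<kappa>\<^sup>2) = (\<lambda>y. of_real (pot b \<beta> k lam y) - z)"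
    unfolding w by (auto simp: step_pot_def pot_eq fun_eq_iff)
  then have "schroedinger (step_pot b (w\<^sup>2) (\<kappa>\<^sup>2)) (decaying w \<kappa> b) (decaying1 w \<kappa> b)
    (dirichlet w \<kappa> b) (dirichlet1 w \<kappa> b) (Re \<kappa>) M (norm (w\<^sup>2) + norm (\<kappa>\<^sup>2)) b \<beta> lam k z"
    using M by (intro schroedinger.intro schroedinger_axioms.intro)
  then show ?thesis by (rule that)
qed

theorem step_resolvent:
  assumes "b > 0" "Re \<kappa> > 0" "EE w \<kappa> b \<noteq> 0"
    and "w\<^sup>2 = of_real ((real k)\<^sup>2 * (1 - \<beta>)) - z" "\<kappa>\<^sup>2 = of_real ((real k)\<^sup>2 * (1 - lam)) - z"
    and ne: "2 * NN w \<kappa> b \<noteq> of_real ((real k)\<^sup>2 * \<alpha>) * EE w \<kappa> b"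
  shows "z \<in> resolvent_set (L_dom \<alpha> k) (L_op b \<beta> k lam)"
proof -
  obtain M where "schroedinger (step_pot b (w\<^sup>2) (\<kappa>\<^sup>2)) (decaying w \<kappa> b) (decaying1 w \<kappa> b)
    (dirichlet w \<kappa> b) (dirichlet1 w \<kappa> b) (Re \<kappa>) M (norm (w\<^sup>2) + norm (\<kappa>\<^sup>2)) b \<beta> lam k z"
    using schroedinger_step[OF assms(1-5)] .
  then interpret schroedinger "step_pot b (w\<^sup>2) (\<kappa>\<^sup>2)" "decaying w \<kappa> b" "decaying1 w \<kappa> b"
    "dirichlet w \<kappa> b" "dirichlet1 w \<kappa> b" "Re \<kappa>" M "norm (w\<^sup>2) + norm (\<kappa>\<^sup>2)" b \<beta> lam \<alpha> k z .
  show ?thesis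
  proof (rule resolvent)
    show "2 * decaying1 w \<kappa> b 0 + of_real ((real k)\<^sup>2 * \<alpha>) \<noteq> 0"
      using ne assms(3) unfolding decaying1_0[OF assms(1)]
      by (simp add: field_simps)
  qed
qed

section \<open>Zeros of the characteristic functions are isolated\<close>

text \<open>Here u'' = w^2 u, u 0 = 1, u' 0 = \<kappa> and v = u'; this is the unnormalised decaying
  solution read from b towards 0. In the derivative of v times the conjugate of u the term |v|^2 is
  real and drops out of the imaginary part.\<close>

lemma interior_energy:
  fixes w \<kappa> :: complex
  defines "u \<equiv> \<lambda>t. cc w t + \<kappa> * ss w t" and "v \<equiv> \<lambda>t. w\<^sup>2 * ss w t + \<kappa> * cc w t"
  shows "((\<lambda>t. Im (v t * cnj (u t))) has_real_derivative Im (w\<^sup>2) * (norm (u t))\<^sup>2) (at t)"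
proof -
  have u: "(u has_vector_derivative v t) (at t)"
  proof -
    have "(u has_vector_derivative (w\<^sup>2 * ss w t + \<kappa> * cc w t)) (at t)"
      unfolding u_def by (intro has_vector_derivative_add has_vector_derivative_mult_right cc_deriv ss_deriv)
    then show ?thesis by (simp add: v_def)
  qed
  have v: "(v has_vector_derivative w\<^sup>2 * u t) (at t)"
  proof -
    have "(v has_vector_derivative (w\<^sup>2 * cc w t + \<kappa> * (w\<^sup>2 * ss w t))) (at t)"
      unfolding v_def by (intro has_vector_derivative_add has_vector_derivative_mult_right cc_deriv ss_deriv)
    then show ?thesis by (simp add: u_def algebra_simps)
  qed
  have "((\<lambda>t. v t * cnj (u t)) has_vector_derivative v t * cnj (v t) + w\<^sup>2 * u t * cnj (u t)) (at t)"
    by (intro has_vector_derivative_mult v has_vector_derivative_cnj u)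
  then have "((\<lambda>t. Im (v t * cnj (u t))) has_vector_derivative Im (v t * cnj (v t) + w\<^sup>2 * u t * cnj (u t))) (at t)"
    by (rule bounded_linear.has_vector_derivative[OF bounded_linear_Im])
  moreover have "Im (v t * cnj (v t) + w\<^sup>2 * u t * cnj (u t)) = Im (w\<^sup>2) * (norm (u t))\<^sup>2"
    by (simp add: mult.assoc complex_norm_square[symmetric] del: of_real_power)
  ultimately show ?thesis
    by (simp add: has_real_derivative_iff_has_vector_derivative)
qed

text \<open>The imaginary part starts at t = 0 with Im \<kappa>, which has the sign of Im (w^2)
  because 2 Re \<kappa> Im \<kappa> = Im (\<kappa>^2), and then moves monotonically in that same
  direction. So \<open>EE\<close> is not 0 and \<open>NN / EE\<close> is not real: a hands-on
  substitute for self-adjointness at non-real spectral parameters.\<close>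

lemma Im_NN_EE_nonzero:
  assumes b: "b > 0" and \<kappa>: "Re \<kappa> > 0" and Im: "Im (\<kappa>\<^sup>2) = Im (w\<^sup>2)" "Im (w\<^sup>2) \<noteq> 0"
  shows "Im (NN w \<kappa> b * cnj (EE w \<kappa> b)) \<noteq> 0"
proof -
  define G where "G t = Im ((w\<^sup>2 * ss w t + \<kappa> * cc w t) * cnj (cc w t + \<kappa> * ss w t))" for t
  have D: "(G has_real_derivative Im (w\<^sup>2) * (norm (cc w t + \<kappa> * ss w t))\<^sup>2) (at t)" for t
    unfolding G_def by (rule interior_energy)
  have G0: "G 0 = Im \<kappa>" by (simp add: G_def)
  have Im\<kappa>: "2 * Re \<kappa> * Im \<kappa> = Im (w\<^sup>2)"
    unfolding Im(1)[symmetric] by (simp add: power2_eq_square)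
  have Gb: "Im (NN w \<kappa> b * cnj (EE w \<kappa> b)) = G b"
    by (simp only: G_def NN_def EE_def)
  show ?thesis
  proof (cases "Im (w\<^sup>2) > 0")
    case True
    have "G 0 \<le> G b"
      by (rule DERIV_nonneg_imp_nondecreasing) (use b D True in \<open>auto intro!: exI mult_nonneg_nonneg\<close>)
    moreover have "Im \<kappa> > 0"
      using Im\<kappa> True \<kappa> by (metis mult_pos_pos zero_less_mult_pos zero_less_numeral)
    ultimately show ?thesis using G0 Gb by simp
  next
    case False
    then have neg: "Im (w\<^sup>2) < 0" using Im(2) by simp
    have "G b \<le> G 0"
      by (rule DERIV_nonpos_imp_nonincreasing) (use b D neg in \<open>auto intro!: exI mult_nonpos_nonneg\<close>)
    moreover have "Im \<kappa> < 0"
      using Im\<kappa> neg \<kappa> by (metis mult_nonneg_nonneg not_less less_imp_le zero_le_numeral)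
    ultimately show ?thesis using G0 Gb by simp
  qed
qed

lemma Re_csqrt_pos: "Re z > 0 \<Longrightarrow> Re (csqrt z) > 0"
proof -
  assume z: "Re z > 0"
  have "Re ((csqrt z)\<^sup>2) > 0" using z by simp
  then have "(Re (csqrt z))\<^sup>2 > (Im (csqrt z))\<^sup>2"
    by (simp add: power2_eq_square del: csqrt.sel)
  then have "Re (csqrt z) \<noteq> 0"
    by (metis not_less power_zero_numeral zero_le_power2)
  moreover have "Re (csqrt z) \<ge> 0"
    using csqrt_principal[of z] by linarith
  ultimately show ?thesis by simp
qed

text \<open>With z = P - w^2 both characteristic functions become holomorphic near a root
  \<open>w0\<close> of P, even if P = 0. They are not identically zero since they do not vanish
  where w^2 is non-real, so their zeros are isolated.\<close>

lemma characteristic_zeros_isolated: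
  fixes P \<kappa>0 \<gamma> b :: real
  assumes b: "b > 0" and \<kappa>0: "\<kappa>0 > 0"
  obtains \<delta> where "\<delta> > 0" "\<And>z. z \<noteq> 0 \<Longrightarrow> norm z < \<delta> \<Longrightarrow> \<exists>w \<kappa>. Re \<kappa> > 0 \<and> w\<^sup>2 = of_real P - z \<and>
    \<kappa>\<^sup>2 = of_real (\<kappa>0\<^sup>2) - z \<and> EE w \<kappa> b \<noteq> 0 \<and> 2 * NN w \<kappa> b \<noteq> of_real \<gamma> * EE w \<kappa> b"
proof -
  \<comment> \<open>The difference of the two constants, so that \<kappa>^2 = w^2 + c; near
    \<open>w0\<close> the right-hand side has positive real part, where the principal root is
    holomorphic.\<close>
  define c where "c = complex_of_real (\<kappa>0\<^sup>2 - P)"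
  define w0 where "w0 = csqrt (of_real P)"
  have w0: "w0\<^sup>2 = of_real P" by (simp add: w0_def)
  have "((\<lambda>w. Re (w\<^sup>2 + c)) \<longlongrightarrow> Re (w0\<^sup>2 + c)) (at w0)"
    by (intro tendsto_intros)
  moreover have "Re (w0\<^sup>2 + c) > 0"
    using \<kappa>0 by (simp add: w0 c_def)
  ultimately have "\<forall>\<^sub>F w in at w0. Re (w\<^sup>2 + c) > 0"
    by (rule order_tendstoD(1))
  then obtain r where r: "r > 0" "\<And>w. w \<noteq> w0 \<Longrightarrow> dist w w0 < r \<Longrightarrow> Re (w\<^sup>2 + c) > 0"
    unfolding eventually_at by auto
  have pos: "Re (w\<^sup>2 + c) > 0" if "w \<in> ball w0 r" for w
    using r(2)[of w] that \<open>Re (w0\<^sup>2 + c) > 0\<close> by (cases "w = w0") (auto simp: dist_commute)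
  define \<kappa> where "\<kappa> w = csqrt (w\<^sup>2 + c)" for w
  \<comment> \<open>Multiplication by w removes the quotient sinh (w b) / w and its case
    distinction, at the price of a zero at w = 0.\<close>
  define H1 where "H1 w = w * cosh (w * of_real b) + \<kappa> w * sinh (w * of_real b)" for w
  define H2 where "H2 w = 2 * (w\<^sup>2 * sinh (w * of_real b) + w * \<kappa> w * cosh (w * of_real b)) - of_real \<gamma> * H1 w" for w
  have EN: "w * EE w (\<kappa> w) b = H1 w" "2 * (w * NN w (\<kappa> w) b) - of_real \<gamma> * (w * EE w (\<kappa> w) b) = H2 w" if "w \<noteq> 0" for w
    using that by (simp_all add: EE_def NN_def cc_def ss_def H1_def H2_def field_simps power2_eq_square)
  have hol\<kappa>: "\<kappa> holomorphic_on ball w0 r"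
    unfolding \<kappa>_def by (intro holomorphic_intros) (use pos in \<open>auto simp: complex_nonpos_Reals_iff dest: leD\<close>)
  have hol: "(\<lambda>w. H1 w * H2 w) holomorphic_on ball w0 r"
    unfolding H1_def H2_def cosh_def sinh_def by (intro holomorphic_intros hol\<kappa>)
  have zero_iff: "EE w (\<kappa> w) b \<noteq> 0 \<and> 2 * NN w (\<kappa> w) b \<noteq> of_real \<gamma> * EE w (\<kappa> w) b" if "H1 w * H2 w \<noteq> 0" "w \<noteq> 0" for w
  proof -
    have "H2 w = w * (2 * NN w (\<kappa> w) b - of_real \<gamma> * EE w (\<kappa> w) b)"
      using EN(2)[OF that(2)] by (simp add: algebra_simps)
    then show ?thesis
      using that(1) EN(1)[OF that(2)] by auto
  qed
  obtain w1 where w1: "w1 \<in> ball w0 r" "Im (w1\<^sup>2) \<noteq> 0"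
  proof -
    define e where "e = r / 4"
    \<comment> \<open>The principal root \<open>w0\<close> lies on the non-negative real or
      imaginary half-axis; a diagonal shift moves it into the open first quadrant, where the square
      is non-real. The size r / 4 keeps it in the ball.\<close>
    define w1 where "w1 = w0 + of_real e * (1 + \<i>)"
    have e: "e > 0" using r by (simp add: e_def)
    have "norm (of_real e * (1 + \<i>)) \<le> e * 2"
      using norm_triangle_ineq[of 1 \<i>] e by (simp add: norm_mult)
    also have "\<dots> < r" using r by (simp add: e_def)
    finally have "w1 \<in> ball w0 r"
      by (simp add: w1_def dist_norm norm_minus_commute)
    moreover have "Im (w1\<^sup>2) \<noteq> 0"
    proof -
      have "Im (w0\<^sup>2) = 0" using w0 by simp
      then have 0: "Re w0 * Im w0 = 0"
        by (auto simp: power2_eq_square)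
      have nn: "Re w0 \<ge> 0" "Im w0 \<ge> 0"
      proof -
        show "Re w0 \<ge> 0" using csqrt_principal[of "of_real P"] unfolding w0_def by linarith
        have "Re w0 > 0 \<or> Re w0 = 0 \<and> Im w0 \<ge> 0"
          using csqrt_principal[of "of_real P"] unfolding w0_def .
        then show "Im w0 \<ge> 0" using 0 by auto
      qed
      have "Im (w1\<^sup>2) = 2 * (Re w0 * Im w0) + 2 * e * (Re w0 + Im w0) + 2 * e * e"
        by (simp add: w1_def power2_eq_square algebra_simps)
      also have "\<dots> > 0"
        unfolding 0 using nn e by (intro add_nonneg_pos) auto
      finally show ?thesis by simp
    qed
    ultimately show ?thesis by (rule that)
  qed
  have "H1 w1 * H2 w1 \<noteq> 0"
  proof -
    have "w1 \<noteq> 0" using w1(2) by auto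
    have sq: "(\<kappa> w1)\<^sup>2 = w1\<^sup>2 + c" by (simp add: \<kappa>_def)
    have nz: "Im (NN w1 (\<kappa> w1) b * cnj (EE w1 (\<kappa> w1) b)) \<noteq> 0"
    proof (rule Im_NN_EE_nonzero[OF b])
      show "Re (\<kappa> w1) > 0" unfolding \<kappa>_def by (rule Re_csqrt_pos[OF pos[OF w1(1)]])
      show "Im ((\<kappa> w1)\<^sup>2) = Im (w1\<^sup>2)" unfolding sq by (simp add: c_def)
    qed (rule w1(2))
    have E: "EE w1 (\<kappa> w1) b \<noteq> 0"
      using nz by auto
    moreover have "2 * NN w1 (\<kappa> w1) b \<noteq> of_real \<gamma> * EE w1 (\<kappa> w1) b"
    proof
      assume "2 * NN w1 (\<kappa> w1) b = of_real \<gamma> * EE w1 (\<kappa> w1) b"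
      then have "NN w1 (\<kappa> w1) b = of_real (\<gamma> / 2) * EE w1 (\<kappa> w1) b"
        by (simp add: mult.commute)
      then have "NN w1 (\<kappa> w1) b * cnj (EE w1 (\<kappa> w1) b) = of_real (\<gamma> / 2 * (norm (EE w1 (\<kappa> w1) b))\<^sup>2)"
        by (simp only: of_real_mult complex_norm_square mult.assoc)
      then show False using nz by (metis Im_complex_of_real)
    qed
    moreover have "H2 w1 = w1 * (2 * NN w1 (\<kappa> w1) b - of_real \<gamma> * EE w1 (\<kappa> w1) b)"
      using EN(2)[OF \<open>w1 \<noteq> 0\<close>] by (simp add: algebra_simps)
    ultimately show ?thesis
      using EN(1)[OF \<open>w1 \<noteq> 0\<close>] \<open>w1 \<noteq> 0\<close> by (metis mult_eq_0_iff right_minus_eq)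
  qed
  then have "\<forall>\<^sub>F w in at w0. H1 w * H2 w \<noteq> 0 \<and> w \<in> ball w0 r"
    using r(1) w1(1) by (intro non_zero_neighbour_alt[OF hol _ _ _ w1(1)]) auto
  then obtain d where d: "d > 0" "\<And>w. w \<noteq> w0 \<Longrightarrow> dist w w0 < d \<Longrightarrow> H1 w * H2 w \<noteq> 0 \<and> w \<in> ball w0 r"
    unfolding eventually_at by auto
  \<comment> \<open>If v is a root of P - z, then |v - w0| |v + w0| = |z|, so for |z| < d^2 one of v
    and -v is closer to \<open>w0\<close> than d.\<close>
  define \<delta> where "\<delta> = d\<^sup>2"
  show ?thesis
  proof (rule that)
    show "\<delta> > 0" using d(1) by (simp add: \<delta>_def)
    fix z :: complex assume z: "z \<noteq> 0" "norm z < \<delta>"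
    define v where "v = csqrt (of_real P - z)"
    have v: "v\<^sup>2 = of_real P - z" by (simp add: v_def)
    have "(v - w0) * (v + w0) = v\<^sup>2 - w0\<^sup>2"
      by (simp add: power2_eq_square algebra_simps)
    also have "\<dots> = - z" by (simp add: v w0)
    finally have "norm (v - w0) * norm (v + w0) = norm z"
      by (metis norm_minus_cancel norm_mult)
    then have "\<not> (norm (v - w0) \<ge> d \<and> norm (v + w0) \<ge> d)"
      using z(2) d(1) mult_mono[of d "norm (v - w0)" d "norm (v + w0)"] by (auto simp: \<delta>_def power2_eq_square)
    then obtain w where w: "w\<^sup>2 = of_real P - z" "dist w w0 < d"
    proof (cases "norm (v - w0) < d")
      case True
      then show ?thesis using that[of v] v by (simp add: dist_norm)
    next
      case False
      assume *: "\<not> (norm (v - w0) \<ge> d \<and> norm (v + w0) \<ge> d)"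
      have "norm (- v - w0) = norm (v + w0)"
        by (metis minus_add_distrib norm_minus_cancel uminus_add_conv_diff add.commute)
      then show ?thesis using that[of "- v"] v * False by (simp add: dist_norm)
    qed
    have ne: "w \<noteq> w0" using w(1) w0 z(1) by auto
    note dw = d(2)[OF ne w(2)]
    show "\<exists>w \<kappa>. Re \<kappa> > 0 \<and> w\<^sup>2 = of_real P - z \<and> \<kappa>\<^sup>2 = of_real (\<kappa>0\<^sup>2) - z \<and> EE w \<kappa> b \<noteq> 0 \<and> 2 * NN w \<kappa> b \<noteq> of_real \<gamma> * EE w \<kappa> b"
    proof (intro exI conjI)
      show "Re (\<kappa> w) > 0" unfolding \<kappa>_def using dw by (intro Re_csqrt_pos pos) auto
      show "w\<^sup>2 = of_real P - z" by (rule w(1))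
      show "(\<kappa> w)\<^sup>2 = of_real (\<kappa>0\<^sup>2) - z" by (simp add: \<kappa>_def w(1) c_def)
      \<comment> \<open>\<open>H1\<close> vanishes at 0, so a point where the product is non-zero is
        different from 0.\<close>
      have "w \<noteq> 0" using dw EN H1_def H2_def by (auto simp: H1_def)
      then show "EE w (\<kappa> w) b \<noteq> 0" "2 * NN w (\<kappa> w) b \<noteq> of_real \<gamma> * EE w (\<kappa> w) b"
        using zero_iff dw by auto
    qed
  qed
qed

section \<open>The resonance condition\<close>

text \<open>Monotonicity in k reduces infinitely many indices to the two neighbours of
  \<open>k0\<close>, whose strict inequalities persist near \<open>s0\<close> by continuity; the
  index \<open>k0\<close> itself is handled by strict monotonicity in s. This yields one radius for
  all k.\<close>

lemma resonance_isolated: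
  fixes G :: "nat \<Rightarrow> real \<Rightarrow> real"
  assumes dec: "\<And>k s. k \<ge> 1 \<Longrightarrow> s > 0 \<Longrightarrow> G (Suc k) s < G k s"
    and inc: "\<And>k s s'. k \<ge> 1 \<Longrightarrow> 0 < s \<Longrightarrow> s < s' \<Longrightarrow> G k s < G k s'"
    and cont: "\<And>k. k \<ge> 1 \<Longrightarrow> isCont (G k) s0"
    and s0: "s0 > 0" and k0: "k0 \<ge> 1"
  obtains e where "e > 0" "e \<le> s0 / 2"
    "\<And>k s. k \<ge> 1 \<Longrightarrow> \<bar>s - s0\<bar> < e \<Longrightarrow> (k, s) \<noteq> (k0, s0) \<Longrightarrow> G k s \<noteq> G k0 s0"
proof -
  have mono: "G k s \<le> G j s" if "1 \<le> j" "j \<le> k" "s > 0" for j k s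
    using that(2)
  proof (induction k rule: dec_induct)
    case (step n)
    then show ?case using dec[of n s] that by simp
  qed simp
  have up: "\<forall>\<^sub>F s in at s0. G (Suc k0) s < G k0 s0"
    using cont[of "Suc k0"] dec[OF k0 s0] unfolding isCont_def by (intro order_tendstoD(2)) auto
  \<comment> \<open>For k0 = 1 there is no lower neighbour, since k0 - 1 = 0 is outside the range of
    the hypotheses.\<close>
  have low: "\<forall>\<^sub>F s in at s0. k0 \<ge> 2 \<longrightarrow> G (k0 - 1) s > G k0 s0"
  proof (cases "k0 \<ge> 2")
    case True
    then have "G k0 s0 < G (k0 - 1) s0"
      using dec[of "k0 - 1" s0] s0 by simp
    then show ?thesis
      using cont[of "k0 - 1"] True unfolding isCont_def by (auto intro!: order_tendstoD(1))
  qed simp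
  obtain e where e: "e > 0" "\<And>s. s \<noteq> s0 \<Longrightarrow> dist s s0 < e \<Longrightarrow> G (Suc k0) s < G k0 s0 \<and> (k0 \<ge> 2 \<longrightarrow> G (k0 - 1) s > G k0 s0)"
    using eventually_conj[OF up low] unfolding eventually_at by auto
  have both: "G (Suc k0) s < G k0 s0 \<and> (k0 \<ge> 2 \<longrightarrow> G (k0 - 1) s > G k0 s0)" if "\<bar>s - s0\<bar> < e" for s
  proof (cases "s = s0")
    case True
    then show ?thesis using dec[OF k0 s0] dec[of "k0 - 1" s0] s0 by auto
  next
    case False
    then show ?thesis using e(2)[of s] that by (simp add: dist_real_def)
  qed
  show ?thesis
  \<comment> \<open>The cap s0 / 2 keeps s positive.\<close>
  proof (rule that[of "min e (s0 / 2)"])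
    show "min e (s0 / 2) > 0" "min e (s0 / 2) \<le> s0 / 2" using e s0 by auto
    fix k s assume k: "1 \<le> k" and s: "\<bar>s - s0\<bar> < min e (s0 / 2)" and ne: "(k, s) \<noteq> (k0, s0)"
    have sp: "s > 0" using s by linarith
    have se: "\<bar>s - s0\<bar> < e" using s by simp
    consider "k = k0" | "k > k0" | "k < k0" by linarith
    then show "G k s \<noteq> G k0 s0"
    proof cases
      case 1
      then have "s < s0 \<or> s0 < s" using ne by auto
      then show ?thesis using inc[OF k0 sp, of s0] inc[OF k0 s0, of s] 1 by auto
    next
      case 2
      then show ?thesis using mono[of "Suc k0" k s] both[OF se] sp by simp
    next
      case 3
      then have "k \<le> k0 - 1" "k0 \<ge> 2" using k by auto
      then have "G (k0 - 1) s \<le> G k s" "G k0 s0 < G (k0 - 1) s"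
        using mono[OF k _ sp] both[OF se] by auto
      then show ?thesis by linarith
    qed
  qed
qed

section \<open>The resonance functions of the three cases\<close>

lemma sinh_ge: "t \<ge> 0 \<Longrightarrow> sinh t \<ge> (t :: real)"
proof -
  assume t: "t \<ge> 0"
  have "(\<lambda>t. sinh t - t) 0 \<le> (\<lambda>t. sinh t - t) t"
    by (rule DERIV_nonneg_imp_nondecreasing[OF t])
      (auto intro!: exI derivative_eq_intros simp: cosh_real_ge_1)
  then show ?thesis by simp
qed

text \<open>Numerator \<open>A\<close> and denominator \<open>B\<close> are each other's derivatives
  and B^2 - A^2 = \<nu>^2 - s^2 is constant, so the sign is that of (\<nu>^2 - s^2) x - A B. Since
  sinh x cosh x \<ge> x, the product A B exceeds (\<nu>^2 + s^2) x, whichever of \<nu> and s is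
  larger.\<close>

lemma hyperbolic_quotient_decreasing:
  fixes \<nu> s :: real
  assumes \<nu>: "\<nu> > 0" and s: "s > 0" and t: "0 < t" "t < t'"
  shows "(\<nu> * sinh t' + s * cosh t') / (\<nu> * cosh t' + s * sinh t') / t'
    < (\<nu> * sinh t + s * cosh t) / (\<nu> * cosh t + s * sinh t) / t"
proof (rule DERIV_neg_imp_decreasing[OF t(2)])
  fix x assume x: "t \<le> x" "x \<le> t'"
  then have x0: "x > 0" using t by simp
  define A where "A = \<nu> * sinh x + s * cosh x"
  define B where "B = \<nu> * cosh x + s * sinh x"
  have sc: "sinh x \<ge> x" "cosh x \<ge> 1" using sinh_ge[of x] x0 cosh_real_ge_1 by auto
  have B: "B > 0" unfolding B_def using \<nu> s x0 by (intro add_pos_pos mult_pos_pos) auto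
  have "((\<lambda>x. (\<nu> * sinh x + s * cosh x) / (\<nu> * cosh x + s * sinh x) / x) has_real_derivative
      ((B * B - A * A) / (B * B) * x - A / B) / (x * x)) (at x)"
  proof -
    have dA: "((\<lambda>x. \<nu> * sinh x + s * cosh x) has_real_derivative B) (at x)"
      and dB: "((\<lambda>x. \<nu> * cosh x + s * sinh x) has_real_derivative A) (at x)"
      by (auto intro!: derivative_eq_intros simp: A_def B_def)
    have "((\<lambda>x. (\<nu> * sinh x + s * cosh x) / (\<nu> * cosh x + s * sinh x)) has_real_derivative (B * B - A * A) / (B * B)) (at x)"
      using DERIV_divide[OF dA dB] B by (simp add: A_def[symmetric] B_def[symmetric])
    from DERIV_divide[OF this DERIV_ident] show ?thesis
      using x0 by (simp add: A_def[symmetric] B_def[symmetric])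
  qed
  moreover have "((B * B - A * A) / (B * B) * x - A / B) / (x * x) < 0"
  proof -
    have cs: "cosh x * cosh x = 1 + sinh x * sinh x"
      using cosh_square_eq[of x] by (simp add: power2_eq_square)
    have BA: "B * B - A * A = (\<nu> * \<nu> - s * s) * (cosh x * cosh x - sinh x * sinh x)"
      by (simp add: A_def B_def algebra_simps)
    then have BA: "B * B - A * A = \<nu> * \<nu> - s * s" using cs by simp
    have "A * B = (\<nu> * \<nu> + s * s) * (sinh x * cosh x) + \<nu> * s * (cosh x * cosh x + sinh x * sinh x)"
      by (simp add: A_def B_def algebra_simps)
    moreover have "sinh x * cosh x \<ge> x"
      using mult_mono[of x "sinh x" 1 "cosh x"] sc x0 by simp
    then have "(\<nu> * \<nu> + s * s) * (sinh x * cosh x) \<ge> (\<nu> * \<nu> + s * s) * x"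
      by (intro mult_left_mono) auto
    moreover have "\<nu> * s * (cosh x * cosh x + sinh x * sinh x) > 0"
      using \<nu> s x0 sc by (intro mult_pos_pos add_pos_nonneg) auto
    moreover have "(\<nu> * \<nu> + s * s) * x \<ge> (\<nu> * \<nu> - s * s) * x"
      using x0 by (intro mult_right_mono) auto
    ultimately have "(\<nu> * \<nu> - s * s) * x < A * B" by linarith
    moreover have "(B * B - A * A) / (B * B) * x - A / B = ((\<nu> * \<nu> - s * s) * x - A * B) / (B * B)"
      unfolding BA using B by (simp add: field_simps)
    ultimately have "(B * B - A * A) / (B * B) * x - A / B < 0"
      using B by (simp add: divide_neg_pos)
    then show ?thesis using x0 by (simp add: divide_neg_pos)
  qed
  ultimately show "\<exists>y. ((\<lambda>x. (\<nu> * sinh x + s * cosh x) / (\<nu> * cosh x + s * sinh x) / x) has_real_derivative y) (at x) \<and> y < 0"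
    by blast
qed

lemma cosh_complex_of_real: "cosh (complex_of_real x) = of_real (cosh x)"
  by (simp add: cosh_field_def flip: exp_of_real)

lemma sinh_complex_of_real: "sinh (complex_of_real x) = of_real (sinh x)"
  by (simp add: sinh_field_def flip: exp_of_real)

text \<open>The interface through which the three cases enter the rest of the proof. With s = sqrt
  (1 - lam), so that \<kappa> = k s at z = 0, \<open>G k s\<close> is the coupling at which index k
  is resonant. The bounds on \<open>EE\<close> and on the interior solution serve the estimate
  uniform in k.\<close>

definition resonance_data :: "real \<Rightarrow> real \<Rightarrow> (nat \<Rightarrow> real \<Rightarrow> real) \<Rightarrow> real \<Rightarrow> bool"
  where "resonance_data b \<beta> G c \<longleftrightarrow> c \<ge> 0 \<and> (\<forall>k\<ge>1. \<forall>s>0.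
    G k s > 0 \<and> G (Suc k) s < G k s \<and> (\<forall>s'>s. G k s < G k s') \<and> isCont (G k) s \<and>
    (\<exists>w. w\<^sup>2 = of_real ((real k)\<^sup>2 * (1 - \<beta>)) \<and> norm (EE w (of_real (k * s)) b) \<ge> 1 \<and>
      2 * NN w (of_real (k * s)) b = of_real ((real k)\<^sup>2 * G k s) * EE w (of_real (k * s)) b \<and>
      (\<forall>t\<in>{0..b}. norm (cc w t + of_real (k * s) * ss w t) \<le> (1 + c * s) * norm (EE w (of_real (k * s)) b))))"

text \<open>The choice of b gives sin (k \<mu> b) = sin (k pi) = 0 for every k, so \<open>EE\<close>
  is (-1)^k and \<open>NN\<close> is k s (-1)^k. The constant 1 / \<mu> comes from |cos + (s /
  \<mu>) sin| \<le> 1 + s / \<mu>.\<close>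

lemma resonance_data_oscillating:
  assumes "\<beta> > 1" "b = pi / sqrt (\<beta> - 1)"
  shows "resonance_data b \<beta> (\<lambda>k s. 2 * s / real k) (1 / sqrt (\<beta> - 1))"
  unfolding resonance_data_def
proof (intro conjI allI impI)
  define \<mu> where "\<mu> = sqrt (\<beta> - 1)"
  have \<mu>: "\<mu> > 0" "\<mu>\<^sup>2 = \<beta> - 1" "\<mu> * b = pi" using assms by (auto simp: \<mu>_def)
  show "0 \<le> 1 / sqrt (\<beta> - 1)" using assms by simp
  fix k :: nat and s :: real assume k: "1 \<le> k" and s: "0 < s"
  show "0 < 2 * s / real k" "2 * s / real (Suc k) < 2 * s / real k"
    using k s by (auto simp: field_simps)
  show "2 * s / real k < 2 * s' / real k" if "s < s'" for s'
    using k that by (auto intro: divide_strict_right_mono)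
  show "isCont (\<lambda>s. 2 * s / real k) s"
    using k by (intro continuous_intros) auto
  define w where "w = \<i> * of_real (k * \<mu>)"
  have w0: "w \<noteq> 0" using k \<mu> by (simp add: w_def)
  have wt: "w * of_real t = \<i> * of_real (k * \<mu> * t)" for t
    by (simp add: w_def)
  have cc: "cc w t = of_real (cos (k * \<mu> * t))" for t
    unfolding cc_def wt cos_of_real[symmetric] cos_conv_cosh ..
  have ss: "ss w t = of_real (sin (k * \<mu> * t) / (k * \<mu>))" for t
  proof -
    have "sinh (\<i> * of_real (k * \<mu> * t)) = \<i> * of_real (sin (k * \<mu> * t))"
      unfolding sin_of_real[symmetric] sin_conv_sinh by simp
    then show ?thesis
      using w0 unfolding ss_def wt by (simp add: w_def)
  qed
  have kb: "k * \<mu> * b = real k * pi" using \<mu>(3) by (simp add: mult.assoc)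
  have E: "EE w (of_real (k * s)) b = of_real ((-1) ^ k)" "NN w (of_real (k * s)) b = of_real (k * s * (-1) ^ k)"
    by (simp_all add: EE_def NN_def cc ss kb cos_npi sin_npi)
  show "\<exists>w. w\<^sup>2 = of_real ((real k)\<^sup>2 * (1 - \<beta>)) \<and> norm (EE w (of_real (k * s)) b) \<ge> 1 \<and>
      2 * NN w (of_real (k * s)) b = of_real ((real k)\<^sup>2 * (2 * s / real k)) * EE w (of_real (k * s)) b \<and>
      (\<forall>t\<in>{0..b}. norm (cc w t + of_real (k * s) * ss w t) \<le> (1 + 1 / sqrt (\<beta> - 1) * s) * norm (EE w (of_real (k * s)) b))"
  proof (intro exI[of _ w] conjI ballI)
    have "w\<^sup>2 = - of_real ((real k)\<^sup>2 * \<mu>\<^sup>2)"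
      by (simp add: w_def power_mult_distrib)
    also have "\<dots> = of_real ((real k)\<^sup>2 * (1 - \<beta>))"
      unfolding \<mu>(2) by (simp add: algebra_simps)
    finally show "w\<^sup>2 = of_real ((real k)\<^sup>2 * (1 - \<beta>))" .
    show "norm (EE w (of_real (k * s)) b) \<ge> 1"
      unfolding E by (simp add: norm_power)
    show "2 * NN w (of_real (k * s)) b = of_real ((real k)\<^sup>2 * (2 * s / real k)) * EE w (of_real (k * s)) b"
      unfolding E using k by (simp add: power2_eq_square)
    fix t
    have "cc w t + of_real (k * s) * ss w t = of_real (cos (k * \<mu> * t) + s / \<mu> * sin (k * \<mu> * t))"
      unfolding cc ss using k \<mu>(1) by simp
    then have "norm (cc w t + of_real (k * s) * ss w t) = \<bar>cos (k * \<mu> * t) + s / \<mu> * sin (k * \<mu> * t)\<bar>"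
      by (metis norm_of_real real_norm_def)
    also have "\<dots> \<le> \<bar>cos (k * \<mu> * t)\<bar> + s / \<mu> * \<bar>sin (k * \<mu> * t)\<bar>"
      using s \<mu>(1) by (intro order_trans[OF abs_triangle_ineq]) (simp add: abs_mult)
    also have "\<dots> \<le> 1 + s / \<mu> * 1"
      using s \<mu>(1) by (intro add_mono mult_left_mono abs_cos_le_one abs_sin_le_one) auto
    finally show "norm (cc w t + of_real (k * s) * ss w t) \<le> (1 + 1 / sqrt (\<beta> - 1) * s) * norm (EE w (of_real (k * s)) b)"
      unfolding E by (simp add: norm_power \<mu>_def[symmetric])
  qed
qed

text \<open>The interior function is non-negative and increasing on [0, b], so it is largest at b,
  where it equals \<open>EE\<close>; hence the constant 0.\<close>

lemma resonance_data_hyperbolic: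
  fixes \<beta> b :: real
  defines "\<nu> \<equiv> sqrt (1 - \<beta>)"
  assumes "\<beta> < 1" "b > 0"
  shows "resonance_data b \<beta> (\<lambda>k s. 2 * \<nu> / real k * ((\<nu> * sinh (real k * \<nu> * b) + s * cosh (real k * \<nu> * b)) /
    (\<nu> * cosh (real k * \<nu> * b) + s * sinh (real k * \<nu> * b)))) 0"
  unfolding resonance_data_def
proof (intro conjI allI impI)
  have \<nu>: "\<nu> > 0" "\<nu>\<^sup>2 = 1 - \<beta>" using assms by (auto simp: \<nu>_def)
  show "0 \<le> (0 :: real)" by simp
  fix k :: nat and s :: real assume k: "1 \<le> k" and s: "0 < s"
  define x where "x = real k * \<nu> * b"
  have x: "x > 0" using k \<nu> assms(3) by (simp add: x_def)
  define A where "A s = \<nu> * sinh x + s * cosh x" for s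
  define B where "B s = \<nu> * cosh x + s * sinh x" for s
  have AB: "A s > 0" "B s > 0" if "s > 0" for s
    using \<nu> x that by (auto simp: A_def B_def intro!: add_pos_pos)
  have sx: "sinh x > 0" using x by simp
  have AB': "A s > 0" "B s > 0" if "s > 0" for s
    using AB that by auto
  note fold = x_def[symmetric] A_def[symmetric] B_def[symmetric]
  show "0 < 2 * \<nu> / real k * ((\<nu> * sinh (real k * \<nu> * b) + s * cosh (real k * \<nu> * b)) /
    (\<nu> * cosh (real k * \<nu> * b) + s * sinh (real k * \<nu> * b)))"
    unfolding fold using AB[OF s] \<nu>(1) k by simp
  show "2 * \<nu> / real (Suc k) * ((\<nu> * sinh (real (Suc k) * \<nu> * b) + s * cosh (real (Suc k) * \<nu> * b)) /
    (\<nu> * cosh (real (Suc k) * \<nu> * b) + s * sinh (real (Suc k) * \<nu> * b))) <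
    2 * \<nu> / real k * ((\<nu> * sinh (real k * \<nu> * b) + s * cosh (real k * \<nu> * b)) /
    (\<nu> * cosh (real k * \<nu> * b) + s * sinh (real k * \<nu> * b)))"
  proof -
    \<comment> \<open>Decrease in k is the decrease of q t / t along t = k \<nu> b, after
      multiplication by the constant 2 \<nu> (\<nu> b).\<close>
    define q where "q t = (\<nu> * sinh t + s * cosh t) / (\<nu> * cosh t + s * sinh t)" for t
    have "real k * \<nu> * b < real (Suc k) * \<nu> * b"
      using \<nu> assms(3) by simp
    from hyperbolic_quotient_decreasing[OF \<nu>(1) s x[unfolded x_def] this]
    have "q (real (Suc k) * \<nu> * b) / (real (Suc k) * \<nu> * b) < q (real k * \<nu> * b) / (real k * \<nu> * b)"
      by (simp only: q_def)
    then have "2 * \<nu> * (\<nu> * b) * (q (real (Suc k) * \<nu> * b) / (real (Suc k) * \<nu> * b)) < 2 * \<nu> * (\<nu> * b) * (q (real k * \<nu> * b) / (real k * \<nu> * b))"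
      using \<nu> assms(3) by (intro mult_strict_left_mono) auto
    moreover have "2 * \<nu> * (\<nu> * b) * (Q / (r * \<nu> * b)) = 2 * \<nu> / r * Q" for Q r :: real
      using \<nu> assms(3) by (cases "r = 0") (auto simp: field_simps)
    ultimately show ?thesis
      by (simp only: q_def)
  qed
  show "2 * \<nu> / real k * ((\<nu> * sinh (real k * \<nu> * b) + s * cosh (real k * \<nu> * b)) /
    (\<nu> * cosh (real k * \<nu> * b) + s * sinh (real k * \<nu> * b))) <
    2 * \<nu> / real k * ((\<nu> * sinh (real k * \<nu> * b) + s' * cosh (real k * \<nu> * b)) /
    (\<nu> * cosh (real k * \<nu> * b) + s' * sinh (real k * \<nu> * b)))" if s': "s < s'" for s'
    unfolding fold
  proof (rule mult_strict_left_mono)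
    have "s' > 0" using s s' by simp
    note p = AB[OF s] AB[OF this]
    \<comment> \<open>Cross-multiplied, monotonicity in s is the identity cosh^2 - sinh^2 =
      1.\<close>
    have "A s' * B s - A s * B s' = \<nu> * (s' - s) * ((cosh x)\<^sup>2 - (sinh x)\<^sup>2)"
      by (simp add: A_def B_def power2_eq_square algebra_simps)
    also have "\<dots> = \<nu> * (s' - s)" by (simp add: cosh_square_eq)
    also have "\<dots> > 0" using \<nu>(1) s' by simp
    finally have "A s * B s' < A s' * B s" by simp
    then show "A s / B s < A s' / B s'"
      using p by (simp add: divide_less_eq less_divide_eq mult.commute)
  qed (use \<nu>(1) k in simp)
  have Bs: "\<nu> * cosh (real k * \<nu> * b) + s * sinh (real k * \<nu> * b) \<noteq> 0"
    using AB(2)[OF s] by (simp add: B_def x_def)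
  show "isCont (\<lambda>s. 2 * \<nu> / real k * ((\<nu> * sinh (real k * \<nu> * b) + s * cosh (real k * \<nu> * b)) /
    (\<nu> * cosh (real k * \<nu> * b) + s * sinh (real k * \<nu> * b)))) s"
    by (intro continuous_intros Bs) (use k in auto)
  define w where "w = complex_of_real (real k * \<nu>)"
  have w0: "w \<noteq> 0" using k \<nu>(1) by (simp add: w_def)
  have wt: "w * of_real t = of_real (real k * \<nu> * t)" for t
    by (simp add: w_def)
  have cc: "cc w t = of_real (cosh (real k * \<nu> * t))" for t
    unfolding cc_def wt by (simp only: cosh_complex_of_real)
  have ss: "ss w t = of_real (sinh (real k * \<nu> * t) / (real k * \<nu>))" for t
  proof -
    have "sinh (w * of_real t) = of_real (sinh (real k * \<nu> * t))"
      unfolding wt by (rule sinh_complex_of_real)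
    then show ?thesis using w0 by (simp add: ss_def w_def)
  qed
  have u: "cc w t + of_real (real k * s) * ss w t = of_real (cosh (real k * \<nu> * t) + s / \<nu> * sinh (real k * \<nu> * t))" for t
    unfolding cc ss using k \<nu>(1) by simp
  have EB: "EE w (of_real (real k * s)) b = of_real (B s / \<nu>)"
    unfolding EE_def u x_def[symmetric] using \<nu>(1) by (simp add: B_def add_divide_distrib)
  have NA: "NN w (of_real (real k * s)) b = of_real (real k * A s)"
    unfolding NN_def cc ss x_def[symmetric] using \<nu>(1) k
    by (simp add: A_def w_def power2_eq_square algebra_simps)
  have mono: "cosh (real k * \<nu> * t) + s / \<nu> * sinh (real k * \<nu> * t) \<le> B s / \<nu>" "0 \<le> cosh (real k * \<nu> * t) + s / \<nu> * sinh (real k * \<nu> * t)" if t: "t \<in> {0..b}" for t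
  proof -
    have le: "real k * \<nu> * t \<le> x" "0 \<le> real k * \<nu> * t"
      using t \<nu>(1) by (auto simp: x_def intro!: mult_left_mono)
    have "cosh (real k * \<nu> * t) \<le> cosh x"
      using le by (subst cosh_real_nonneg_le_iff) auto
    moreover have "s / \<nu> * sinh (real k * \<nu> * t) \<le> s / \<nu> * sinh x"
      using le s \<nu>(1) by (intro mult_left_mono) auto
    ultimately show "cosh (real k * \<nu> * t) + s / \<nu> * sinh (real k * \<nu> * t) \<le> B s / \<nu>"
      using \<nu>(1) by (simp add: B_def add_divide_distrib)
    show "0 \<le> cosh (real k * \<nu> * t) + s / \<nu> * sinh (real k * \<nu> * t)"
      using le s \<nu>(1) by (intro add_nonneg_nonneg mult_nonneg_nonneg) auto
  qed
  have nE: "norm (EE w (of_real (real k * s)) b) = B s / \<nu>"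
    unfolding EB norm_of_real using AB(2)[OF s] \<nu>(1) by simp
  show "\<exists>w. w\<^sup>2 = of_real ((real k)\<^sup>2 * (1 - \<beta>)) \<and> norm (EE w (of_real (k * s)) b) \<ge> 1 \<and>
      2 * NN w (of_real (k * s)) b = of_real ((real k)\<^sup>2 * (2 * \<nu> / real k * ((\<nu> * sinh (real k * \<nu> * b) + s * cosh (real k * \<nu> * b)) /
    (\<nu> * cosh (real k * \<nu> * b) + s * sinh (real k * \<nu> * b))))) * EE w (of_real (k * s)) b \<and>
      (\<forall>t\<in>{0..b}. norm (cc w t + of_real (k * s) * ss w t) \<le> (1 + 0 * s) * norm (EE w (of_real (k * s)) b))"
  proof (intro exI[of _ w] conjI ballI)
    show "w\<^sup>2 = of_real ((real k)\<^sup>2 * (1 - \<beta>))"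
      unfolding \<nu>(2)[symmetric] by (simp add: w_def power_mult_distrib)
    show "norm (EE w (of_real (k * s)) b) \<ge> 1"
      using mono(1)[of 0] assms(3) unfolding nE by simp
    have "2 * (real k * A s) = (real k)\<^sup>2 * (2 * \<nu> / real k * (A s / B s)) * (B s / \<nu>)"
      using AB(2)[OF s] \<nu>(1) k by (simp add: power2_eq_square)
    then have "complex_of_real (2 * (real k * A s)) = of_real ((real k)\<^sup>2 * (2 * \<nu> / real k * (A s / B s)) * (B s / \<nu>))"
      by (simp only:)
    then show "2 * NN w (of_real (k * s)) b = of_real ((real k)\<^sup>2 * (2 * \<nu> / real k * ((\<nu> * sinh (real k * \<nu> * b) + s * cosh (real k * \<nu> * b)) /
    (\<nu> * cosh (real k * \<nu> * b) + s * sinh (real k * \<nu> * b))))) * EE w (of_real (k * s)) b"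
      unfolding fold NA EB of_real_mult[of 2] by (simp only: of_real_mult of_real_numeral)
    fix t assume "t \<in> {0..b}"
    then show "norm (cc w t + of_real (k * s) * ss w t) \<le> (1 + 0 * s) * norm (EE w (of_real (k * s)) b)"
      unfolding u nE norm_of_real using mono[of t] by simp
  qed
qed

text \<open>Here w = 0 and the interior function is 1 + k s t, again increasing with maximum
  \<open>EE\<close> at b.\<close>

lemma resonance_data_linear:
  assumes "b > 0"
  shows "resonance_data b 1 (\<lambda>k s. 2 * s / (real k * (1 + s * real k * b))) 0"
  unfolding resonance_data_def
proof (intro conjI allI impI)
  show "0 \<le> (0 :: real)" by simp
  fix k :: nat and s :: real assume k: "1 \<le> k" and s: "0 < s"
  have p: "1 + r * real j * b > 0" if "r > 0" for r j
    using that assms by (intro add_pos_nonneg) auto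
  show "0 < 2 * s / (real k * (1 + s * real k * b))"
    using p[OF s, of k] k s by simp
  show "2 * s / (real (Suc k) * (1 + s * real (Suc k) * b)) < 2 * s / (real k * (1 + s * real k * b))"
  proof (rule divide_strict_left_mono)
    show "real k * (1 + s * real k * b) < real (Suc k) * (1 + s * real (Suc k) * b)"
      using k s assms p[OF s, of k] by (intro mult_strict_mono) auto
    show "0 < real (Suc k) * (1 + s * real (Suc k) * b) * (real k * (1 + s * real k * b))"
      by (intro mult_pos_pos p s) (use k in auto)
  qed (use s in simp)
  show "2 * s / (real k * (1 + s * real k * b)) < 2 * s' / (real k * (1 + s' * real k * b))" if s': "s < s'" for s'
  proof -
    have s'p: "s' > 0" using s s' by simp
    have "s * (real k * (1 + s' * real k * b)) < s' * (real k * (1 + s * real k * b))"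
      using s' k by (simp add: algebra_simps)
    then show ?thesis
      using p[OF s, of k] p[OF s'p, of k] k by (simp add: divide_less_eq less_divide_eq mult.commute mult.left_commute)
  qed
  have "real k * (1 + s * real k * b) \<noteq> 0" using p[OF s, of k] k by simp
  then show "isCont (\<lambda>s. 2 * s / (real k * (1 + s * real k * b))) s"
    by (intro continuous_intros)
  have u: "cc 0 t + of_real (k * s) * ss 0 t = of_real (1 + k * s * t)" for t
    by (simp add: cc_def ss_def)
  have E: "EE 0 (of_real (k * s)) b = of_real (1 + s * real k * b)" "NN 0 (of_real (k * s)) b = of_real (k * s)"
    by (simp_all add: EE_def NN_def cc_def ss_def mult.commute)
  show "\<exists>w. w\<^sup>2 = of_real ((real k)\<^sup>2 * (1 - 1)) \<and> norm (EE w (of_real (k * s)) b) \<ge> 1 \<and>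
      2 * NN w (of_real (k * s)) b = of_real ((real k)\<^sup>2 * (2 * s / (real k * (1 + s * real k * b)))) * EE w (of_real (k * s)) b \<and>
      (\<forall>t\<in>{0..b}. norm (cc w t + of_real (k * s) * ss w t) \<le> (1 + 0 * s) * norm (EE w (of_real (k * s)) b))"
  proof (intro exI[of _ 0] conjI ballI)
    show "0\<^sup>2 = complex_of_real ((real k)\<^sup>2 * (1 - 1))" by simp
    show "norm (EE 0 (of_real (k * s)) b) \<ge> 1"
      unfolding E norm_of_real using s assms by simp
    have "2 * (real k * s) = (real k)\<^sup>2 * (2 * s / (real k * (1 + s * real k * b))) * (1 + s * real k * b)"
      using p[OF s, of k] k by (simp add: power2_eq_square)
    then have "complex_of_real (2 * (real k * s)) = of_real ((real k)\<^sup>2 * (2 * s / (real k * (1 + s * real k * b))) * (1 + s * real k * b))"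
      by (simp only:)
    then show "2 * NN 0 (of_real (k * s)) b = of_real ((real k)\<^sup>2 * (2 * s / (real k * (1 + s * real k * b)))) * EE 0 (of_real (k * s)) b"
      unfolding E by (simp only: of_real_mult of_real_numeral)
    fix t assume t: "t \<in> {0..b}"
    have "k * s * t \<le> k * s * b" "0 \<le> k * s * t" using t s by (auto intro!: mult_left_mono)
    then show "norm (cc 0 t + of_real (k * s) * ss 0 t) \<le> (1 + 0 * s) * norm (EE 0 (of_real (k * s)) b)"
      unfolding u E norm_of_real using s assms by (simp add: mult_ac)
  qed
qed

section \<open>The bound on the decaying solution, uniform in k\<close>

lemma integral_exp_decay:
  fixes r b :: real
  assumes "r > 0"
  shows "has_bochner_integral lborel (\<lambda>y. indicator {b..} y * exp (- r * (y - b))) (1 / r)"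
proof (rule has_bochner_integral_nn_integral)
  have "((\<lambda>t. - exp (- r * (t - b)) / r) \<longlongrightarrow> 0) at_top"
    using assms by real_asymp
  then have "(\<integral>\<^sup>+t. ennreal (exp (- r * (t - b))) * indicator {b..} t \<partial>lborel) = ennreal (0 - (- exp (- r * (b - b)) / r))"
    using assms by (intro nn_integral_FTC_atLeast) (auto intro!: derivative_eq_intros)
  then show "(\<integral>\<^sup>+y. ennreal (indicator {b..} y * exp (- r * (y - b))) \<partial>lborel) = ennreal (1 / r)"
    by (simp add: ennreal_mult' ennreal_indicator mult.commute)
qed (use assms in auto)

text \<open>On [0, b] the solution at y is the interior function at b - y divided by
  \<open>EE\<close>. Beyond b it is an exponential divided by \<open>EE\<close>, and the lower bound
  1 on |EE| suffices.\<close>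

lemma decaying_bound:
  assumes b: "b > 0" and r: "r > 0" and E: "norm (EE w (of_real r) b) \<ge> 1"
    and u: "\<And>t. t \<in> {0..b} \<Longrightarrow> norm (cc w t + of_real r * ss w t) \<le> K * norm (EE w (of_real r) b)"
    and K: "K \<ge> 1" and y: "y \<ge> 0"
  shows "(norm (decaying w (of_real r) b y))\<^sup>2 \<le> K\<^sup>2 * (indicator {0..b} y + indicator {b..} y * exp (- (2 * r) * (y - b)))"
proof (cases "y \<le> b")
  case True
  have "cc w (y - b) - of_real r * ss w (y - b) = cc w (b - y) + of_real r * ss w (b - y)"
    using cc_minus[of w "b - y"] ss_minus[of w "b - y"] by simp
  then have "norm (decaying w (of_real r) b y) = norm (cc w (b - y) + of_real r * ss w (b - y)) / norm (EE w (of_real r) b)"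
    using True by (simp add: decaying_def join_def norm_divide)
  also have "\<dots> \<le> K"
    by (subst pos_divide_le_eq[OF order_less_le_trans[OF zero_less_one E]]) (use u[of "b - y"] True y in auto)
  finally have "(norm (decaying w (of_real r) b y))\<^sup>2 \<le> K\<^sup>2"
    by (rule power_mono) simp
  also have "\<dots> \<le> K\<^sup>2 * (indicator {0..b} y + indicator {b..} y * exp (- (2 * r) * (y - b)))"
  proof -
    have "1 \<le> indicator {0..b} y + indicator {b..} y * exp (- (2 * r) * (y - b))"
      using True y by simp
    from mult_left_mono[OF this, of "K\<^sup>2"] show ?thesis by simp
  qed
  finally show ?thesis .
next
  case False
  have "norm (decaying w (of_real r) b y) = exp (- r * (y - b)) / norm (EE w (of_real r) b)"
    using False by (simp add: decaying_def join_def norm_divide norm_exp_eq_Re)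
  also have "\<dots> \<le> exp (- r * (y - b)) * K"
    using E K mult_mono[of 1 K 1 "norm (EE w (of_real r) b)"] by (simp add: divide_le_eq mult.assoc)
  finally have "(norm (decaying w (of_real r) b y))\<^sup>2 \<le> (exp (- r * (y - b)) * K)\<^sup>2"
    by (rule power_mono) simp
  also have "\<dots> = K\<^sup>2 * exp (- (2 * r) * (y - b))"
    by (simp add: power_mult_distrib exp_double[symmetric] algebra_simps)
  finally show ?thesis using False by simp
qed

lemma (in schroedinger) half_line_solutions:
  assumes z: "z = 0"
  shows "half_line_solution b \<beta> k lam \<phi>"
    and "half_line_solution b \<beta> k lam f \<Longrightarrow> AE y\<in>{0<..} in lborel. f y = \<phi> y"
proof -
  have p: "p = (\<lambda>y. of_real (pot b \<beta> k lam y))" using p_eq z by simp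
  have "set_borel_measurable lborel {0<..} \<phi>"
    by (rule continuous_on_set_borel_measurable, rule continuous_on_subset[OF \<phi>_continuous]) auto
  then show "half_line_solution b \<beta> k lam \<phi>"
    unfolding half_line_solution_iff using H2_rep_\<phi> initial(1) unfolding p by auto
  assume "half_line_solution b \<beta> k lam f"
  then obtain R R1 where R: "H2_rep {0..} R R1 (\<lambda>y. p y * R y)" "AE y\<in>{0<..} in lborel. f y = R y" "R 0 = 1"
    unfolding half_line_solution_iff p by blast
  show "AE y\<in>{0<..} in lborel. f y = \<phi> y"
    using R(2) by (rule eventually_mono) (use H2_rep_homogeneous(1)[OF R(1)] R(3) in auto)
qed

lemma L2_norm_decaying_le:
  assumes b: "b > 0" and r: "r > 0" and E: "norm (EE w (of_real r) b) \<ge> 1"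
    and u: "\<And>t. t \<in> {0..b} \<Longrightarrow> norm (cc w t + of_real r * ss w t) \<le> K * norm (EE w (of_real r) b)"
    and K: "K \<ge> 1" and f: "AE y\<in>{0<..} in lborel. f y = decaying w (of_real r) b y"
  shows "L2_norm_on {0<..} f \<le> sqrt (K\<^sup>2 * (b + 1 / (2 * r)))"
proof -
  define h where "h y = K\<^sup>2 * (indicator {0..b} y + indicator {b..} y * exp (- (2 * r) * (y - b)))" for y
  have hi: "has_bochner_integral lborel h (K\<^sup>2 * (b + 1 / (2 * r)))"
    unfolding h_def using b r
    by (intro has_bochner_integral_mult_right has_bochner_integral_add integral_exp_decay)
      (auto simp: has_bochner_integral_iff)
  have "(LINT y:{0<..}|lborel. (norm (f y))\<^sup>2) \<le> (LINT y|lborel. h y)"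
    unfolding set_lebesgue_integral_def
  proof (rule integral_mono_AE')
    show "integrable lborel h" using hi by (simp add: has_bochner_integral_iff)
    show "AE y in lborel. indicator {0<..} y *\<^sub>R (norm (f y))\<^sup>2 \<le> h y"
      using f
    proof (rule eventually_mono)
      fix y assume y: "y \<in> {0<..} \<longrightarrow> f y = decaying w (of_real r) b y"
      show "indicator {0<..} y *\<^sub>R (norm (f y))\<^sup>2 \<le> h y"
      proof (cases "y > 0")
        case True
        then show ?thesis
          using decaying_bound[OF b r E u K, of y] y unfolding h_def by simp
      next
        case False
        then show ?thesis by (simp add: h_def)
      qed
    qed
    show "AE y in lborel. 0 \<le> h y"
      by (simp add: h_def)
  qed
  also have "\<dots> = K\<^sup>2 * (b + 1 / (2 * r))"
    using hi by (rule has_bochner_integral_integral_eq)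
  finally show ?thesis
    unfolding L2_norm_on_def by (rule real_sqrt_le_mono)
qed

lemma decaying_ne_0:
  assumes "EE w \<kappa> b \<noteq> 0"
  shows "decaying w \<kappa> b (b + 1) \<noteq> 0"
  using assms by (simp add: decaying_def join_def)

text \<open>The number 0 is in the spectrum because of the eigenfunction, while every small non-zero
  \<open>z\<close> is in the resolvent set because the characteristic functions have isolated
  zeros.\<close>

lemma resonance_spectral:
  assumes b: "b > 0" and k: "k \<ge> 1" and lam: "lam < 1"
    and w: "w\<^sup>2 = of_real ((real k)\<^sup>2 * (1 - \<beta>))" "EE w (of_real (k * sqrt (1 - lam))) b \<noteq> 0"
      "2 * NN w (of_real (k * sqrt (1 - lam))) b = of_real ((real k)\<^sup>2 * \<alpha>) * EE w (of_real (k * sqrt (1 - lam))) b"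
  shows "isolated_simple_eigenvalue (L_dom \<alpha> k) (L_op b \<beta> k lam) 0"
    and "L2.span {\<phi>} = kernel (L_dom \<alpha> k) (L_op b \<beta> k lam) \<Longrightarrow> cinner_L2 (mult_L2 (V0 b) \<phi>) \<phi> \<noteq> 0"
proof -
  define r where "r = k * sqrt (1 - lam)"
  have r: "r > 0" using k lam by (simp add: r_def)
  have r2: "r\<^sup>2 = (real k)\<^sup>2 * (1 - lam)" using lam by (simp add: r_def power_mult_distrib)
  have w2: "w\<^sup>2 = of_real ((real k)\<^sup>2 * (1 - \<beta>)) - 0" "(of_real r)\<^sup>2 = of_real ((real k)\<^sup>2 * (1 - lam)) - (0 :: complex)"
    using w(1) by (simp_all flip: r2)
  have Re: "Re (of_real r) > 0" using r by simp
  note E = w(2)[folded r_def] and res = w(3)[folded r_def]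
  obtain M where "schroedinger (step_pot b (w\<^sup>2) ((of_real r)\<^sup>2)) (decaying w (of_real r) b) (decaying1 w (of_real r) b)
    (dirichlet w (of_real r) b) (dirichlet1 w (of_real r) b) (Re (of_real r)) M (norm (w\<^sup>2) + norm ((of_real r :: complex)\<^sup>2)) b \<beta> lam k 0"
    using schroedinger_step[OF b Re E w2] .
  then interpret schroedinger "step_pot b (w\<^sup>2) ((of_real r)\<^sup>2)" "decaying w (of_real r) b" "decaying1 w (of_real r) b"
    "dirichlet w (of_real r) b" "dirichlet1 w (of_real r) b" "Re (of_real r)" M "norm (w\<^sup>2) + norm ((of_real r :: complex)\<^sup>2)" b \<beta> lam \<alpha> k 0 .
  have ev: "2 * decaying1 w (of_real r) b 0 + of_real ((real k)\<^sup>2 * \<alpha>) = 0"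
  proof -
    have "2 * decaying1 w (of_real r) b 0 = - (2 * NN w (of_real r) b) / EE w (of_real r) b"
      unfolding decaying1_0[OF b] by simp
    then show ?thesis
      unfolding res using E by simp
  qed
  have real: "cnj (step_pot b (w\<^sup>2) ((of_real r)\<^sup>2) y) = step_pot b (w\<^sup>2) ((of_real r)\<^sup>2) y" for y
    unfolding w(1) by (simp add: step_pot_def)
  obtain \<delta> where \<delta>: "\<delta> > 0" "\<And>z. z \<noteq> 0 \<Longrightarrow> norm z < \<delta> \<Longrightarrow> \<exists>w \<kappa>. Re \<kappa> > 0 \<and> w\<^sup>2 = of_real ((real k)\<^sup>2 * (1 - \<beta>)) - z \<and>
      \<kappa>\<^sup>2 = of_real (r\<^sup>2) - z \<and> EE w \<kappa> b \<noteq> 0 \<and> 2 * NN w \<kappa> b \<noteq> of_real ((real k)\<^sup>2 * \<alpha>) * EE w \<kappa> b"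
    by (rule characteristic_zeros_isolated[OF b r, where P = "(real k)\<^sup>2 * (1 - \<beta>)" and \<gamma> = "(real k)\<^sup>2 * \<alpha>"]) blast
  have "z \<in> resolvent_set (L_dom \<alpha> k) (L_op b \<beta> k lam)" if z: "z \<noteq> 0" "norm z < \<delta>" for z
  proof -
    obtain w \<kappa> where "Re \<kappa> > 0" "w\<^sup>2 = of_real ((real k)\<^sup>2 * (1 - \<beta>)) - z"
      "\<kappa>\<^sup>2 = of_real ((real k)\<^sup>2 * (1 - lam)) - z" "EE w \<kappa> b \<noteq> 0" "2 * NN w \<kappa> b \<noteq> of_real ((real k)\<^sup>2 * \<alpha>) * EE w \<kappa> b"
      using \<delta>(2)[OF z] unfolding r2 by blast
    then show ?thesis by (intro step_resolvent[OF b])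
  qed
  then have "ball 0 \<delta> \<inter> spectrum (L_dom \<alpha> k) (L_op b \<beta> k lam) = {0}"
    using \<delta>(1) resonance_in_spectrum[OF ev] by (auto simp: spectrum_def) blast
  then have "0 isolated_in spectrum (L_dom \<alpha> k) (L_op b \<beta> k lam)"
    unfolding isolated_in_def using resonance_in_spectrum[OF ev] by (intro conjI exI[of _ "ball 0 \<delta>"]) auto
  then show "isolated_simple_eigenvalue (L_dom \<alpha> k) (L_op b \<beta> k lam) 0"
    unfolding isolated_simple_eigenvalue_def using simple_eigenvalue_resonance[OF ev real] by simp
  assume "L2.span {\<phi>} = kernel (L_dom \<alpha> k) (L_op b \<beta> k lam)"
  then have "L2.span {\<phi>} = {u \<in> L_dom \<alpha> k. L_op b \<beta> k lam u - 0 *\<^sub>C u = 0}"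
    by (simp add: kernel_def)
  then show "cinner_L2 (mult_L2 (V0 b) \<phi>) \<phi> \<noteq> 0"
    by (rule V0_form_nonzero[OF ev less_imp_le[OF b] decaying_ne_0[OF E]])
qed

text \<open>\<open>g\<close> is the resonant coupling for this k and lam; as \<open>EE\<close> and k
  are non-zero, any other coupling violates the resonance condition.\<close>

lemma nonresonant_resolvent:
  assumes "b > 0" "k \<ge> 1" and lam: "lam < 1"
    and w: "w\<^sup>2 = of_real ((real k)\<^sup>2 * (1 - \<beta>))" "EE w (of_real (k * sqrt (1 - lam))) b \<noteq> 0"
      "2 * NN w (of_real (k * sqrt (1 - lam))) b = of_real ((real k)\<^sup>2 * g) * EE w (of_real (k * sqrt (1 - lam))) b"
    and ne: "g \<noteq> \<alpha>"
  shows "0 \<in> resolvent_set (L_dom \<alpha> k) (L_op b \<beta> k lam)"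
proof (rule step_resolvent[OF assms(1) _ w(2)])
  show "Re (complex_of_real (k * sqrt (1 - lam))) > 0"
    using assms by simp
  show "w\<^sup>2 = of_real ((real k)\<^sup>2 * (1 - \<beta>)) - 0" using w(1) by simp
  have "(real k * sqrt (1 - lam))\<^sup>2 = (real k)\<^sup>2 * (1 - lam)"
    using lam by (simp add: power_mult_distrib)
  then show "(complex_of_real (k * sqrt (1 - lam)))\<^sup>2 = of_real ((real k)\<^sup>2 * (1 - lam)) - 0"
    by (simp only: of_real_power[symmetric] diff_zero)
  show "2 * NN w (of_real (k * sqrt (1 - lam))) b \<noteq> of_real ((real k)\<^sup>2 * \<alpha>) * EE w (of_real (k * sqrt (1 - lam))) b"
    unfolding w(3) using w(2) ne assms(2) by simp
qed

lemma half_line_solutions_step: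
  assumes b: "b > 0" and k: "k \<ge> 1" and lam: "lam < 1"
    and w: "w\<^sup>2 = of_real ((real k)\<^sup>2 * (1 - \<beta>))" "EE w (of_real (k * sqrt (1 - lam))) b \<noteq> 0"
  shows "half_line_solution b \<beta> k lam (decaying w (of_real (k * sqrt (1 - lam))) b)"
    and "half_line_solution b \<beta> k lam f \<Longrightarrow> AE y\<in>{0<..} in lborel. f y = decaying w (of_real (k * sqrt (1 - lam))) b y"
proof -
  define r where "r = k * sqrt (1 - lam)"
  have r: "Re (of_real r) > 0" using k lam by (simp add: r_def)
  have r2: "r\<^sup>2 = (real k)\<^sup>2 * (1 - lam)" using lam by (simp add: r_def power_mult_distrib)
  have w2: "w\<^sup>2 = of_real ((real k)\<^sup>2 * (1 - \<beta>)) - 0" "(of_real r)\<^sup>2 = of_real ((real k)\<^sup>2 * (1 - lam)) - (0 :: complex)"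
    using w(1) by (simp_all flip: r2)
  note E = w(2)[folded r_def]
  obtain M where "schroedinger (step_pot b (w\<^sup>2) ((of_real r)\<^sup>2)) (decaying w (of_real r) b) (decaying1 w (of_real r) b)
    (dirichlet w (of_real r) b) (dirichlet1 w (of_real r) b) (Re (of_real r)) M (norm (w\<^sup>2) + norm ((of_real r :: complex)\<^sup>2)) b \<beta> lam k 0"
    using schroedinger_step[OF b r E w2] .
  note sol = schroedinger.half_line_solutions[OF this refl, folded r_def]
  show "half_line_solution b \<beta> k lam (decaying w (of_real (k * sqrt (1 - lam))) b)"
    using sol(1) by (simp only: r_def)
  show "half_line_solution b \<beta> k lam f \<Longrightarrow> AE y\<in>{0<..} in lborel. f y = decaying w (of_real (k * sqrt (1 - lam))) b y"
    using sol(2) by (simp only: r_def)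
qed

theorem corollary2p14:
  fixes b \<beta> \<alpha> lam_star :: real and k_star :: nat
  assumes "b > 0" and "k_star \<ge> 1" and "lam_star < 1"
    and cases:
      "(\<beta> > 1 \<and> b = pi / sqrt (\<beta> - 1) \<and> \<alpha> = 2 * sqrt (1 - lam_star) / real k_star) \<or>
       (\<beta> < 1 \<and>
        \<alpha> = 2 * sqrt (1 - \<beta>) / real k_star *
          ((sqrt (1 - \<beta>) * sinh (real k_star * sqrt (1 - \<beta>) * b)
            + sqrt (1 - lam_star) * cosh (real k_star * sqrt (1 - \<beta>) * b)) /
           (sqrt (1 - \<beta>) * cosh (real k_star * sqrt (1 - \<beta>) * b)
            + sqrt (1 - lam_star) * sinh (real k_star * sqrt (1 - \<beta>) * b)))) \<or>
       (\<beta> = 1 \<and> \<alpha> = 2 * sqrt (1 - lam_star) / (real k_star * (1 + sqrt (1 - lam_star) * real k_star * b)))"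
  shows "L_infinity (V0 b) \<and> L_infinity (W b \<beta>) \<and>
      (\<forall>y. V0 b (- y) = V0 b y) \<and> (\<forall>y. W b \<beta> (- y) = W b \<beta> y) \<and>
    (\<exists>I. is_interval I \<and>
      (\<forall>k\<ge>1. \<forall>lam\<in>I. 0 \<in> resolvent_set L0_dom (L0_op b \<beta> k lam)) \<and>
      (\<exists>J. open J \<and> is_interval J \<and> J \<subseteq> I \<and> lam_star \<in> J \<and>
        isolated_simple_eigenvalue (L_dom \<alpha> k_star) (L_op b \<beta> k_star lam_star) 0 \<and>
        (\<forall>k\<ge>1. \<forall>lam\<in>J. (k, lam) \<noteq> (k_star, lam_star) \<longrightarrow>
          0 \<in> resolvent_set (L_dom \<alpha> k) (L_op b \<beta> k lam)) \<and>
        (\<forall>k\<ge>1. \<forall>lam\<in>J.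
          (\<exists>\<phi>. half_line_solution b \<beta> k lam \<phi>) \<and>
          (\<forall>\<phi> \<psi>. half_line_solution b \<beta> k lam \<phi> \<longrightarrow> half_line_solution b \<beta> k lam \<psi> \<longrightarrow>
            (AE y\<in>{0<..} in lborel. \<phi> y = \<psi> y))) \<and>
        (\<exists>C>0. \<forall>k\<ge>1. \<forall>lam\<in>J. \<forall>\<phi>. half_line_solution b \<beta> k lam \<phi> \<longrightarrow>
          L2_norm_on {0<..} \<phi> \<le> C))) \<and>
    (\<forall>\<phi>. L2.span {\<phi>} = kernel (L_dom \<alpha> k_star) (L_op b \<beta> k_star lam_star) \<longrightarrow>
      cinner_L2 (mult_L2 (V0 b) \<phi>) \<phi> \<noteq> 0)"
proof -
  \<comment> \<open>All resonance functions depend on lam only through s = sqrt (1 - lam), so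
    isolation is proved in s and transported back by continuity.\<close>
  define s0 where "s0 = sqrt (1 - lam_star)"
  have s0: "s0 > 0" using assms(3) by (simp add: s0_def)
  obtain G c where G: "resonance_data b \<beta> G c" and \<alpha>: "\<alpha> = G k_star s0"
  proof -
    consider "\<beta> > 1" "b = pi / sqrt (\<beta> - 1)" "\<alpha> = 2 * s0 / real k_star"
      | "\<beta> < 1" "\<alpha> = 2 * sqrt (1 - \<beta>) / real k_star *
          ((sqrt (1 - \<beta>) * sinh (real k_star * sqrt (1 - \<beta>) * b) + s0 * cosh (real k_star * sqrt (1 - \<beta>) * b)) /
           (sqrt (1 - \<beta>) * cosh (real k_star * sqrt (1 - \<beta>) * b) + s0 * sinh (real k_star * sqrt (1 - \<beta>) * b)))"
      | "\<beta> = 1" "\<alpha> = 2 * s0 / (real k_star * (1 + s0 * real k_star * b))"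
      using cases unfolding s0_def by blast
    then show thesis
    proof cases
      case 1
      show thesis by (rule that[OF resonance_data_oscillating[OF 1(1,2)] 1(3)])
    next
      case 2
      show thesis by (rule that[OF resonance_data_hyperbolic[OF 2(1) assms(1)] 2(2)])
    next
      case 3
      have "resonance_data b \<beta> (\<lambda>k s. 2 * s / (real k * (1 + s * real k * b))) 0"
        using resonance_data_linear[OF assms(1)] 3(1) by simp
      then show thesis
        by (rule that[of "\<lambda>k s. 2 * s / (real k * (1 + s * real k * b))", OF _ 3(2)])
    qed
  qed
  have c0: "c \<ge> 0" using G by (simp add: resonance_data_def)
  have dec: "G (Suc k) s < G k s" and pos: "G k s > 0" and inc: "s < s' \<Longrightarrow> G k s < G k s'" and cont: "isCont (G k) s"
    if "k \<ge> 1" "s > 0" for k s s'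
    using G that unfolding resonance_data_def by blast+
  have wex: "\<exists>w. w\<^sup>2 = of_real ((real k)\<^sup>2 * (1 - \<beta>)) \<and> norm (EE w (of_real (k * s)) b) \<ge> 1 \<and>
      2 * NN w (of_real (k * s)) b = of_real ((real k)\<^sup>2 * G k s) * EE w (of_real (k * s)) b \<and>
      (\<forall>t\<in>{0..b}. norm (cc w t + of_real (k * s) * ss w t) \<le> (1 + c * s) * norm (EE w (of_real (k * s)) b))"
    if "k \<ge> 1" "s > 0" for k :: nat and s :: real
    using G that unfolding resonance_data_def by blast
  obtain e where e: "e > 0" "e \<le> s0 / 2"
    "\<And>k s. k \<ge> 1 \<Longrightarrow> \<bar>s - s0\<bar> < e \<Longrightarrow> (k, s) \<noteq> (k_star, s0) \<Longrightarrow> G k s \<noteq> G k_star s0"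
    by (rule resonance_isolated[of G s0 k_star]) (use dec inc cont s0 assms(2) in auto)
  have "((\<lambda>lam. sqrt (1 - lam)) \<longlongrightarrow> sqrt (1 - lam_star)) (nhds lam_star)"
    by (intro tendsto_intros) (rule filterlim_ident)
  then have "\<forall>\<^sub>F lam in nhds lam_star. dist (sqrt (1 - lam)) s0 < e"
    unfolding s0_def using e(1) by (rule tendstoD)
  then obtain d where d: "d > 0" "\<And>lam. dist lam lam_star < d \<Longrightarrow> dist (sqrt (1 - lam)) s0 < e"
    unfolding eventually_nhds_metric by blast
  define J where "J = {lam_star - d<..<lam_star + d}"
  \<comment> \<open>Since e \<le> s0 / 2, the decay rate k s stays above s0 / 2 for all k and all
    lam in \<open>J\<close>; positivity of the root also gives lam < 1.\<close>
  have sJ: "\<bar>sqrt (1 - lam) - s0\<bar> < e" "s0 / 2 < sqrt (1 - lam)" "sqrt (1 - lam) < 2 * s0" "lam < 1" if "lam \<in> J" for lam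
  proof -
    have "dist lam lam_star < d" using that by (auto simp: J_def dist_real_def)
    then show 1: "\<bar>sqrt (1 - lam) - s0\<bar> < e" using d(2) by (simp add: dist_real_def)
    then show 2: "s0 / 2 < sqrt (1 - lam)" "sqrt (1 - lam) < 2 * s0" using e(2) s0 by linarith+
    then have "sqrt (1 - lam) > 0" using s0 by linarith
    then show "lam < 1" by simp
  qed
  have spos: "sqrt (1 - lam) > 0" if "lam \<in> J" for lam
    using sJ(4)[OF that] by simp
  have lamJ: "lam_star \<in> J" using d(1) by (simp add: J_def)
  have a: "L_infinity (V0 b)" "L_infinity (W b \<beta>)"
    unfolding L_infinity_def
    by (auto intro!: exI[of _ "max 1 \<bar>\<beta>\<bar>"] AE_I2 simp: V0_def W_def indicator_def)
  \<comment> \<open>The free operator is the case \<alpha> = 0, which is never resonant since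
    \<open>G\<close> is positive.\<close>
  have bI: "0 \<in> resolvent_set L0_dom (L0_op b \<beta> k lam)" if k: "k \<ge> 1" and lam: "lam \<in> J" for k lam
  proof -
    obtain w where w: "w\<^sup>2 = of_real ((real k)\<^sup>2 * (1 - \<beta>))" "norm (EE w (of_real (k * sqrt (1 - lam))) b) \<ge> 1"
      "2 * NN w (of_real (k * sqrt (1 - lam))) b = of_real ((real k)\<^sup>2 * G k (sqrt (1 - lam))) * EE w (of_real (k * sqrt (1 - lam))) b"
      using wex[OF k spos[OF lam]] by blast
    have "EE w (of_real (k * sqrt (1 - lam))) b \<noteq> 0" using w(2) by auto
    then show ?thesis
      unfolding resolvent_set_L0[of b \<beta> k lam]
      using pos[OF k spos[OF lam]]
      by (intro nonresonant_resolvent[OF assms(1) k sJ(4)[OF lam] w(1) _ w(3)]) auto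
  qed
  have cI: "0 \<in> resolvent_set (L_dom \<alpha> k) (L_op b \<beta> k lam)"
    if k: "k \<ge> 1" and lam: "lam \<in> J" and ne: "(k, lam) \<noteq> (k_star, lam_star)" for k lam
  proof -
    obtain w where w: "w\<^sup>2 = of_real ((real k)\<^sup>2 * (1 - \<beta>))" "norm (EE w (of_real (k * sqrt (1 - lam))) b) \<ge> 1"
      "2 * NN w (of_real (k * sqrt (1 - lam))) b = of_real ((real k)\<^sup>2 * G k (sqrt (1 - lam))) * EE w (of_real (k * sqrt (1 - lam))) b"
      using wex[OF k spos[OF lam]] by blast
    have E: "EE w (of_real (k * sqrt (1 - lam))) b \<noteq> 0" using w(2) by auto
    have "(k, sqrt (1 - lam)) \<noteq> (k_star, s0)"
      using ne by (auto simp: s0_def)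
    then have "G k (sqrt (1 - lam)) \<noteq> \<alpha>"
      unfolding \<alpha> by (rule e(3)[OF k sJ(1)[OF lam]])
    then show ?thesis
      by (rule nonresonant_resolvent[OF assms(1) k sJ(4)[OF lam] w(1) E w(3)])
  qed
  obtain w0 where w0: "w0\<^sup>2 = of_real ((real k_star)\<^sup>2 * (1 - \<beta>))" "norm (EE w0 (of_real (k_star * s0)) b) \<ge> 1"
    "2 * NN w0 (of_real (k_star * s0)) b = of_real ((real k_star)\<^sup>2 * G k_star s0) * EE w0 (of_real (k_star * s0)) b"
    using wex[OF assms(2) s0] by blast
  have E0: "EE w0 (of_real (k_star * s0)) b \<noteq> 0" using w0(2) by auto
  note spec = resonance_spectral[OF assms(1-3) w0(1) E0[unfolded s0_def] w0(3)[folded \<alpha>, unfolded s0_def]]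
  have sol: "(\<exists>\<phi>. half_line_solution b \<beta> k lam \<phi>) \<and>
      (\<forall>\<phi> \<psi>. half_line_solution b \<beta> k lam \<phi> \<longrightarrow> half_line_solution b \<beta> k lam \<psi> \<longrightarrow>
        (AE y\<in>{0<..} in lborel. \<phi> y = \<psi> y))"
    and bnd: "half_line_solution b \<beta> k lam \<phi> \<Longrightarrow> L2_norm_on {0<..} \<phi> \<le> sqrt ((1 + c * (2 * s0))\<^sup>2 * (b + 1 / s0))"
    if k: "k \<ge> 1" and lam: "lam \<in> J" for k lam \<phi>
  proof -
    define s where "s = sqrt (1 - lam)"
    have s: "s > 0" "s0 / 2 < s" "s < 2 * s0" using spos[OF lam] sJ[OF lam] by (auto simp: s_def)
    obtain w where w: "w\<^sup>2 = of_real ((real k)\<^sup>2 * (1 - \<beta>))" "norm (EE w (of_real (k * s)) b) \<ge> 1"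
      "\<And>t. t \<in> {0..b} \<Longrightarrow> norm (cc w t + of_real (k * s) * ss w t) \<le> (1 + c * s) * norm (EE w (of_real (k * s)) b)"
      using wex[OF k s(1)] by blast
    have E: "EE w (of_real (k * sqrt (1 - lam))) b \<noteq> 0" using w(2) by (auto simp: s_def)
    note sol = half_line_solutions_step[OF assms(1) k sJ(4)[OF lam] w(1) E, folded s_def]
    show "(\<exists>\<phi>. half_line_solution b \<beta> k lam \<phi>) \<and>
      (\<forall>\<phi> \<psi>. half_line_solution b \<beta> k lam \<phi> \<longrightarrow> half_line_solution b \<beta> k lam \<psi> \<longrightarrow>
        (AE y\<in>{0<..} in lborel. \<phi> y = \<psi> y))"
    proof (intro conjI allI impI)
      show "\<exists>\<phi>. half_line_solution b \<beta> k lam \<phi>" using sol(1) by blast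
      fix \<phi> \<psi> assume h: "half_line_solution b \<beta> k lam \<phi>" "half_line_solution b \<beta> k lam \<psi>"
      show "AE y\<in>{0<..} in lborel. \<phi> y = \<psi> y"
        using sol(2)[OF h(1)] sol(2)[OF h(2)] by eventually_elim auto
    qed
    assume h: "half_line_solution b \<beta> k lam \<phi>"
    have r: "k * s > 0" using k s by simp
    have K1: "1 + c * s \<ge> 1" using c0 s by simp
    have "L2_norm_on {0<..} \<phi> \<le> sqrt ((1 + c * s)\<^sup>2 * (b + 1 / (2 * (k * s))))"
      by (rule L2_norm_decaying_le[OF assms(1) r w(2,3) K1 sol(2)[OF h]])
    \<comment> \<open>Uniformity: s < 2 s0 controls the interior factor, and 2 k s \<ge> s0 controls
      the exponential tail for every k.\<close>
    also have "\<dots> \<le> sqrt ((1 + c * (2 * s0))\<^sup>2 * (b + 1 / s0))"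
    proof (rule real_sqrt_le_mono, rule mult_mono)
      have "c * s \<le> c * (2 * s0)" using c0 s by (intro mult_left_mono) auto
      then show "(1 + c * s)\<^sup>2 \<le> (1 + c * (2 * s0))\<^sup>2" using K1 by (intro power_mono) auto
      have "1 * s \<le> k * s" using k s by (intro mult_right_mono) auto
      then have "s0 \<le> 2 * (k * s)" using s by linarith
      then show "b + 1 / (2 * (k * s)) \<le> b + 1 / s0" using s0 by (simp add: frac_le)
      show "0 \<le> (1 + c * (2 * s0))\<^sup>2" by simp
      show "0 \<le> b + 1 / (2 * (k * s))" using assms(1) r by simp
    qed
    finally show "L2_norm_on {0<..} \<phi> \<le> sqrt ((1 + c * (2 * s0))\<^sup>2 * (b + 1 / s0))" .
  qed
  have Cpos: "sqrt ((1 + c * (2 * s0))\<^sup>2 * (b + 1 / s0)) > 0"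
  proof -
    have "1 + c * (2 * s0) > 0" using c0 s0 by (intro add_pos_nonneg) auto
    then show ?thesis using assms(1) s0 by (simp add: add_pos_pos)
  qed
  have J: "open J" "is_interval J" by (simp_all add: J_def is_interval_oo)
  have C: "\<exists>C>0. \<forall>k\<ge>1. \<forall>lam\<in>J. \<forall>\<phi>. half_line_solution b \<beta> k lam \<phi> \<longrightarrow> L2_norm_on {0<..} \<phi> \<le> C"
    using Cpos bnd by blast
  show ?thesis
    \<comment> \<open>Both intervals, the one for the free operator and the one around
      \<open>lam_star\<close>, are taken to be \<open>J\<close>.\<close>
    by (intro conjI exI[of _ J] a C J lamJ spec(1) subset_refl allI ballI impI)
      (use V0_minus W_minus bI cI sol spec(2) in blast)+
qed

end
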